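(* Let $\mathcal I=(-1,1)$ and let $\mathcal B\subset L^2(\mathcal I,\mathbb R^{q})$, $q=m+p$, be a linear differential behavior with lag $\mathfrak l(\mathcal B)$. Put $$J(w)=\|y\|^2+\|u^{(\mathfrak l(\mathcal B))}\|^2,\qquad w=\operatorname{col}(u,y)\in\mathcal B,$$ with $L^2$-norms, and let $\xi^0\in\mathbb R^{\mathfrak l(\mathcal B)q}$ be the prescribed initial value. For given approximation order $N\in\mathbb N$, let $w^\star$ be the solution of $$(\mathrm P)\quad \operatorname*{minimize}_{w\in\mathcal B\cap H^{\mathfrak l(\mathcal B)}(\mathcal I,\mathbb R^q)}J(w)\quad\text{s.t. }\Lambda_{\mathfrak l(\mathcal B)}(w)(-1)=\xi^0$$ and let $w^N$ be the solution of $$(\mathrm P_N)\quad \operatorname*{minimize}_{w\in\mathcal B\cap\operatorname{im}P_N}J(w)\quad\text{s.t. }\Lambda_{\mathfrak l(\mathcal B)}(w)(-1)=\xi^0 .$$ Then for every $k\in\mathbb N$ one has $$0\le J(w^N)-J(w^\star)=\mathcal O(N^{-k})\qquad\text{and}\qquad \|w^\star-w^N\|=\mathcal O(N^{-k})$$ as $N\to\infty$, where $\|\cdot\|$ is the $L^2$-norm.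
   Context: $\mathbb N$ includes $0$; $\mathcal I=(-1,1)$. $H^k(\mathcal I,\mathbb R^d)$ is the Sobolev space of order $k$ based on $L^2$. For $f\in H^{k-1}(\mathcal I,\mathbb R^d)$, $\Lambda_k(f)=\operatorname{col}(f,f^{(1)},\dots,f^{(k-1)})$ (vertical stacking; for $k=0$ it is empty and the corresponding initial condition is void). $\operatorname{im}P_N$ is the space of $\mathbb R^{q}$-valued polynomial functions on $\mathcal I$ of degree at most $N-1$ (the image of the orthogonal projection $P_N$ that truncates the Legendre expansion after the first $N$ terms). A linear differential behavior is a set $\mathcal B=\{w\in L^2(\mathcal I,\mathbb R^q)\mid R(\frac{d}{dt})w=0\}$ with $R(s)=R_0+\dots+R_rs^r\in\mathbb R^{g\times q}[s]$, where $R(\frac{d}{dt})w=0$ is meant weakly: $\sum_{i=0}^r(-1)^i\int_{\mathcal I}w^\top R_i^\top\phi^{(i)}\,dt=0$ for all $\phi\in C_c^\infty(\mathcal I,\mathbb R^g)$. Trajectories are partitioned as $w=\operatorname{col}(u,y)$ with input $u$ ($m$ components) and output $y$ ($p$ components), and $\mathcal B$ admits an input-state-output representation: matrices $A\in\mathbb R^{n\times n}$, $B\in\mathbb R^{n\times m}$, $C\in\mathbb R^{p\times n}$, $D\in\mathbb R^{p\times m}$ such that $w=\operatorname{col}(u,y)\in C^\infty(\overline{\mathcal I},\mathbb R^q)$ belongs to $\mathcal B$ if and only if there is $x\in C^\infty(\overline{\mathcal I},\mathbb R^n)$ with $\frac{d}{dt}x=Ax+Bu$, $y=Cx+Du$.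 With $\mathcal O_k=\operatorname{col}(C,CA,\dots,CA^k)$ (and $\mathcal O_{-1}$ the empty matrix, of rank $0$), the lag is $\mathfrak l(\mathcal B)=\min\{k\in\mathbb N\mid \operatorname{rank}\mathcal O_k=\operatorname{rank}\mathcal O_{k-1}\}$, an invariant of $\mathcal B$. *)

theory Defs
  imports
    "HOL-Analysis.Analysis"
    "HOL-Library.Landau_Symbols"
    "HOL-Computational_Algebra.Polynomial"
begin

section \<open>Square-integrable functions on the interval (-1,1)\<close>

abbreviation Iv :: "real set" where
  "Iv \<equiv> {-1<..<1}"

text \<open>
  Elements of \<open>L\<^sup>2\<close> are represented by functions on the real line whose values outside
  \<open>Iv\<close> are irrelevant. All notions below only depend on the a.e.-equivalence class on \<open>Iv\<close>.
\<close>

definition L2 :: "(real \<Rightarrow> 'a::euclidean_space) set" where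
  "L2 = {f. f \<in> borel_measurable (lebesgue_on Iv) \<and> integrable (lebesgue_on Iv) (\<lambda>t. (norm (f t))\<^sup>2)}"

definition L2_norm :: "(real \<Rightarrow> 'a::euclidean_space) \<Rightarrow> real" where
  "L2_norm f = sqrt (integral\<^sup>L (lebesgue_on Iv) (\<lambda>t. (norm (f t))\<^sup>2))"

section \<open>Smooth functions, test functions, Sobolev spaces\<close>

text \<open>
  Iterated derivative relative to \<open>S\<close>, used for \<open>S = UNIV\<close> and for \<open>S = {-1..1}\<close> (one-sided
  derivatives at the end points).
\<close>

definition nderiv :: "real set \<Rightarrow> nat \<Rightarrow> (real \<Rightarrow> 'a::real_normed_vector) \<Rightarrow> real \<Rightarrow> 'a" where
  "nderiv S k = (\<lambda>f t. vector_derivative f (at t within S)) ^^ k"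

definition smooth_on :: "real set \<Rightarrow> (real \<Rightarrow> 'a::real_normed_vector) \<Rightarrow> bool" where
  "smooth_on S f \<longleftrightarrow> (\<forall>k. nderiv S k f differentiable_on S)"

definition test_functions :: "(real \<Rightarrow> 'a::real_normed_vector) set" where
  "test_functions = {\<phi>. smooth_on UNIV \<phi> \<and> (\<exists>K. compact K \<and> K \<subseteq> Iv \<and> (\<forall>t. t \<notin> K \<longrightarrow> \<phi> t = 0))}"

definition has_weak_deriv :: "nat \<Rightarrow> (real \<Rightarrow> 'a::euclidean_space) \<Rightarrow> (real \<Rightarrow> 'a) \<Rightarrow> bool" where
  "has_weak_deriv k f g \<longleftrightarrow>
     (\<forall>\<phi>::real \<Rightarrow> real. \<phi> \<in> test_functions \<longrightarrow>
        integral\<^sup>L (lebesgue_on Iv) (\<lambda>t. nderiv UNIV k \<phi> t *\<^sub>R f t) =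
        (- 1) ^ k *\<^sub>R integral\<^sup>L (lebesgue_on Iv) (\<lambda>t. \<phi> t *\<^sub>R g t))"

definition sobolev :: "nat \<Rightarrow> (real \<Rightarrow> 'a::euclidean_space) set" where
  "sobolev k = {f \<in> L2. \<forall>i\<le>k. \<exists>g\<in>L2. has_weak_deriv i f g}"

text \<open>A representative of the (a.e. unique) weak derivative of order \<open>k\<close>.\<close>

definition weak_deriv :: "nat \<Rightarrow> (real \<Rightarrow> 'a::euclidean_space) \<Rightarrow> real \<Rightarrow> 'a" where
  "weak_deriv k f = (SOME g. g \<in> L2 \<and> has_weak_deriv k f g)"

text \<open>Value at \<open>-1\<close> of the (unique) representative that is continuous up to the boundary.\<close>

definition trace_left :: "(real \<Rightarrow> 'a::euclidean_space) \<Rightarrow> 'a" where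
  "trace_left f = (THE c. \<exists>g. continuous_on {-1..1} g \<and> (AE t in lebesgue_on Iv. g t = f t) \<and> g (-1) = c)"

text \<open>
  The stacked vector \<open>col (f (-1), f\<^sup>(\<^sup>1\<^sup>) (-1), \<dots>, f\<^sup>(\<^sup>k\<^sup>-\<^sup>1\<^sup>) (-1))\<close> as the list of its \<open>k\<close> blocks;
  meaningful for \<open>f\<close> in the Sobolev space of order \<open>k\<close>.
\<close>

definition Lambda_left :: "nat \<Rightarrow> (real \<Rightarrow> 'a::euclidean_space) \<Rightarrow> 'a list" where
  "Lambda_left k f = map (\<lambda>i. trace_left (weak_deriv i f)) [0..<k]"

text \<open>Polynomial functions of degree at most \<open>N - 1\<close>; only the zero function for \<open>N = 0\<close>.\<close>

definition im_P :: "nat \<Rightarrow> (real \<Rightarrow> 'a::euclidean_space) set" where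
  "im_P N = {w. \<exists>c. AE t in lebesgue_on Iv. w t = (\<Sum>j<N. t ^ j *\<^sub>R c j)}"

section \<open>Linear differential behaviors\<close>

definition behavior :: "(real^'q^'g) poly \<Rightarrow> (real \<Rightarrow> real^'q) set" where
  "behavior R = {w \<in> L2. \<forall>\<phi>\<in>test_functions.
     (\<Sum>i\<le>degree R. (- 1) ^ i *
        integral\<^sup>L (lebesgue_on Iv) (\<lambda>t. w t \<bullet> (transpose (coeff R i) *v nderiv UNIV i \<phi> t))) = 0}"

text \<open>
  Trajectories \<open>w = col (u, y)\<close> are indexed by the sum type of the input and the output indices.
  Since index types are nonempty, there is at least one input, output and state component. This is
  no restriction: a free input that enters neither state nor output, an output constrained to be
  zero, or a state component with zero dynamics, input and output matrices may always be added
  without changing the lag.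
\<close>

definition inp :: "(real \<Rightarrow> real^('m::finite + 'p::finite)) \<Rightarrow> real \<Rightarrow> real^'m" where
  "inp w t = (\<chi> i. w t $ Inl i)"

definition outp :: "(real \<Rightarrow> real^('m::finite + 'p::finite)) \<Rightarrow> real \<Rightarrow> real^'p" where
  "outp w t = (\<chi> i. w t $ Inr i)"

definition iso_representation ::
  "real^'n^'n \<Rightarrow> real^'m^'n \<Rightarrow> real^'n^'p \<Rightarrow> real^'m^'p \<Rightarrow>
   (real \<Rightarrow> real^('m::finite + 'p::finite)) set \<Rightarrow> bool" where
  "iso_representation A B C D \<BB> \<longleftrightarrow>
     (\<forall>w. smooth_on {-1..1} w \<longrightarrow>
        (w \<in> \<BB> \<longleftrightarrow>
         (\<exists>x. smooth_on {-1..1} x \<and>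
           (\<forall>t\<in>{-1..1}.
              (x has_vector_derivative (A *v x t + B *v inp w t)) (at t within {-1..1}) \<and>
              outp w t = C *v x t + D *v inp w t))))"

text \<open>
  The number of block rows of the observability matrix \<open>col (C, CA, \<dots>, CA\<^sup>k)\<close> varies, so its
  rank is written as what \<open>rank\<close> unfolds to, the dimension of the span of its rows.
  The argument counts blocks: \<open>obs_rank A C k\<close> is the rank of \<open>col (C, CA, \<dots>, CA\<^sup>k\<^sup>-\<^sup>1)\<close>.
\<close>

definition obs_rank :: "real^'n^'n \<Rightarrow> real^'n^'p \<Rightarrow> nat \<Rightarrow> nat" where
  "obs_rank A C k = dim (\<Union>i<k. rows (((\<lambda>M. M ** A) ^^ i) C))"

definition lag :: "real^'n^'n \<Rightarrow> real^'n^'p \<Rightarrow> nat" where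
  "lag A C = (LEAST k. obs_rank A C (Suc k) = obs_rank A C k)"

section \<open>The optimal control problems\<close>

definition cost :: "nat \<Rightarrow> (real \<Rightarrow> real^('m::finite + 'p::finite)) \<Rightarrow> real" where
  "cost l w = (L2_norm (outp w))\<^sup>2 + (L2_norm (weak_deriv l (inp w)))\<^sup>2"

definition solves_P ::
  "(real \<Rightarrow> real^('m::finite + 'p::finite)) set \<Rightarrow> nat \<Rightarrow> (real^('m + 'p)) list \<Rightarrow>
   (real \<Rightarrow> real^('m + 'p)) \<Rightarrow> bool" where
  "solves_P \<BB> l \<xi> w \<longleftrightarrow>
     is_arg_min (cost l) (\<lambda>v. v \<in> \<BB> \<inter> sobolev l \<and> Lambda_left l v = \<xi>) w"

definition solves_PN ::
  "(real \<Rightarrow> real^('m::finite + 'p::finite)) set \<Rightarrow> nat \<Rightarrow> (real^('m + 'p)) list \<Rightarrow> nat \<Rightarrow>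
   (real \<Rightarrow> real^('m + 'p)) \<Rightarrow> bool" where
  "solves_PN \<BB> l \<xi> N w \<longleftrightarrow>
     is_arg_min (cost l) (\<lambda>v. v \<in> \<BB> \<inter> im_P N \<and> Lambda_left l v = \<xi>) w"

end

theory Submission
  imports Defs "HOL-Computational_Algebra.Polynomial_Factorial"
    "HOL-Computational_Algebra.Fundamental_Theorem_Algebra"
begin

text \<open>
  The first-order optimality condition, tested with compactly supported trajectories, and the
  equations of the behavior form a weak linear system with constant coefficients for the minimizer
  \<open>w\<close> of \<open>(P)\<close>. For positive lag its polynomial matrix has trivial kernel, hence every component of \<open>w\<close>
  satisfies a scalar weak differential equation with constant coefficients and is an entire function
  whose derivatives at \<open>-1\<close> grow at most exponentially.

  Let \<open>v\<close> be one feasible polynomial trajectory. The initial values of \<open>w - v\<close> vanish up to order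
  \<open>l\<close>, so by the definition of the lag it is the response to its input from the zero state (up to
  unobservable states). With \<open>\<theta> I = S (s I - A)\<close> it has an image representation: the input is \<open>\<theta>(d/dt) f\<close>
  and the state is \<open>(S B)(d/dt) f\<close> for an entire \<open>f\<close>. Truncating the Taylor series of \<open>f\<close> yields
  polynomial trajectories with the same initial values that converge to \<open>w - v\<close> geometrically.
  Finally \<open>J(w + h) = J(w) + J(h)\<close> for admissible smooth variations \<open>h\<close>, and \<open>J(h)\<close> dominates the
  squared \<open>L\<^sup>2\<close>-norm of \<open>h\<close> by Poincare's inequality.
\<close>

section \<open>Sequences as modules over polynomials\<close>

text \<open>The minimizer is a priori only in \<open>sobolev l\<close>, whereas the state space
  representation speaks of smooth trajectories alone. The weak equations are therefore taken from
  \<open>R\<close> and the variations from the state space; \<open>row_kernel\<close> ties the two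
  together by polynomial identities read off from derivatives at -1. The feasible polynomial
  trajectory is the solution of the discretized problem of order \<open>N0\<close>; this is where
  solvability from \<open>N0\<close> on enters beyond the comparison of costs. The base 2 of the
  geometric rate is a choice: Taylor coefficients of the functions involved decay factorially, so
  every base can be had. Lag 0 is treated apart: the penalty then has no advantage in degree, but
  the cost is the full squared norm, the initial condition is void, and every minimizer
  vanishes.\<close>

text \<open>
  Polynomials act on sequences with the indeterminate acting as the shift. On the sequence of
  derivatives of a function, \<open>P\<close> thus acts as the differential operator \<open>P(d/dt)\<close>.
\<close>

definition act :: "'a::comm_ring_1 poly \<Rightarrow> (nat \<Rightarrow> 'a) \<Rightarrow> nat \<Rightarrow> 'a" where
  "act P a k = (\<Sum>i\<le>degree P. coeff P i * a (i + k))"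

lemma act_eq_sum:
  assumes "degree P \<le> n"
  shows "act P a k = (\<Sum>i\<le>n. coeff P i * a (i + k))"
  unfolding act_def
  by (rule sum.mono_neutral_left) (use assms in \<open>auto simp: coeff_eq_0\<close>)

lemma act_0 [simp]: "act 0 a k = 0"
  by (simp add: act_def)

lemma act_pCons [simp]: "act (pCons c P) a k = c * a k + act P a (Suc k)"
proof -
  have "act (pCons c P) a k = (\<Sum>i\<le>Suc (degree P). coeff (pCons c P) i * a (i + k))"
    by (rule act_eq_sum) (simp add: degree_pCons_le)
  also have "\<dots> = c * a k + act P a (Suc k)"
    by (subst sum.atMost_Suc_shift) (simp add: act_def)
  finally show ?thesis .
qed

lemma act_add_left: "act (P + Q) a k = act P a k + act Q a k"
proof -
  let ?n = "max (degree P) (degree Q)"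
  have "degree (P + Q) \<le> ?n" by (rule degree_add_le_max)
  then show ?thesis
    by (simp add: act_eq_sum[where n = ?n] sum.distrib algebra_simps)
qed

lemma act_smult: "act (smult c P) a k = c * act P a k"
proof -
  have "degree (smult c P) \<le> degree P" by (rule degree_smult_le)
  then show ?thesis
    by (simp add: act_eq_sum[where n = "degree P"] sum_distrib_left mult.assoc)
qed

lemma act_minus_left: "act (- P) a k = - act P a k"
  using act_smult[of "-1" P a k] by simp

lemma act_diff_left: "act (P - Q) a k = act P a k - act Q a k"
  using act_add_left[of P "- Q" a k] by (simp add: act_minus_left)

lemma act_sum_left: "act (\<Sum>i\<in>I. P i) a k = (\<Sum>i\<in>I. act (P i) a k)"
  by (induction I rule: infinite_finite_induct) (auto simp: act_add_left)

lemma act_add_right: "act P (\<lambda>k. a k + b k) k = act P a k + act P b k"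
  by (simp add: act_def sum.distrib algebra_simps)

lemma act_cmult_right: "act P (\<lambda>k. c * a k) k = c * act P a k"
  by (simp add: act_def sum_distrib_left algebra_simps)

lemma act_zero_right [simp]: "act P (\<lambda>k. 0) k = 0"
  by (simp add: act_def)

lemma act_sum_right: "act P (\<lambda>k. \<Sum>i\<in>I. a i k) k = (\<Sum>i\<in>I. act P (a i) k)"
  by (induction I rule: infinite_finite_induct) (auto simp: act_add_right)

lemma act_mult: "act (P * Q) a k = act P (act Q a) k"
proof (induction P arbitrary: k)
  case (pCons c P)
  have "act (pCons c P * Q) a k = act (smult c Q) a k + act (pCons 0 (P * Q)) a k"
    by (simp only: mult_pCons_left act_add_left)
  then show ?case by (simp add: act_smult pCons)
qed simp

lemma act_monom: "act (monom c m) a k = c * a (m + k)"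
  by (induction m arbitrary: k) (simp_all add: monom_0 monom_Suc)

lemma act_delta: "act P (\<lambda>i. if i = m then 1 else 0) 0 = coeff P m"
proof -
  have "act P (\<lambda>i. if i = m then 1 else 0) 0 = (\<Sum>i\<le>degree P. if i = m then coeff P i else 0)"
    unfolding act_def by (intro sum.cong) auto
  then show ?thesis by (simp add: coeff_eq_0)
qed

text \<open>Unit impulses are dual to coefficients: at index 0, the impulse at \<open>m\<close>
  reads off coefficient \<open>m\<close>. This turns identities between derivative sequences into
  identities between polynomials.\<close>

lemma act_faithful:
  assumes "\<And>m. act P (\<lambda>i. if i = m then 1 else 0) 0 = act Q (\<lambda>i. if i = m then 1 else 0) 0"
  shows "P = Q"
  using assms by (simp add: act_delta poly_eq_iff)

lemma act_eq_0:
  assumes "\<And>i. i \<le> degree P \<Longrightarrow> a (i + k) = 0"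
  shows "act P a k = 0"
  using assms by (simp add: act_def)

text \<open>\<open>P(-s)\<close>, the symbol of the formal adjoint of \<open>P(d/dt)\<close>.\<close>

definition adj_poly :: "'a::comm_ring_1 poly \<Rightarrow> 'a poly" where
  "adj_poly P = pcompose P [:0, - 1:]"

lemma coeff_adj_poly: "coeff (adj_poly P) i = (- 1) ^ i * coeff P i"
  by (simp add: adj_poly_def coeff_pcompose_linear)

lemma adj_poly_mult: "adj_poly (P * Q) = adj_poly P * adj_poly Q"
  by (simp add: adj_poly_def pcompose_mult)

lemma adj_poly_adj_poly [simp]: "adj_poly (adj_poly P) = P"
  by (rule poly_eqI) (simp add: coeff_adj_poly flip: mult.assoc power_mult_distrib)

lemma adj_poly_0 [simp]: "adj_poly 0 = 0"
  by (simp add: adj_poly_def)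

lemma adj_poly_sum: "adj_poly (\<Sum>i\<in>I. P i) = (\<Sum>i\<in>I. adj_poly (P i))"
  by (rule poly_eqI) (simp add: coeff_adj_poly coeff_sum sum_distrib_left)

lemma adj_poly_eq_0_iff [simp]: "adj_poly P = 0 \<longleftrightarrow> P = 0"
  by (metis adj_poly_adj_poly adj_poly_0)

lemma degree_adj_poly [simp]: "degree (adj_poly P) = degree (P :: 'a::idom poly)"
proof -
  have "degree (adj_poly Q) \<le> degree Q" for Q :: "'a poly"
    by (rule degree_le) (simp add: coeff_adj_poly coeff_eq_0)
  from this[of P] this[of "adj_poly P"] show ?thesis by simp
qed

text \<open>A linear recurrence solved forward: the leading coefficient is invertible, so the
  equation at \<open>k\<close> determines the entry \<open>degree P + k\<close>. Zero initial
  entries select the solution starting from rest.\<close>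

lemma act_solve:
  fixes P :: "'a::field poly"
  assumes "P \<noteq> 0"
  obtains a where "\<And>i. i < degree P \<Longrightarrow> a i = 0" "\<And>k. act P a k = b k"
proof -
  let ?n = "degree P"
  define st where "st = (\<lambda>(f :: nat \<Rightarrow> 'a) k. if k < ?n then 0 else (b (k - ?n) - (\<Sum>i<?n. coeff P i * f (i + (k - ?n)))) / lead_coeff P)"
  define a where "a = wfrec less_than st"
  have adm: "adm_wf less_than st"
    unfolding adm_wf_def st_def by (auto intro!: sum.cong)
  have a: "a k = st a k" for k
    unfolding a_def by (subst wfrec_fixpoint[OF wf_less_than adm]) simp
  have "act P a k = b k" for k
  proof -
    have "act P a k = (\<Sum>i<?n. coeff P i * a (i + k)) + lead_coeff P * a (?n + k)"
      unfolding act_def by (simp flip: lessThan_Suc_atMost)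
    moreover have "a (?n + k) = (b k - (\<Sum>i<?n. coeff P i * a (i + k))) / lead_coeff P"
      by (subst a) (simp add: st_def)
    ultimately show ?thesis using assms by simp
  qed
  moreover have "a i = 0" if "i < ?n" for i
    by (subst a) (simp add: st_def that)
  ultimately show ?thesis by (rule that[rotated]) 
qed

section \<open>Sequences of exponential growth\<close>

text \<open>The derivative sequences of entire functions of exponential type. The class is stable
  under shifts and under solving recurrences, and it makes Taylor terms decay factorially.
  \<open>C\<close> and \<open>M\<close> are unrestricted here; \<open>exp_bddE\<close> normalizes
  them.\<close>

definition exp_bdd :: "(nat \<Rightarrow> 'a::real_normed_vector) \<Rightarrow> bool" where
  "exp_bdd a \<longleftrightarrow> (\<exists>C M. \<forall>k. norm (a k) \<le> C * M ^ k)"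

lemma exp_bddE:
  assumes "exp_bdd a"
  obtains C M where "C > 0" "M \<ge> 1" "\<And>k. norm (a k) \<le> C * M ^ k"
proof -
  from assms obtain C M where CM: "norm (a k) \<le> C * M ^ k" for k
    unfolding exp_bdd_def by blast
  have "norm (a k) \<le> (\<bar>C\<bar> + 1) * (\<bar>M\<bar> + 1) ^ k" for k
  proof -
    have "norm (a k) \<le> \<bar>C\<bar> * \<bar>M\<bar> ^ k"
      using CM[of k] abs_ge_self[of "C * M ^ k"] by (simp add: abs_mult power_abs)
    also have "\<dots> \<le> (\<bar>C\<bar> + 1) * (\<bar>M\<bar> + 1) ^ k"
      by (intro mult_mono power_mono) auto
    finally show ?thesis .
  qed
  then show ?thesis using that[of "\<bar>C\<bar> + 1" "\<bar>M\<bar> + 1"] by auto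
qed

lemma exp_bddI: "(\<And>k. norm (a k) \<le> C * M ^ k) \<Longrightarrow> exp_bdd a"
  unfolding exp_bdd_def by blast

lemma exp_bdd_add:
  assumes "exp_bdd a" "exp_bdd b"
  shows "exp_bdd (\<lambda>k. a k + b k)"
proof -
  from assms(1) obtain C M where a: "C > 0" "M \<ge> 1" "\<And>k. norm (a k) \<le> C * M ^ k" by (rule exp_bddE) blast
  from assms(2) obtain C' M' where b: "C' > 0" "M' \<ge> 1" "\<And>k. norm (b k) \<le> C' * M' ^ k" by (rule exp_bddE) blast
  show ?thesis
  proof (rule exp_bddI)
    fix k
    have "norm (a k + b k) \<le> C * M ^ k + C' * M' ^ k"
      using a(3)[of k] b(3)[of k] norm_triangle_ineq[of "a k" "b k"] by linarith
    also have "\<dots> \<le> C * (max M M') ^ k + C' * (max M M') ^ k"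
      using a b by (intro add_mono mult_left_mono power_mono) auto
    finally show "norm (a k + b k) \<le> (C + C') * max M M' ^ k" by (simp add: algebra_simps)
  qed
qed

lemma exp_bdd_shift:
  assumes "exp_bdd a"
  shows "exp_bdd (\<lambda>k. a (k + m))"
proof -
  from assms obtain C M where a: "C > 0" "M \<ge> 1" "\<And>k. norm (a k) \<le> C * M ^ k" by (rule exp_bddE) blast
  have "norm (a (k + m)) \<le> (C * M ^ m) * M ^ k" for k
    using a(3)[of "k + m"] by (simp add: power_add mult_ac)
  then show ?thesis by (rule exp_bddI)
qed

lemma exp_bdd_0 [simp]: "exp_bdd (\<lambda>k. 0)"
  by (rule exp_bddI[of _ 0]) simp

lemma exp_bdd_bounded_linear:
  assumes "bounded_linear f" "exp_bdd a"
  shows "exp_bdd (\<lambda>k. f (a k))"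
proof -
  from assms(2) obtain C M where a: "C > 0" "M \<ge> 1" "\<And>k. norm (a k) \<le> C * M ^ k" by (rule exp_bddE) blast
  from bounded_linear.nonneg_bounded[OF assms(1)] obtain K where
    K: "K \<ge> 0" "\<And>x. norm (f x) \<le> norm x * K" by blast
  have "norm (f (a k)) \<le> (K * C) * M ^ k" for k
    using K(2)[of "a k"] mult_right_mono[OF a(3)[of k] K(1)] by (simp add: mult_ac)
  then show ?thesis by (rule exp_bddI)
qed

lemma exp_bdd_minus: "exp_bdd a \<Longrightarrow> exp_bdd (\<lambda>k. - a k)"
  unfolding exp_bdd_def by simp

lemma exp_bdd_diff: "exp_bdd a \<Longrightarrow> exp_bdd b \<Longrightarrow> exp_bdd (\<lambda>k. a k - b k)"
  using exp_bdd_add[of a "\<lambda>k. - b k"] exp_bdd_minus[of b] by simp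

lemma exp_bdd_cmult: "exp_bdd a \<Longrightarrow> exp_bdd (\<lambda>k. c * a k)" for c :: "'a::real_normed_algebra"
  by (rule exp_bdd_bounded_linear[OF bounded_linear_mult_right])

lemma exp_bdd_sum: "(\<And>i. i \<in> I \<Longrightarrow> exp_bdd (a i)) \<Longrightarrow> exp_bdd (\<lambda>k. \<Sum>i\<in>I. a i k)"
  by (induction I rule: infinite_finite_induct) (auto intro!: exp_bdd_add)

lemma exp_bdd_act: "exp_bdd a \<Longrightarrow> exp_bdd (act P a)"
  for a :: "nat \<Rightarrow> 'a::{real_normed_algebra_1, comm_ring_1}"
proof -
  assume "exp_bdd a"
  then have "exp_bdd (\<lambda>k. \<Sum>i\<le>degree P. coeff P i * a (k + i))"
    by (intro exp_bdd_sum exp_bdd_cmult exp_bdd_shift)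
  then show ?thesis unfolding act_def by (simp add: add.commute fun_eq_iff act_def[abs_def])
qed

lemma exp_bdd_vec:
  assumes "\<And>i. exp_bdd (\<lambda>k. a k $ i)"
  shows "exp_bdd (a :: nat \<Rightarrow> real^'n)"
proof -
  have "exp_bdd (\<lambda>k. \<Sum>i\<in>UNIV. (a k $ i) *\<^sub>R (axis i 1 :: real^'n))"
    by (intro exp_bdd_sum exp_bdd_bounded_linear[OF bounded_linear_scaleR_left assms])
  moreover have "(\<Sum>i\<in>UNIV. (a k $ i) *\<^sub>R (axis i 1 :: real^'n)) = a k" for k
    by (simp add: vec_eq_iff axis_def if_distrib cong: if_cong)
  ultimately show ?thesis by simp
qed

lemma exp_bdd_finite_support:
  assumes "\<And>k. k \<ge> N \<Longrightarrow> a k = 0"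
  shows "exp_bdd a"
proof (rule exp_bddI)
  fix k
  show "norm (a k) \<le> (\<Sum>i<N. norm (a i)) * 1 ^ k"
  proof (cases "k < N")
    case True
    then show ?thesis using member_le_sum[of k "{..<N}" "\<lambda>i. norm (a i)"] by simp
  qed (simp add: assms sum_nonneg)
qed

lemma exp_bdd_truncate: "exp_bdd a \<Longrightarrow> exp_bdd (\<lambda>k. if P k then a k else 0)"
  by (erule exp_bddE, rule exp_bddI) (auto split: if_splits)

lemma exp_bdd_solve:
  fixes P :: "'a::{real_normed_field} poly"
  assumes P: "P \<noteq> 0" and b: "exp_bdd b" and init: "\<And>i. i < degree P \<Longrightarrow> a i = 0" and sol: "\<And>k. act P a k = b k"
  shows "exp_bdd a"
proof -
  let ?n = "degree P" let ?c = "lead_coeff P"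
  from b obtain K M where KM: "K > 0" "M \<ge> 1" "\<And>k. norm (b k) \<le> K * M ^ k" by (rule exp_bddE) blast
  define \<sigma> where "\<sigma> = (\<Sum>i<?n. norm (coeff P i))"
  \<comment> \<open>With this \<open>L\<close>, one step of the recurrence costs at most a factor
    \<open>L\<close>: \<sigma> bounds the earlier entries and 1 is reserved for \<open>b\<close>.
    The second entry of \<open>H\<close> serves degree 0, where no power of \<open>L\<close> can be
    spared.\<close>
  define L where "L = max M ((1 + \<sigma>) / norm ?c)"
  define H where "H = max K (K / norm ?c)"
  have c: "norm ?c > 0" using P by simp
  have L: "L \<ge> 1" "L \<ge> M" using KM by (auto simp: L_def)
  have H: "H \<ge> K" "H > 0" using KM by (auto simp: H_def)
  have "(1 + \<sigma>) / norm ?c \<le> L" "K / norm ?c \<le> H" by (auto simp: L_def H_def)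
  then have L': "1 + \<sigma> \<le> norm ?c * L" and H': "K \<le> norm ?c * H"
    using c by (simp_all add: pos_divide_le_eq mult.commute)
  have "norm (a k) \<le> H * L ^ k" for k
  proof (induction k rule: less_induct)
    case (less k)
    show ?case
    proof (cases "k < ?n")
      case True
      then show ?thesis using init H L by simp
    next
      case False
      define m where "m = k - ?n"
      have k: "k = ?n + m" using False by (simp add: m_def)
      have bm: "norm (b m) \<le> K * L ^ m"
      proof -
        have "K * M ^ m \<le> K * L ^ m" using KM L by (intro mult_left_mono power_mono) auto
        then show ?thesis using KM(3)[of m] by linarith
      qed
      have "b m = (\<Sum>i<?n. coeff P i * a (i + m)) + ?c * a k"
        unfolding sol[symmetric] act_def k by (simp flip: lessThan_Suc_atMost)
      then have eq: "?c * a k = b m - (\<Sum>i<?n. coeff P i * a (i + m))" by simp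
      have "norm ?c * norm (a k) \<le> norm (b m) + (\<Sum>i<?n. norm (coeff P i) * norm (a (i + m)))"
      proof -
        have "norm (\<Sum>i<?n. coeff P i * a (i + m)) \<le> (\<Sum>i<?n. norm (coeff P i) * norm (a (i + m)))"
          by (rule sum_norm_le) (simp add: norm_mult)
        then show ?thesis
          using norm_triangle_ineq4[of "b m" "\<Sum>i<?n. coeff P i * a (i + m)"]
          unfolding norm_mult[symmetric] eq by linarith
      qed
      also have "\<dots> \<le> norm ?c * (H * L ^ k)"
      proof (cases "?n = 0")
        case True
        have "norm (b m) \<le> norm ?c * H * L ^ m"
          using bm mult_right_mono[OF H', of "L ^ m"] zero_le_power[of L m] L by linarith
        then show ?thesis using True k by simp
      next
        case False
        then obtain n' where n': "?n = Suc n'" by (cases "?n") auto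
        have pw: "L ^ j \<le> L ^ (n' + m)" if "j \<le> n' + m" for j
          using that L by (intro power_increasing) auto
        have "norm (a (i + m)) \<le> H * L ^ (n' + m)" if "i < ?n" for i
        proof -
          have "norm (a (i + m)) \<le> H * L ^ (i + m)" using that k by (intro less) auto
          also have "\<dots> \<le> H * L ^ (n' + m)"
            using that n' H by (intro mult_left_mono pw) auto
          finally show ?thesis .
        qed
        then have "(\<Sum>i<?n. norm (coeff P i) * norm (a (i + m))) \<le> (\<Sum>i<?n. norm (coeff P i) * (H * L ^ (n' + m)))"
          by (intro sum_mono mult_left_mono) auto
        also have "\<dots> = \<sigma> * (H * L ^ (n' + m))" by (simp add: \<sigma>_def sum_distrib_right)
        finally have 1: "(\<Sum>i<?n. norm (coeff P i) * norm (a (i + m))) \<le> \<sigma> * (H * L ^ (n' + m))" .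
        have "K * L ^ m \<le> H * L ^ (n' + m)" using H KM L by (intro mult_mono pw) auto
        with 1 bm have "norm (b m) + (\<Sum>i<?n. norm (coeff P i) * norm (a (i + m))) \<le> (1 + \<sigma>) * (H * L ^ (n' + m))"
          by (simp add: algebra_simps)
        also have "\<dots> \<le> (norm ?c * L) * (H * L ^ (n' + m))"
          using H L L' by (intro mult_right_mono) auto
        finally show ?thesis by (simp add: k n' mult_ac)
      qed
      finally show ?thesis using c by simp
    qed
  qed
  then show ?thesis by (rule exp_bddI)
qed

section \<open>Taylor series and derivative sequences\<close>

text \<open>
  The function with derivatives \<open>a\<close> at \<open>-1\<close>. Expanding at \<open>-1\<close> makes initial values coefficients,
  and differentiation becomes the shift of \<open>a\<close>.
\<close>

definition taylor :: "(nat \<Rightarrow> 'a::euclidean_space) \<Rightarrow> real \<Rightarrow> 'a" where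
  "taylor a t = (\<Sum>k. ((t + 1) ^ k / fact k) *\<^sub>R a k)"

text \<open>A smooth function bundled with all its derivatives, so that differentiation is an index
  shift and polynomials act through \<open>act\<close>. Differentiability is on the whole line,
  which avoids one-sided derivatives.\<close>

definition derivs :: "(nat \<Rightarrow> real \<Rightarrow> 'a::real_normed_vector) \<Rightarrow> bool" where
  "derivs F \<longleftrightarrow> (\<forall>k t. (F k has_vector_derivative F (Suc k) t) (at t))"

lemma exp_bdd_summable_norm:
  assumes "exp_bdd a"
  shows "summable (\<lambda>k. norm (((t + 1) ^ k / fact k) *\<^sub>R a k))"
proof -
  from assms obtain C M where a: "C > 0" "M \<ge> 1" "\<And>k. norm (a k) \<le> C * M ^ k" by (rule exp_bddE) blast
  show ?thesis
  proof (rule summable_comparison_test')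
    show "summable (\<lambda>k. C * (inverse (fact k) * (\<bar>t + 1\<bar> * M) ^ k))"
      by (intro summable_mult summable_exp)
    fix k
    have "(\<bar>t + 1\<bar> ^ k / fact k) * norm (a k) \<le> (\<bar>t + 1\<bar> ^ k / fact k) * (C * M ^ k)"
      by (intro mult_left_mono a) auto
    then show "norm (norm (((t + 1) ^ k / fact k) *\<^sub>R a k)) \<le> C * (inverse (fact k) * (\<bar>t + 1\<bar> * M) ^ k)"
      by (simp add: power_abs power_mult_distrib field_simps)
  qed
qed

lemma exp_bdd_summable:
  "exp_bdd a \<Longrightarrow> summable (\<lambda>k. ((t + 1) ^ k / fact k) *\<^sub>R (a k :: 'a::euclidean_space))"
  by (rule summable_norm_cancel[OF exp_bdd_summable_norm])

lemma taylor_bounded_linear: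
  fixes a :: "nat \<Rightarrow> 'a::euclidean_space" and f :: "'a \<Rightarrow> 'b::euclidean_space"
  assumes "bounded_linear f" "exp_bdd a"
  shows "f (taylor a t) = taylor (\<lambda>k. f (a k)) t"
  unfolding taylor_def
  by (subst bounded_linear.suminf[OF assms(1) exp_bdd_summable[OF assms(2)]])
     (simp add: linear_simps[OF assms(1)])

lemma taylor_add: "exp_bdd a \<Longrightarrow> exp_bdd b \<Longrightarrow> taylor (\<lambda>k. a k + b k) t = taylor a t + taylor b t"
  unfolding taylor_def by (simp add: suminf_add exp_bdd_summable scaleR_add_right)

lemma taylor_diff: "exp_bdd a \<Longrightarrow> exp_bdd b \<Longrightarrow> taylor (\<lambda>k. a k - b k) t = taylor a t - taylor b t"
  unfolding taylor_def by (simp add: suminf_diff exp_bdd_summable scaleR_diff_right)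

lemma taylor_zero [simp]: "taylor (\<lambda>k. 0) t = 0"
  by (simp add: taylor_def)

lemma taylor_sum:
  assumes "\<And>i. i \<in> I \<Longrightarrow> exp_bdd (f i)"
  shows "taylor (\<lambda>k. \<Sum>i\<in>I. f i k) t = (\<Sum>i\<in>I. taylor (f i) t)"
  using assms by (induction I rule: infinite_finite_induct) (auto simp: taylor_add exp_bdd_sum)

lemma taylor_at_left: "taylor a (- 1) = a 0"
proof -
  have "taylor a (- 1) = (\<Sum>k. if k = 0 then a 0 else 0)"
    unfolding taylor_def by (intro suminf_cong) (auto simp: power_0_left)
  then show ?thesis using sums_single[of 0 "\<lambda>_. a 0"] by (simp add: sums_iff)
qed

lemma taylor_finite:
  assumes "\<And>k. k \<ge> N \<Longrightarrow> a k = 0"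
  shows "taylor a t = (\<Sum>k<N. ((t + 1) ^ k / fact k) *\<^sub>R a k)"
  unfolding taylor_def by (rule suminf_finite) (use assms in auto)

lemma taylor_real_has_derivative:
  fixes a :: "nat \<Rightarrow> real"
  assumes "exp_bdd a"
  shows "(taylor a has_real_derivative taylor (\<lambda>k. a (Suc k)) t) (at t)"
proof -
  let ?c = "\<lambda>k. a k / fact k"
  have summ: "summable (\<lambda>k. ?c k * (x + 1) ^ k)" for x
    using exp_bdd_summable[OF assms, of x] by (simp add: mult.commute)
  have "DERIV (\<lambda>x. \<Sum>k. ?c k * x ^ k) (t + 1) :> (\<Sum>k. diffs ?c k * (t + 1) ^ k)"
    by (rule termdiffs_strong[OF summ[of "\<bar>t\<bar> + 2"]]) simp
  then have "DERIV (\<lambda>x. \<Sum>k. ?c k * (x + 1) ^ k) t :> (\<Sum>k. diffs ?c k * (t + 1) ^ k)"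
    by (subst (asm) DERIV_shift)
  moreover have "diffs ?c k = a (Suc k) / fact k" for k
    by (simp add: diffs_def del: of_nat_Suc)
  ultimately show ?thesis
    by (simp add: taylor_def[abs_def] mult.commute)
qed

lemma taylor_has_vector_derivative:
  fixes a :: "nat \<Rightarrow> 'a::euclidean_space"
  assumes "exp_bdd a"
  shows "(taylor a has_vector_derivative taylor (\<lambda>k. a (Suc k)) t) (at t)"
  unfolding has_vector_derivative_def
proof (subst has_derivative_componentwise_within, intro ballI)
  fix i :: 'a assume "i \<in> Basis"
  have bl: "bounded_linear (\<lambda>x::'a. x \<bullet> i)" by (rule bounded_linear_inner_left)
  have "(taylor (\<lambda>k. a k \<bullet> i) has_real_derivative taylor (\<lambda>k. a (Suc k) \<bullet> i) t) (at t)"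
    by (rule taylor_real_has_derivative[OF exp_bdd_bounded_linear[OF bl assms]])
  moreover have "exp_bdd (\<lambda>k. a (Suc k))" using exp_bdd_shift[OF assms, of 1] by simp
  ultimately have "((\<lambda>x. taylor a x \<bullet> i) has_derivative (*) (taylor (\<lambda>k. a (Suc k)) t \<bullet> i)) (at t)"
    using assms by (simp add: taylor_bounded_linear[OF bl] has_field_derivative_def)
  moreover have "(*) (taylor (\<lambda>k. a (Suc k)) t \<bullet> i) = (\<lambda>x. (x *\<^sub>R taylor (\<lambda>k. a (Suc k)) t) \<bullet> i)"
    by (simp add: fun_eq_iff)
  ultimately show "((\<lambda>x. taylor a x \<bullet> i) has_derivative (\<lambda>x. (x *\<^sub>R taylor (\<lambda>k. a (Suc k)) t) \<bullet> i)) (at t)"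
    by simp
qed

lemma derivs_taylor:
  assumes "exp_bdd a"
  shows "derivs (\<lambda>k. taylor (\<lambda>i. a (i + k)))"
  unfolding derivs_def
  using taylor_has_vector_derivative[OF exp_bdd_shift[OF assms]] by simp

text \<open>On the interval \<open>t + 1\<close> is at most 2, so term \<open>k\<close> is at most
  \<open>C\<close> times \<open>(2 * M) ^ k / fact k\<close>. Writing \<open>2 * M\<close> as
  \<open>4 * M\<close> over 2 splits off a factor \<open>1 / 2 ^ k\<close>, at most
  \<open>1 / 2 ^ K\<close> from index \<open>K\<close> on, and leaves the series of
  \<open>exp (4 * M)\<close>.\<close>

lemma norm_taylor_le:
  assumes a: "\<And>k. norm (a k) \<le> C * M ^ k" and "M \<ge> 1" "C > 0"
    and low: "\<And>k. k < K \<Longrightarrow> a k = 0" and t: "t \<in> {-1..1}"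
  shows "norm (taylor a t) \<le> C * exp (4 * M) / 2 ^ K"
proof -
  have "exp_bdd a" using a by (rule exp_bddI)
  let ?f = "\<lambda>k. C / 2 ^ K * (inverse (fact k) * (4 * M) ^ k)"
  have "norm (taylor a t) \<le> (\<Sum>k. norm (((t + 1) ^ k / fact k) *\<^sub>R a k))"
    unfolding taylor_def by (rule summable_norm[OF exp_bdd_summable_norm[OF \<open>exp_bdd a\<close>]])
  also have "\<dots> \<le> (\<Sum>k. ?f k)"
  proof (rule suminf_le[OF _ exp_bdd_summable_norm[OF \<open>exp_bdd a\<close>]])
    fix k
    show "norm (((t + 1) ^ k / fact k) *\<^sub>R a k) \<le> ?f k"
    proof (cases "k < K")
      case True
      then show ?thesis using assms by (simp add: low)
    next
      case False
      have "norm (((t + 1) ^ k / fact k) *\<^sub>R a k) \<le> (2 ^ k / fact k) * (C * M ^ k)"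
        unfolding norm_scaleR using t assms by (intro mult_mono) (auto simp: power_abs intro!: divide_right_mono power_mono)
      also have "\<dots> = (C / 2 ^ k) * (inverse (fact k) * (4 * M) ^ k)"
        using power_mult_distrib[of "2::real" 2 k] by (simp add: field_simps power_mult_distrib)
      also have "\<dots> \<le> ?f k"
        using False assms by (intro mult_right_mono divide_left_mono power_increasing) auto
      finally show ?thesis .
    qed
  qed (intro summable_mult summable_exp)
  also have "\<dots> = C / 2 ^ K * exp (4 * M)"
    by (subst suminf_mult[OF summable_exp]) (simp add: exp_def scaleR_conv_of_real divide_inverse mult.commute)
  finally show ?thesis by simp
qed

section \<open>Calculus of derivative families\<close>

lemma derivs_add: "derivs F \<Longrightarrow> derivs G \<Longrightarrow> derivs (\<lambda>k t. F k t + G k t)"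
  unfolding derivs_def by (auto intro!: has_vector_derivative_add)

lemma derivs_bounded_linear: "bounded_linear f \<Longrightarrow> derivs F \<Longrightarrow> derivs (\<lambda>k t. f (F k t))"
  unfolding derivs_def by (auto intro: bounded_linear.has_vector_derivative)

lemma derivs_0: "derivs (\<lambda>k t. 0)"
  unfolding derivs_def by auto

lemma derivs_sum: "(\<And>i. i \<in> I \<Longrightarrow> derivs (F i)) \<Longrightarrow> derivs (\<lambda>k t. \<Sum>i\<in>I. F i k t)"
  unfolding derivs_def by (auto intro!: has_vector_derivative_sum)

lemma derivs_shift: "derivs F \<Longrightarrow> derivs (\<lambda>k. F (k + m))"
  unfolding derivs_def by auto

lemma derivs_act:
  fixes F :: "nat \<Rightarrow> real \<Rightarrow> 'a::{real_normed_algebra_1, comm_ring_1}"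
  assumes "derivs F"
  shows "derivs (\<lambda>k t. act P (\<lambda>i. F i t) k)"
proof -
  have "derivs (\<lambda>k t. \<Sum>i\<le>degree P. coeff P i * F (k + i) t)"
    by (intro derivs_sum derivs_bounded_linear[OF bounded_linear_mult_right] derivs_shift assms)
  then show ?thesis by (simp add: act_def add.commute)
qed

lemma derivs_vec:
  fixes F :: "'n::finite \<Rightarrow> nat \<Rightarrow> real \<Rightarrow> real"
  assumes "\<And>c. derivs (F c)"
  shows "derivs (\<lambda>k t. \<chi> c. F c k t)"
proof -
  have "derivs (\<lambda>k t. \<Sum>c\<in>UNIV. F c k t *\<^sub>R (axis c 1 :: real^'n))"
    by (intro derivs_sum derivs_bounded_linear[OF bounded_linear_scaleR_left] assms)
  moreover have "(\<Sum>c\<in>UNIV. F c k t *\<^sub>R (axis c 1 :: real^'n)) = (\<chi> c. F c k t)" for k t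
    by (simp add: vec_eq_iff axis_def if_distrib cong: if_cong)
  ultimately show ?thesis by simp
qed

lemma derivs_continuous_on: "derivs F \<Longrightarrow> continuous_on S (F k)"
  unfolding derivs_def
  by (meson continuous_at_imp_continuous_on has_vector_derivative_continuous)

lemma derivs_measurable: "derivs F \<Longrightarrow> F k \<in> borel_measurable (lebesgue_on S)"
  for F :: "nat \<Rightarrow> real \<Rightarrow> 'a::euclidean_space"
  using borel_measurable_continuous_onI[OF derivs_continuous_on[of F UNIV k]]
  by (simp add: measurable_completion measurable_restrict_space1)

lemma nderiv_0 [simp]: "nderiv S 0 f = f"
  by (simp add: nderiv_def)

lemma nderiv_Suc: "nderiv S (Suc k) f t = vector_derivative (nderiv S k f) (at t within S)"
  by (simp add: nderiv_def)

lemma derivs_nderiv: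
  assumes "derivs F"
  shows "nderiv UNIV k (F 0) = F k"
proof (induction k)
  case (Suc k)
  show ?case
    using assms by (auto simp: fun_eq_iff nderiv_Suc Suc derivs_def intro!: vector_derivative_at)
qed simp

lemma smooth_on_UNIV_iff: "smooth_on UNIV f \<longleftrightarrow> (\<exists>F. derivs F \<and> F 0 = f)"
proof
  assume f: "smooth_on UNIV f"
  have "derivs (\<lambda>k. nderiv UNIV k f)"
    unfolding derivs_def nderiv_Suc
    using f by (auto simp: smooth_on_def differentiable_on_def vector_derivative_works[symmetric])
  then show "\<exists>F. derivs F \<and> F 0 = f" by (intro exI[of _ "\<lambda>k. nderiv UNIV k f"]) simp
next
  assume "\<exists>F. derivs F \<and> F 0 = f"
  then obtain F where "derivs F" "F 0 = f" by blast
  then show "smooth_on UNIV f"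
    using derivs_nderiv[of F] unfolding smooth_on_def derivs_def differentiable_on_def
    by (auto intro: differentiableI_vector)
qed

lemma derivs_nderiv_Icc:
  fixes F :: "nat \<Rightarrow> real \<Rightarrow> 'a::euclidean_space"
  assumes "derivs F" "t \<in> {-1..1}"
  shows "nderiv {-1..1} k (F 0) t = F k t"
    and "(nderiv {-1..1} k (F 0) has_vector_derivative F (Suc k) t) (at t within {-1..1})"
proof -
  have *: "\<forall>t\<in>{-1..1}. nderiv {-1..1} k (F 0) t = F k t \<and>
    (nderiv {-1..1} k (F 0) has_vector_derivative F (Suc k) t) (at t within {-1..1})"
  proof (induction k)
    case 0
    then show ?case using assms by (auto simp: derivs_def intro: has_vector_derivative_at_within)
  next
    case (Suc k)
    have 1: "nderiv {-1..1} (Suc k) (F 0) t = F (Suc k) t" if "t \<in> {-1..1}" for t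
      unfolding nderiv_Suc using Suc that
      by (intro vector_derivative_within_closed_interval) auto
    show ?case
    proof (intro ballI conjI 1)
      fix t :: real assume t: "t \<in> {-1..1}"
      have "(F (Suc k) has_vector_derivative F (Suc (Suc k)) t) (at t within {-1..1})"
        using assms by (auto simp: derivs_def intro: has_vector_derivative_at_within)
      then show "(nderiv {-1..1} (Suc k) (F 0) has_vector_derivative F (Suc (Suc k)) t) (at t within {-1..1})"
        by (rule has_vector_derivative_transform[rotated 2]) (use 1 t in auto)
    qed
  qed
  from * assms(2) show "nderiv {-1..1} k (F 0) t = F k t"
    "(nderiv {-1..1} k (F 0) has_vector_derivative F (Suc k) t) (at t within {-1..1})"
    by auto
qed

lemma derivs_smooth_on_Icc: "derivs F \<Longrightarrow> smooth_on {-1..1} (F 0)"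
  for F :: "nat \<Rightarrow> real \<Rightarrow> 'a::euclidean_space"
  unfolding smooth_on_def differentiable_on_def
  using derivs_nderiv_Icc(2) differentiableI_vector by blast

text \<open>Test functions with their derivatives bundled in. A symmetric interval of radius
  \<open>r < 1\<close> replaces the compact support; it is common to all derivatives, so
  differential operators preserve the notion.\<close>

definition tests :: "(nat \<Rightarrow> real \<Rightarrow> 'a::real_normed_vector) \<Rightarrow> bool" where
  "tests F \<longleftrightarrow> derivs F \<and> (\<exists>r<1. r > 0 \<and> (\<forall>k t. \<bar>t\<bar> > r \<longrightarrow> F k t = 0))"

lemma tests_derivs: "tests F \<Longrightarrow> derivs F"
  by (simp add: tests_def)

lemma derivs_zero_outside:
  assumes "derivs F" "\<And>t. \<bar>t\<bar> > r \<Longrightarrow> F 0 t = 0" "\<bar>t\<bar> > r"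
  shows "F k t = 0"
proof -
  have "\<forall>t. \<bar>t\<bar> > r \<longrightarrow> F k t = 0"
  proof (induction k)
    case (Suc k)
    show ?case
    proof (intro allI impI)
      fix t :: real assume t: "\<bar>t\<bar> > r"
      have "open {t. \<bar>t\<bar> > r}"
        by (intro open_Collect_less continuous_intros)
      then have "(F k has_vector_derivative 0) (at t)"
        using t Suc by (intro has_vector_derivative_transform_within_open[OF has_vector_derivative_const[of 0]]) auto
      moreover have "(F k has_vector_derivative F (Suc k) t) (at t)"
        using assms(1) by (simp add: derivs_def)
      ultimately show "F (Suc k) t = 0" by (metis vector_derivative_at)
    qed
  qed (use assms in auto)
  then show ?thesis using assms by blast
qed

lemma testsI:
  assumes "derivs F" "0 < r" "r < 1" "\<And>t. \<bar>t\<bar> > r \<Longrightarrow> F 0 t = 0"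
  shows "tests F"
  unfolding tests_def using assms derivs_zero_outside[of F r] by blast

lemma test_functions_iff: "\<phi> \<in> test_functions \<longleftrightarrow> (\<exists>F. tests F \<and> F 0 = \<phi>)"
proof
  assume "\<phi> \<in> test_functions"
  then obtain K F where K: "compact K" "K \<subseteq> Iv" "\<And>t. t \<notin> K \<Longrightarrow> \<phi> t = 0" and F: "derivs F" "F 0 = \<phi>"
    unfolding test_functions_def smooth_on_UNIV_iff by blast
  obtain r where r: "0 < r" "r < 1" "K \<subseteq> {-r..r}"
  proof (cases "K = {}")
    case True
    then show ?thesis using that[of "1/2"] by auto
  next
    case False
    obtain s where s: "s \<in> K" "\<And>x. x \<in> K \<Longrightarrow> \<bar>x\<bar> \<le> \<bar>s\<bar>"
      using continuous_attains_sup[OF K(1) False, of abs] continuous_on_rabs[OF continuous_on_id] by auto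
    have "\<bar>s\<bar> < 1" using subsetD[OF K(2) s(1)] by (simp add: abs_less_iff)
    \<comment> \<open>The radius is the midpoint between the largest modulus in \<open>K\<close> and
      1; it is positive even if \<open>K\<close> contains only 0.\<close>
    have "x \<in> {- ((1 + \<bar>s\<bar>) / 2)..(1 + \<bar>s\<bar>) / 2}" if "x \<in> K" for x
    proof -
      have "x \<le> \<bar>s\<bar>" "- x \<le> \<bar>s\<bar>" using s(2)[OF that] by (simp_all only: abs_le_iff)
      then show ?thesis using \<open>\<bar>s\<bar> < 1\<close> by (simp add: field_simps)
    qed
    then have "K \<subseteq> {- ((1 + \<bar>s\<bar>) / 2)..(1 + \<bar>s\<bar>) / 2}" by blast
    then show ?thesis using \<open>\<bar>s\<bar> < 1\<close> by (intro that[of "(1 + \<bar>s\<bar>) / 2"]) auto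
  qed
  then have "F 0 t = 0" if "\<bar>t\<bar> > r" for t using K(3)[of t] F that by fastforce
  then show "\<exists>F. tests F \<and> F 0 = \<phi>" using testsI[OF F(1) r(1,2)] F(2) by blast
next
  assume "\<exists>F. tests F \<and> F 0 = \<phi>"
  then obtain F r where F: "derivs F" "F 0 = \<phi>" "r < 1" "\<And>k t. \<bar>t\<bar> > r \<Longrightarrow> F k t = 0"
    unfolding tests_def by blast
  then have "compact {-r..r}" "{-r..r} \<subseteq> Iv" "\<forall>t. t \<notin> {-r..r} \<longrightarrow> \<phi> t = 0" by (auto simp: abs_if)
  then show "\<phi> \<in> test_functions"
    using F unfolding test_functions_def smooth_on_UNIV_iff by blast
qed

lemma tests_add: assumes "tests F" "tests G" shows "tests (\<lambda>k t. F k t + G k t)"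
proof -
  from assms(1) obtain r where F: "derivs F" "0 < r" "r < 1" "\<And>k t. \<bar>t\<bar> > r \<Longrightarrow> F k t = 0" unfolding tests_def by blast
  from assms(2) obtain s where G: "derivs G" "0 < s" "s < 1" "\<And>k t. \<bar>t\<bar> > s \<Longrightarrow> G k t = 0" unfolding tests_def by blast
  show ?thesis
    by (rule testsI[OF derivs_add[OF F(1) G(1)], of "max r s"]) (use F G in auto)
qed

lemma tests_bounded_linear:
  assumes "bounded_linear f" "tests F"
  shows "tests (\<lambda>k t. f (F k t))"
  using assms(2) derivs_bounded_linear[OF assms(1)] linear_simps(3)[OF assms(1)]
  unfolding tests_def by metis

lemma tests_shift: "tests F \<Longrightarrow> tests (\<lambda>k. F (k + m))"
  unfolding tests_def using derivs_shift by blast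

lemma tests_act: "tests F \<Longrightarrow> tests (\<lambda>k t. act P (\<lambda>i. F i t) k)"
  for F :: "nat \<Rightarrow> real \<Rightarrow> 'a::{real_normed_algebra_1, comm_ring_1}"
  unfolding tests_def using derivs_act[of F P] by (fastforce intro: act_eq_0)

section \<open>Integration over the interval\<close>

abbreviation mI :: "real measure" where
  "mI \<equiv> lebesgue_on Iv"

abbreviation LI :: "(real \<Rightarrow> 'a::{banach, second_countable_topology}) \<Rightarrow> 'a" where
  "LI f \<equiv> integral\<^sup>L mI f"

abbreviation integr :: "(real \<Rightarrow> 'a::{banach, second_countable_topology}) \<Rightarrow> bool" where
  "integr f \<equiv> integrable mI f"

lemma finite_measure_Iv: "finite_measure mI"
  by (rule finite_measure_lebesgue_on) (metis box_real(1) lmeasurable_box)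

lemma bounded_integr:
  fixes f :: "real \<Rightarrow> 'a::euclidean_space"
  assumes "f \<in> borel_measurable mI" "\<And>t. t \<in> Iv \<Longrightarrow> norm (f t) \<le> K"
  shows "integr f"
  by (rule finite_measure.integrable_const_bound[OF finite_measure_Iv, where B = K])
     (use assms in \<open>auto intro!: AE_I2 simp: space_restrict_space\<close>)

lemma continuous_bounded_Iv:
  fixes f :: "real \<Rightarrow> 'a::real_normed_vector"
  assumes "continuous_on {-1..1} f"
  obtains K where "K > 0" "\<And>t. t \<in> {-1..1} \<Longrightarrow> norm (f t) \<le> K"
proof -
  have "bounded (f ` {-1..1})"
    by (rule compact_imp_bounded[OF compact_continuous_image[OF assms]]) simp
  then show ?thesis using that unfolding bounded_pos by auto
qed

lemma continuous_measurable_Iv: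
  "continuous_on {-1..1} f \<Longrightarrow> f \<in> borel_measurable mI"
  for f :: "real \<Rightarrow> 'a::euclidean_space"
  by (rule continuous_imp_measurable_on_sets_lebesgue) (auto elim: continuous_on_subset)

lemma continuous_integr:
  fixes f :: "real \<Rightarrow> 'a::euclidean_space"
  assumes "continuous_on {-1..1} f"
  shows "integr f"
proof -
  from continuous_bounded_Iv[OF assms] obtain K where "\<And>t. t \<in> {-1..1} \<Longrightarrow> norm (f t) \<le> K" by blast
  then show ?thesis by (intro bounded_integr[OF continuous_measurable_Iv[OF assms], of K]) auto
qed

lemma LI_eq_integral:
  fixes f :: "real \<Rightarrow> 'a::euclidean_space"
  assumes "continuous_on {-1..1} f"
  shows "LI f = integral {-1..1} f"
proof -
  have "LI f = integral Iv f"
    by (rule lebesgue_integral_eq_integral[OF continuous_integr[OF assms]]) simp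
  then show ?thesis by (simp add: integral_open_interval_real)
qed

lemma integr_bilinear:
  fixes f :: "real \<Rightarrow> 'b::euclidean_space" and g :: "real \<Rightarrow> 'a::euclidean_space"
    and prod :: "'a \<Rightarrow> 'b \<Rightarrow> 'c::euclidean_space"
  assumes "bounded_bilinear prod" "continuous_on {-1..1} g" "integr f"
  shows "integr (\<lambda>t. prod (g t) (f t))"
proof -
  from continuous_bounded_Iv[OF assms(2)] obtain K where K: "K > 0" "\<And>t. t \<in> {-1..1} \<Longrightarrow> norm (g t) \<le> K" by blast
  obtain L where L: "L > 0" "\<And>a b. norm (prod a b) \<le> norm a * norm b * L"
    using bounded_bilinear.pos_bounded[OF assms(1)] by blast
  have "continuous_on UNIV (\<lambda>x. prod (fst x) (snd x))"
    by (intro bounded_bilinear.continuous_on[OF assms(1)] continuous_intros)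
  then have meas: "(\<lambda>t. prod (g t) (f t)) \<in> borel_measurable mI"
    using borel_measurable_continuous_Pair[OF continuous_measurable_Iv[OF assms(2)] borel_measurable_integrable[OF assms(3)], of prod]
    by simp
  show ?thesis
  proof (rule Bochner_Integration.integrable_bound[OF _ meas])
    show "integr (\<lambda>t. (K * L) *\<^sub>R f t)" using assms(3) by simp
    show "AE t in mI. norm (prod (g t) (f t)) \<le> norm ((K * L) *\<^sub>R f t)"
    proof (rule AE_I2)
      fix t assume "t \<in> space mI"
      then have "norm (g t) \<le> K" using K by (auto simp: space_restrict_space)
      then have "norm (g t) * norm (f t) * L \<le> K * norm (f t) * L"
        using L by (intro mult_right_mono) auto
      then have "norm (prod (g t) (f t)) \<le> K * norm (f t) * L"
        using L(2)[of "g t" "f t"] by linarith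
      then show "norm (prod (g t) (f t)) \<le> norm ((K * L) *\<^sub>R f t)"
        using K(1) L(1) by (simp add: abs_mult mult_ac)
    qed
  qed
qed

lemmas integr_mult = integr_bilinear[OF bounded_bilinear_mult]
lemmas integr_scaleR = integr_bilinear[OF bounded_bilinear_scaleR]

lemma LI_by_parts:
  fixes F :: "nat \<Rightarrow> real \<Rightarrow> 'a::euclidean_space" and G :: "nat \<Rightarrow> real \<Rightarrow> 'b::euclidean_space"
    and prod :: "'a \<Rightarrow> 'b \<Rightarrow> 'c::euclidean_space"
  assumes "bounded_bilinear prod" "tests F" "derivs G"
  shows "LI (\<lambda>t. prod (F (Suc k) t) (G m t)) = - LI (\<lambda>t. prod (F k t) (G (Suc m) t))"
proof -
  interpret bounded_bilinear prod by fact
  have cont: "continuous_on {-1..1} (\<lambda>t. prod (F i t) (G j t))" for i j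
    using assms by (intro continuous_on) (auto intro: derivs_continuous_on tests_derivs)
  have z: "F k 1 = 0" "F k (- 1) = 0" using assms(2) by (auto simp: tests_def)
  have "((\<lambda>t. prod (F k t) (G (Suc m) t) + prod (F (Suc k) t) (G m t)) has_integral
      prod (F k 1) (G m 1) - prod (F k (- 1)) (G m (- 1))) {-1..1}"
    using assms by (intro fundamental_theorem_of_calculus has_vector_derivative)
      (auto simp: tests_def derivs_def intro: has_vector_derivative_at_within)
  then have "integral {-1..1} (\<lambda>t. prod (F k t) (G (Suc m) t) + prod (F (Suc k) t) (G m t)) = 0"
    by (simp add: z zero_left integral_unique)
  then have "LI (\<lambda>t. prod (F k t) (G (Suc m) t) + prod (F (Suc k) t) (G m t)) = 0"
    by (subst LI_eq_integral) (auto intro!: continuous_on_add cont)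
  then show ?thesis
    by (subst (asm) Bochner_Integration.integral_add)
       (auto intro!: continuous_integr cont simp: add_eq_0_iff)
qed

lemma LI_by_parts_iter:
  fixes F :: "nat \<Rightarrow> real \<Rightarrow> 'a::euclidean_space" and G :: "nat \<Rightarrow> real \<Rightarrow> 'b::euclidean_space"
    and prod :: "'a \<Rightarrow> 'b \<Rightarrow> 'c::euclidean_space"
  assumes "bounded_bilinear prod" "tests F" "derivs G"
  shows "LI (\<lambda>t. prod (F (k + i) t) (G m t)) = (- 1) ^ i *\<^sub>R LI (\<lambda>t. prod (F k t) (G (m + i) t))"
proof (induction i arbitrary: m)
  case (Suc i)
  show ?case
    using LI_by_parts[OF assms, of "k + i" m] Suc[of "Suc m"] by simp
qed simp

section \<open>Bump functions\<close>

text \<open>Dependent choice along a class closed under differentiation gives all derivatives at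
  once, without a formula for the higher ones.\<close>

lemma derivs_of_closed:
  assumes "\<And>f. \<C> f \<Longrightarrow> \<exists>f'. \<C> f' \<and> (\<forall>t. (f has_vector_derivative f' t) (at t))" "\<C> f"
  shows "\<exists>F. derivs F \<and> F 0 = f"
proof -
  have "\<exists>F. \<forall>n. (\<C> (F n) \<and> (n = 0 \<longrightarrow> F n = f)) \<and> (\<forall>t. (F n has_vector_derivative F (Suc n) t) (at t))"
    by (rule dependent_nat_choice) (use assms in auto)
  then show ?thesis unfolding derivs_def by blast
qed

text \<open>For \<open>i = 0\<close> the classical flat function \<open>exp (- c / x)\<close>. The
  powers of \<open>1 / x\<close> close the family under differentiation up to linear combinations,
  and letting \<open>c\<close> tend to 0 approximates a step.\<close>

definition half_bump :: "real \<Rightarrow> nat \<Rightarrow> real \<Rightarrow> real" where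
  "half_bump c i x = (if x > 0 then (1 / x) ^ i * exp (- (c / x)) else 0)"

lemma power_div_fact_le_exp:
  fixes z :: real
  assumes "z \<ge> 0"
  shows "z ^ n / fact n \<le> exp z"
proof -
  have "sum (\<lambda>n. inverse (fact n) * z ^ n) {n} \<le> (\<Sum>n. inverse (fact n) * z ^ n)"
    by (rule sum_le_suminf[OF summable_exp]) (use assms in auto)
  then show ?thesis by (simp add: exp_def scaleR_conv_of_real field_simps)
qed

text \<open>One term of the exponential series at \<open>c / x\<close> bounds
  \<open>exp (c / x)\<close> from below. Exponent \<open>i + 2\<close> beats the \<open>i\<close>
  poles and leaves \<open>x\<^sup>2\<close>, which gives derivative 0 at the origin.\<close>

lemma half_bump_le:
  assumes "c > 0"
  shows "\<bar>half_bump c i x\<bar> \<le> fact (i + 2) / c ^ (i + 2) * x\<^sup>2"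
proof (cases "x > 0")
  case True
  have "(c / x) ^ (i + 2) / fact (i + 2) \<le> exp (c / x)"
    using True assms by (intro power_div_fact_le_exp) simp
  then have "inverse (exp (c / x)) \<le> inverse ((c / x) ^ (i + 2) / fact (i + 2))"
    using True assms by (intro le_imp_inverse_le) auto
  then have "exp (- (c / x)) \<le> fact (i + 2) / c ^ (i + 2) * x ^ (i + 2)"
    by (simp add: exp_minus power_divide field_simps)
  then have "(1 / x) ^ i * exp (- (c / x)) \<le> (1 / x) ^ i * (fact (i + 2) / c ^ (i + 2) * x ^ (i + 2))"
    using True by (intro mult_left_mono) auto
  also have "\<dots> = fact (i + 2) / c ^ (i + 2) * x\<^sup>2"
  proof -
    have "(1 / x) ^ i * x ^ (i + 2) = x\<^sup>2" using True by (simp add: power_add power_divide power2_eq_square)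
    then show ?thesis by (subst mult.left_commute) (simp only:)
  qed
  finally show ?thesis using True by (simp add: half_bump_def abs_mult)
next
  case False
  then show ?thesis using assms by (simp add: half_bump_def)
qed

lemma half_bump_has_derivative:
  assumes "c > 0"
  shows "(half_bump c i has_real_derivative - real i * half_bump c (i + 1) x + c * half_bump c (i + 2) x) (at x)"
proof -
  consider "x > 0" | "x < 0" | "x = 0" by linarith
  then show ?thesis
  proof cases
    case 1
    have inv: "((\<lambda>x. 1 / x) has_real_derivative - ((1 / x) ^ 2)) (at x)"
      using 1 by (auto intro!: derivative_eq_intros simp: power2_eq_square)
    have pow: "((\<lambda>x. (1 / x) ^ i) has_real_derivative - real i * (1 / x) ^ (i + 1)) (at x)"
    proof (cases i)
      case (Suc n)
      show ?thesis
        unfolding Suc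
      proof (rule DERIV_cong[OF DERIV_power_Suc[OF inv]])
        show "(1 + real n) * (- ((1 / x)\<^sup>2) * (1 / x) ^ n) = - real (Suc n) * (1 / x) ^ (Suc n + 1)"
          unfolding power2_eq_square power_Suc Suc_eq_plus1[symmetric] of_nat_Suc by (simp only: mult_ac mult_minus_left mult_minus_right)
      qed
    qed simp
    have ex: "((\<lambda>x. exp (- (c / x))) has_real_derivative exp (- (c / x)) * (c * (1 / x) ^ 2)) (at x)"
      using 1 by (auto intro!: derivative_eq_intros simp: power2_eq_square)
    have "((\<lambda>x. (1 / x) ^ i * exp (- (c / x))) has_real_derivative
        - real i * half_bump c (i + 1) x + c * half_bump c (i + 2) x) (at x)"
      using DERIV_mult[OF pow ex] 1 by (simp add: half_bump_def power_add power2_eq_square mult_ac)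
    then show ?thesis
      by (rule has_field_derivative_transform_within_open[of _ _ _ "{0<..}"]) (use 1 in \<open>auto simp: half_bump_def\<close>)
  next
    case 2
    have "((\<lambda>x. 0) has_real_derivative 0) (at x)" by simp
    then have "(half_bump c i has_real_derivative 0) (at x)"
      by (rule has_field_derivative_transform_within_open[of _ _ _ "{..<0}"]) (use 2 in \<open>auto simp: half_bump_def\<close>)
    then show ?thesis using 2 by (simp add: half_bump_def)
  next
    case 3
    let ?K = "fact (i + 2) / c ^ (i + 2)"
    have "((\<lambda>h. (half_bump c i (0 + h) - half_bump c i 0) / h) \<longlongrightarrow> 0) (at 0)"
    proof (rule Lim_null_comparison)
      show "\<forall>\<^sub>F h in at 0. norm ((half_bump c i (0 + h) - half_bump c i 0) / h) \<le> ?K * \<bar>h\<bar>"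
        unfolding eventually_at_topological
      proof (intro exI[of _ UNIV] conjI ballI impI)
        fix h :: real assume "h \<noteq> 0"
        have "\<bar>half_bump c i h\<bar> \<le> (?K * \<bar>h\<bar>) * \<bar>h\<bar>"
          using half_bump_le[OF assms, of i h] by (simp add: power2_eq_square mult.assoc)
        then show "norm ((half_bump c i (0 + h) - half_bump c i 0) / h) \<le> ?K * \<bar>h\<bar>"
          using \<open>h \<noteq> 0\<close> by (simp add: half_bump_def[of _ _ 0] pos_divide_le_eq)
      qed auto
      show "((\<lambda>h. ?K * \<bar>h\<bar>) \<longlongrightarrow> 0) (at 0)"
        by (auto intro!: tendsto_eq_intros simp: assms less_imp_neq[OF assms, symmetric])
    qed
    then have "(half_bump c i has_real_derivative 0) (at 0)" by (simp add: DERIV_def)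
    then show ?thesis using 3 by (simp add: half_bump_def)
  qed
qed

text \<open>The linear span that the Leibniz rule requires. The scalar sits inside the generators,
  so closure under sums is enough.\<close>

inductive bump_class :: "real \<Rightarrow> real \<Rightarrow> real \<Rightarrow> (real \<Rightarrow> real) \<Rightarrow> bool" for c a b where
  prod: "bump_class c a b (\<lambda>x. k * (half_bump c i (x - a) * half_bump c j (b - x)))"
| add: "bump_class c a b f \<Longrightarrow> bump_class c a b g \<Longrightarrow> bump_class c a b (\<lambda>x. f x + g x)"

lemma bump_class_has_derivative:
  assumes "c > 0" "bump_class c a b f"
  shows "\<exists>f'. bump_class c a b f' \<and> (\<forall>x. (f has_vector_derivative f' x) (at x))"
  using assms(2)
proof induction
  case (prod k i j)
  let ?h = "\<lambda>i j x. half_bump c i (x - a) * half_bump c j (b - x)"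
  let ?f' = "\<lambda>x. (((- k * real i) * ?h (i + 1) j x + (k * c) * ?h (i + 2) j x) + (k * real j) * ?h i (j + 1) x)
     + (- k * c) * ?h i (j + 2) x"
  have "((\<lambda>x. k * ?h i j x) has_real_derivative ?f' x) (at x)" for x
  proof -
    have 1: "((\<lambda>x. half_bump c i (x - a)) has_real_derivative
        (- real i * half_bump c (i + 1) (x - a) + c * half_bump c (i + 2) (x - a)) * 1) (at x)"
      by (rule DERIV_chain2[OF half_bump_has_derivative[OF assms(1)]]) (auto intro!: derivative_eq_intros)
    have 2: "((\<lambda>x. half_bump c j (b - x)) has_real_derivative
        (- real j * half_bump c (j + 1) (b - x) + c * half_bump c (j + 2) (b - x)) * (- 1)) (at x)"
      by (rule DERIV_chain2[OF half_bump_has_derivative[OF assms(1)]]) (auto intro!: derivative_eq_intros)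
    show ?thesis
      using DERIV_cmult[OF DERIV_mult[OF 1 2], of k] by (simp add: algebra_simps)
  qed
  moreover have "bump_class c a b ?f'" by (intro bump_class.intros)
  ultimately show ?case by (auto simp: has_real_derivative_iff_has_vector_derivative)
next
  case (add f g)
  then obtain f' g' where "bump_class c a b f'" "bump_class c a b g'"
    "\<And>x. (f has_vector_derivative f' x) (at x)" "\<And>x. (g has_vector_derivative g' x) (at x)"
    by blast
  then show ?case
    by (intro exI[of _ "\<lambda>x. f' x + g' x"]) (auto intro!: bump_class.add has_vector_derivative_add)
qed

definition bump :: "real \<Rightarrow> real \<Rightarrow> real \<Rightarrow> real \<Rightarrow> real" where
  "bump c a b x = half_bump c 0 (x - a) * half_bump c 0 (b - x)"

lemma bump_tests:
  assumes "c > 0" "- 1 < a" "b < 1"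
  obtains F where "tests F" "F 0 = bump c a b"
proof -
  have "bump_class c a b (bump c a b)"
    using bump_class.prod[of c a b 1 0 0] by (simp add: bump_def[abs_def])
  then obtain F where F: "derivs F" "F 0 = bump c a b"
    using derivs_of_closed[of "bump_class c a b"] bump_class_has_derivative[OF assms(1)] by blast
  have "tests F"
  proof (rule testsI[OF F(1)])
    show "0 < max (1/2) (max (- a) b)" "max (1/2) (max (- a) b) < 1" using assms by auto
    show "F 0 t = 0" if "\<bar>t\<bar> > max (1/2) (max (- a) b)" for t
      using that by (auto simp: F bump_def half_bump_def)
  qed
  then show ?thesis using that F(2) by blast
qed

section \<open>The fundamental lemma of the calculus of variations\<close>

text \<open>Bumps of steepness \<open>c n\<close> on the interval shrunk by \<open>c n\<close> at
  both ends are bounded by 1 and tend pointwise to the indicator; dominated convergence does the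
  rest. The shrinking makes them test functions even for \<open>a = -1\<close> or
  \<open>b = 1\<close>.\<close>

lemma LI_indicator_eq_0:
  fixes f :: "real \<Rightarrow> real"
  assumes f: "integr f" and ann: "\<And>F. tests F \<Longrightarrow> LI (\<lambda>t. F 0 t * f t) = 0"
    and ab: "- 1 \<le> a" "b \<le> 1"
  shows "LI (\<lambda>t. indicator {a<..<b} t * f t) = 0"
proof -
  define c :: "nat \<Rightarrow> real" where "c n = 1 / real (Suc n)" for n
  have c: "c n > 0" for n by (simp add: c_def)
  have c0: "c \<longlonglongrightarrow> 0" unfolding c_def by (rule lim_1_over_n[THEN LIMSEQ_Suc])
  let ?\<phi> = "\<lambda>n. bump (c n) (a + c n) (b - c n)"
  have lim: "(\<lambda>n. ?\<phi> n t) \<longlonglongrightarrow> indicator {a<..<b} t" for t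
  proof (cases "t \<in> {a<..<b}")
    case True
    have "\<forall>\<^sub>F n in sequentially. c n < min (t - a) (b - t)"
      by (rule order_tendstoD(2)[OF c0]) (use True in auto)
    then have "\<forall>\<^sub>F n in sequentially. exp (- (c n / (t - (a + c n)))) * exp (- (c n / ((b - c n) - t))) = ?\<phi> n t"
      by eventually_elim (simp add: bump_def half_bump_def)
    moreover have "(\<lambda>n. exp (- (c n / (t - (a + c n)))) * exp (- (c n / ((b - c n) - t)))) \<longlonglongrightarrow>
        exp (- (0 / (t - (a + 0)))) * exp (- (0 / ((b - 0) - t)))"
      using True by (intro tendsto_intros c0) auto
    ultimately show ?thesis using True by (auto elim!: Lim_transform_eventually[rotated])
  next
    case False
    then have "?\<phi> n t = 0" for n
      using c[of n] by (auto simp: bump_def half_bump_def)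
    then show ?thesis using False by simp
  qed
  have le: "\<bar>?\<phi> n t\<bar> \<le> 1" for n t
    using c[of n] by (auto simp: bump_def half_bump_def abs_mult intro!: mult_le_one)
  have meas: "?\<phi> n \<in> borel_measurable mI" and zero: "LI (\<lambda>t. ?\<phi> n t * f t) = 0" for n
  proof -
    obtain F where "tests F" "F 0 = ?\<phi> n" using bump_tests[of "c n" "a + c n" "b - c n"] c[of n] ab by auto
    then show "?\<phi> n \<in> borel_measurable mI" "LI (\<lambda>t. ?\<phi> n t * f t) = 0"
      using derivs_measurable[OF tests_derivs, of F 0] ann[of F] by auto
  qed
  have "(\<lambda>n. LI (\<lambda>t. ?\<phi> n t * f t)) \<longlonglongrightarrow> LI (\<lambda>t. indicator {a<..<b} t * f t)"
  proof (rule integral_dominated_convergence[where w = "\<lambda>t. \<bar>f t\<bar>"])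
    have [measurable]: "f \<in> borel_measurable mI" using f by simp
    note meas[measurable]
    show "(\<lambda>t. ?\<phi> n t * f t) \<in> borel_measurable mI" for n by measurable
    have "{a<..<b} \<in> sets lebesgue" by simp
    then have "(indicator {a<..<b} :: real \<Rightarrow> real) \<in> borel_measurable mI"
      by (intro measurable_restrict_space1 borel_measurable_indicator)
    then show "(\<lambda>t. indicator {a<..<b} t * f t) \<in> borel_measurable mI" by simp
    show "integr (\<lambda>t. \<bar>f t\<bar>)" using f by simp
    show "AE t in mI. (\<lambda>n. ?\<phi> n t * f t) \<longlonglongrightarrow> indicator {a<..<b} t * f t"
      by (intro AE_I2 tendsto_mult_right lim)
    show "AE t in mI. norm (?\<phi> n t * f t) \<le> \<bar>f t\<bar>" for n
      using le by (intro AE_I2) (simp add: abs_mult mult_left_le_one_le)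
  qed
  then show ?thesis by (simp add: zero LIMSEQ_const_iff)
qed

text \<open>Positive and negative part of \<open>g\<close> are densities of two measures that agree
  on all half-lines, hence on all Borel sets. Uniqueness of densities makes the two parts equal
  almost everywhere, so both vanish.\<close>

lemma AE_eq_0_of_tails:
  fixes g :: "real \<Rightarrow> real"
  assumes g: "integrable lborel g" and z: "\<And>x. integral\<^sup>L lborel (\<lambda>t. indicator {x<..} t * g t) = 0"
  shows "AE t in lborel. g t = 0"
proof -
  have [measurable]: "g \<in> borel_measurable borel" using g by simp
  \<comment> \<open>\<open>ennreal\<close> sends negative reals to 0, so these densities are the
    positive and the negative part.\<close>
  let ?P = "density lborel (\<lambda>t. ennreal (g t))" and ?N = "density lborel (\<lambda>t. ennreal (- g t))"
  have P: "emeasure ?P {x<..} = (\<integral>\<^sup>+t. ennreal (indicator {x<..} t * g t) \<partial>lborel)"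
    and N: "emeasure ?N {x<..} = (\<integral>\<^sup>+t. ennreal (- (indicator {x<..} t * g t)) \<partial>lborel)" for x
    by (auto simp: emeasure_density intro!: nn_integral_cong split: split_indicator)
  have int: "integrable lborel (\<lambda>t. indicator {x<..} t * g t)" for x
    using g by (rule Bochner_Integration.integrable_bound) (auto split: split_indicator)
  have fin: "emeasure ?P {x<..} < \<infinity>" "emeasure ?N {x<..} < \<infinity>" for x
    unfolding P N using int[of x] by (auto simp: real_integrable_def less_top)
  have "?P = ?N"
  proof (rule measure_eqI_lessThan)
    fix x
    have "enn2real (emeasure ?P {x<..}) = enn2real (emeasure ?N {x<..})"
      using z[of x] unfolding P N real_lebesgue_integral_def[OF int] by simp
    then show "emeasure ?P {x<..} = emeasure ?N {x<..}"
      using fin[of x] by (metis ennreal_enn2real infinity_ennreal_def)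
  qed (use fin in auto)
  then have "AE t in lborel. ennreal (g t) = ennreal (- g t)"
    by (intro sigma_finite_measure.density_unique[OF sigma_finite_lborel]) auto
  then show ?thesis
  proof (rule AE_mp, intro AE_I2 impI)
    fix t assume "ennreal (g t) = ennreal (- g t)"
    then show "g t = 0"
      by (cases "g t \<ge> 0") (auto simp: ennreal_neg ennreal_eq_0_iff dest!: sym[of 0])
  qed
qed

text \<open>The function is extended by zero and replaced by a Borel version, since the measure
  argument of \<open>AE_eq_0_of_tails\<close> lives on \<open>lborel\<close>. Half-lines cut down to
  the interval are then covered by \<open>LI_indicator_eq_0\<close>.\<close>

lemma fundamental_lemma_real:
  fixes f :: "real \<Rightarrow> real"
  assumes f: "integr f" and ann: "\<And>F. tests F \<Longrightarrow> LI (\<lambda>t. F 0 t * f t) = 0"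
  shows "AE t in mI. f t = 0"
proof -
  let ?f = "\<lambda>t. indicator Iv t * f t"
  have fi: "integrable lebesgue ?f"
    using f by (simp add: integrable_restrict_space)
  obtain g where g: "g \<in> borel_measurable lborel" "AE t in lborel. ?f t = g t"
    using completion_ex_borel_measurable_real[OF borel_measurable_integrable[OF fi]] by blast
  have [measurable]: "g \<in> borel_measurable borel" using g by simp
  have ae: "AE t in lebesgue. ?f t = g t" using g(2) by (rule AE_completion)
  have "integrable lebesgue g"
    by (rule integrable_cong_AE_imp[OF fi _ ae]) (simp add: measurable_completion)
  then have gi: "integrable lborel g" by (simp add: integrable_completion)
  have "integral\<^sup>L lborel (\<lambda>t. indicator {x<..} t * g t) = 0" for x
  proof -
    have "integral\<^sup>L lborel (\<lambda>t. indicator {x<..} t * g t) = integral\<^sup>L lebesgue (\<lambda>t. indicator {x<..} t * g t)"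
      by (rule integral_completion[symmetric]) simp
    also have "\<dots> = integral\<^sup>L lebesgue (\<lambda>t. indicator Iv t *\<^sub>R (indicator {max x (-1)<..<1} t * f t))"
    proof (rule integral_cong_AE)
      show "(\<lambda>t. indicator {x<..} t * g t) \<in> borel_measurable lebesgue"
        by (simp add: measurable_completion)
      have "(\<lambda>t. indicator {max x (-1)<..<1} t * ?f t) \<in> borel_measurable lebesgue"
        by (rule borel_measurable_times[OF measurable_completion borel_measurable_integrable[OF fi]]) simp
      then show "(\<lambda>t. indicator Iv t *\<^sub>R (indicator {max x (-1)<..<1} t * f t)) \<in> borel_measurable lebesgue"
        by (simp add: mult.left_commute)
      show "AE t in lebesgue. indicator {x<..} t * g t = indicator Iv t *\<^sub>R (indicator {max x (-1)<..<1} t * f t)"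
        using ae by (rule AE_mp) (auto intro!: AE_I2 split: split_indicator)
    qed
    also have "\<dots> = LI (\<lambda>t. indicator {max x (-1)<..<1} t * f t)"
      by (simp add: integral_restrict_space)
    finally show ?thesis using LI_indicator_eq_0[of f "max x (-1)" 1] f ann by simp
  qed
  then have "AE t in lborel. g t = 0" by (rule AE_eq_0_of_tails[OF gi])
  with g(2) have "AE t in lborel. ?f t = 0" by eventually_elim simp
  then have "AE t in lebesgue. t \<in> Iv \<longrightarrow> f t = 0"
    by (rule AE_mp[OF AE_completion]) (auto intro!: AE_I2 split: split_indicator)
  then show ?thesis by (simp add: AE_restrict_space_iff)
qed

lemma fundamental_lemma:
  fixes f :: "real \<Rightarrow> 'a::euclidean_space"
  assumes f: "integr f" and ann: "\<And>F :: nat \<Rightarrow> real \<Rightarrow> real. tests F \<Longrightarrow> LI (\<lambda>t. F 0 t *\<^sub>R f t) = 0"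
  shows "AE t in mI. f t = 0"
proof -
  have "AE t in mI. f t \<bullet> b = 0" for b
  proof (rule fundamental_lemma_real)
    show "integr (\<lambda>t. f t \<bullet> b)" using f by simp
    fix F :: "nat \<Rightarrow> real \<Rightarrow> real" assume F: "tests F"
    have "integr (\<lambda>t. F 0 t *\<^sub>R f t)"
      using F f by (intro integr_scaleR derivs_continuous_on tests_derivs)
    then have "LI (\<lambda>t. (F 0 t *\<^sub>R f t) \<bullet> b) = LI (\<lambda>t. F 0 t *\<^sub>R f t) \<bullet> b"
      by (rule integral_inner_left)
    then show "LI (\<lambda>t. F 0 t * (f t \<bullet> b)) = 0" using ann[OF F] by simp
  qed
  then have "AE t in mI. \<forall>b\<in>Basis. f t \<bullet> b = 0"
    by (intro AE_finite_allI) auto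
  then show ?thesis by eventually_elim (simp add: euclidean_all_zero_iff)
qed

section \<open>Weak solutions of scalar linear differential equations\<close>

lemma AE_Iv_False: "\<not> (AE t in mI. False)"
proof
  assume "AE t in mI. False"
  then have "AE t in mI. (1::real) = 0" by eventually_elim simp
  then have "LI (\<lambda>t. 1::real) = 0" by (rule integral_eq_zero_AE)
  moreover have "LI (\<lambda>t. 1::real) = 2"
    by (subst LI_eq_integral) auto
  ultimately show False by simp
qed

text \<open>
  A test function with vanishing integral against \<open>exp (-\<mu> t)\<close> is in the image of \<open>d/dt - \<mu>\<close>; so a
  functional vanishing on that image is a multiple of integration against \<open>exp (-\<mu> t)\<close>.
\<close>

lemma weighted_antiderivative:
  fixes \<Theta> :: "nat \<Rightarrow> real \<Rightarrow> complex"
  assumes \<Theta>: "tests \<Theta>" and z: "LI (\<lambda>t. exp (- \<mu> * of_real t) * \<Theta> 0 t) = 0"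
  obtains \<Psi> where "tests \<Psi>" "\<And>k t. \<Psi> (Suc k) t = \<mu> * \<Psi> k t + \<Theta> k t"
proof -
  obtain r where r: "0 < r" "r < 1" "\<And>k t. \<bar>t\<bar> > r \<Longrightarrow> \<Theta> k t = 0"
    using \<Theta> unfolding tests_def by blast
  define g where "g = (\<lambda>t. exp (- \<mu> * of_real t) * \<Theta> 0 t)"
  \<comment> \<open>The lower limit -2 lies strictly left of the support. Hence every
    \<open>t \<ge> - r\<close> is interior to \<open>{-2..t + 1}\<close> and the one-sided
    derivative of the integral is two-sided.\<close>
  define G where "G = (\<lambda>t. integral {-2..t} g)"
  have cont: "continuous_on S g" for S
    unfolding g_def by (intro continuous_intros derivs_continuous_on tests_derivs \<Theta>)
  have g0: "g t = 0" if "\<bar>t\<bar> > r" for t using r(3)[OF that] by (simp add: g_def)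
  have int0: "integral {a..b} g = 0" if "\<And>t. t \<in> {a..b} \<Longrightarrow> \<bar>t\<bar> > r" for a b
    using that g0 by (subst integral_cong[of _ g "\<lambda>_. 0"]) auto
  have G_left: "G t = 0" if "t < - r" for t
    unfolding G_def by (rule int0) (use that r in auto)
  have dG: "(G has_vector_derivative g t) (at t)" for t
  proof (cases "t < - r")
    case True
    then have "(G has_vector_derivative 0) (at t)"
      by (intro has_vector_derivative_transform_within_open[OF has_vector_derivative_const, of "{..<- r}"])
         (auto simp: G_left)
    then show ?thesis using True r by (simp add: g0)
  next
    case False
    have "(G has_vector_derivative g t) (at t within {-2..t + 1})"
      unfolding G_def using False r by (intro integral_has_vector_derivative cont) auto
    then show ?thesis using False r by (simp add: at_within_Icc_at)
  qed
  have int: "g integrable_on {a..b}" for a b by (intro integrable_continuous_real cont)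
  have "integral {-1..1} g = 0"
    using z LI_eq_integral[OF cont] by (simp add: g_def)
  moreover have "integral {-2..-1} g = 0" by (rule int0) (use r in auto)
  ultimately have G1: "integral {-2..1} g = 0"
    using Henstock_Kurzweil_Integration.integral_combine[of "-2" "-1" 1 g] int by simp
  have G_right: "G t = 0" if "t > r" for t
  proof (cases "t \<ge> 1")
    case True
    have "integral {1..t} g = 0" by (rule int0) (use r in auto)
    then show ?thesis
      using True G1 Henstock_Kurzweil_Integration.integral_combine[of "-2" 1 t g] int by (simp add: G_def)
  next
    case False
    have "integral {t..1} g = 0" by (rule int0) (use r that in auto)
    then show ?thesis
      using False that r G1 Henstock_Kurzweil_Integration.integral_combine[of "-2" t 1 g] int by (simp add: G_def)
  qed
  \<comment> \<open>The recursion makes the differential equation hold by definition; that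
    successive entries really are derivatives is then an induction whose base case is the product
    rule.\<close>
  define \<Psi> where "\<Psi> = rec_nat (\<lambda>t. exp (\<mu> * of_real t) * G t) (\<lambda>k f t. \<mu> * f t + \<Theta> k t)"
  have \<Psi>0: "\<Psi> 0 = (\<lambda>t. exp (\<mu> * of_real t) * G t)" and \<Psi>S: "\<Psi> (Suc k) t = \<mu> * \<Psi> k t + \<Theta> k t" for k t
    by (simp_all add: \<Psi>_def)
  have d0: "(\<Psi> 0 has_vector_derivative \<Psi> (Suc 0) t) (at t)" for t
  proof -
    have "((\<lambda>t. exp (\<mu> * of_real t)) has_vector_derivative (exp (\<mu> * of_real t) * \<mu>)) (at t)"
      by (rule has_vector_derivative_real_field) (auto intro!: derivative_eq_intros)
    from has_vector_derivative_mult[OF this dG[of t]]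
    have "(\<Psi> 0 has_vector_derivative (exp (\<mu> * of_real t) * g t + exp (\<mu> * of_real t) * \<mu> * G t)) (at t)"
      by (simp add: \<Psi>0)
    moreover have "exp (\<mu> * of_real t) * g t = \<Theta> 0 t"
      by (simp add: g_def exp_minus field_simps)
    ultimately show ?thesis by (simp add: \<Psi>S \<Psi>0 mult_ac add.commute)
  qed
  have "(\<Psi> k has_vector_derivative \<Psi> (Suc k) t) (at t)" for k t
  proof (induction k arbitrary: t)
    case (Suc k)
    have "\<Psi> (Suc k) = (\<lambda>t. \<mu> * \<Psi> k t + \<Theta> k t)" using \<Psi>S by blast
    moreover have "(\<Theta> k has_vector_derivative \<Theta> (Suc k) t) (at t)" using \<Theta> by (simp add: tests_def derivs_def)
    ultimately show ?case
      using Suc[of t] by (auto simp: \<Psi>S[of "Suc k"] intro!: has_vector_derivative_add has_vector_derivative_mult_right)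
  qed (rule d0)
  then have "derivs \<Psi>" by (simp add: derivs_def)
  then have "tests \<Psi>"
    by (rule testsI[OF _ r(1,2)]) (use G_left G_right in \<open>auto simp: \<Psi>0 abs_if split: if_splits\<close>)
  then show ?thesis using that \<Psi>S by blast
qed

text \<open>Complex-linear functionals on test functions. Precomposing with a factor of the operator
  leaves the form of integration against a given function, so the induction on the degree has to be
  carried out for functionals.\<close>

locale test_functional =
  fixes T :: "(nat \<Rightarrow> real \<Rightarrow> complex) \<Rightarrow> complex"
  assumes add: "\<And>F G. tests F \<Longrightarrow> tests G \<Longrightarrow> T (\<lambda>k t. F k t + G k t) = T F + T G"
    and cmult: "\<And>c F. tests F \<Longrightarrow> T (\<lambda>k t. c * F k t) = c * T F"

text \<open>Expansion at -1 of \<open>exp (- \<mu> * t)\<close>, that is, of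
  \<open>exp \<mu>\<close> times \<open>exp (- \<mu> * (t + 1))\<close>.\<close>

lemma taylor_exp:
  fixes \<mu> :: complex
  shows "exp_bdd (\<lambda>k. exp \<mu> * (- \<mu>) ^ k)" "taylor (\<lambda>k. exp \<mu> * (- \<mu>) ^ k) t = exp (- \<mu> * of_real t)"
proof -
  show "exp_bdd (\<lambda>k. exp \<mu> * (- \<mu>) ^ k)"
    by (rule exp_bddI[of _ "norm (exp \<mu>)" "norm \<mu>"]) (simp add: norm_mult norm_power)
  have "(\<Sum>k. ((t + 1) ^ k / fact k) *\<^sub>R (exp \<mu> * (- \<mu>) ^ k)) = (\<Sum>k. exp \<mu> * ((- \<mu> * of_real (t + 1)) ^ k /\<^sub>R fact k))"
  proof (intro suminf_cong)
    fix k
    have "(- \<mu> * of_real (t + 1)) ^ k = (- \<mu>) ^ k * of_real ((t + 1) ^ k)"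
      by (simp only: power_mult_distrib of_real_power)
    then show "((t + 1) ^ k / fact k) *\<^sub>R (exp \<mu> * (- \<mu>) ^ k) = exp \<mu> * ((- \<mu> * of_real (t + 1)) ^ k /\<^sub>R fact k)"
      by (simp add: scaleR_conv_of_real divide_inverse mult_ac)
  qed
  also have "\<dots> = exp \<mu> * exp (- \<mu> * of_real (t + 1))"
    by (subst suminf_mult) (auto simp: exp_def summable_exp_generic)
  also have "\<dots> = exp (- \<mu> * of_real t)"
    by (simp add: exp_add[symmetric] algebra_simps)
  finally show "taylor (\<lambda>k. exp \<mu> * (- \<mu>) ^ k) t = exp (- \<mu> * of_real t)" by (simp add: taylor_def)
qed

lemma taylor_continuous_on: "exp_bdd a \<Longrightarrow> continuous_on S (taylor a)"
  using derivs_continuous_on[OF derivs_taylor, of a S 0] by simp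

lemma LI_add_cont:
  fixes f g :: "real \<Rightarrow> 'a::euclidean_space"
  assumes "continuous_on {-1..1} f" "continuous_on {-1..1} g"
  shows "LI (\<lambda>t. f t + g t) = LI f + LI g"
  using assms by (intro Bochner_Integration.integral_add continuous_integr)

text \<open>A particular solution \<open>g\<close> of g' + \<mu> g = -e, the adjoint equation, is
  subtracted so that the remainder \<open>T1\<close> annihilates the image of d/dt - \<mu>. A
  multiple of integration against \<open>exp (- \<mu> * t)\<close>, the homogeneous adjoint
  solution, is all that is left.\<close>

lemma (in test_functional) first_order:
  assumes e: "exp_bdd e"
    and eq: "\<And>F. tests F \<Longrightarrow> T (\<lambda>k t. act [:- \<mu>, 1:] (\<lambda>i. F i t) k) = LI (\<lambda>t. taylor e t * F 0 t)"
  obtains a where "exp_bdd a" "\<And>F. tests F \<Longrightarrow> T F = LI (\<lambda>t. taylor a t * F 0 t)"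
proof -
  obtain g where g0: "\<And>i. i < degree [:\<mu>, 1:] \<Longrightarrow> g i = 0" and g: "\<And>k. act [:\<mu>, 1:] g k = - e k"
    using act_solve[of "[:\<mu>, 1:]" "\<lambda>k. - e k"] by auto
  have ge: "exp_bdd g"
    by (rule exp_bdd_solve[OF _ exp_bdd_minus[OF e] g0 g]) auto
  let ?m = "\<lambda>F :: nat \<Rightarrow> real \<Rightarrow> complex. LI (\<lambda>t. exp (- \<mu> * of_real t) * F 0 t)"
  define T1 where "T1 F = T F - LI (\<lambda>t. taylor g t * F 0 t)" for F
  have cont: "continuous_on {-1..1} (F k)" if "tests F" for k and F :: "nat \<Rightarrow> real \<Rightarrow> complex"
    using that by (intro derivs_continuous_on tests_derivs)
  have contg: "continuous_on {-1..1} (taylor g)" using ge by (rule taylor_continuous_on)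
  have T1_0: "T1 (\<lambda>k t. act [:- \<mu>, 1:] (\<lambda>i. F i t) k) = 0" if F: "tests F" for F
  proof -
    have "LI (\<lambda>t. F 1 t * taylor g t) = - LI (\<lambda>t. F 0 t * taylor (\<lambda>i. g (Suc i)) t)"
      using LI_by_parts[OF bounded_bilinear_mult F derivs_taylor[OF ge], of 0 0] by simp
    moreover have "taylor (\<lambda>i. g (Suc i)) t = - taylor e t - \<mu> * taylor g t" for t
    proof -
      have "taylor (\<lambda>i. g (Suc i)) t = taylor (\<lambda>k. - e k - \<mu> * g k) t"
        using g by (intro arg_cong2[where f = taylor]) (auto simp: fun_eq_iff algebra_simps)
      also have "\<dots> = - taylor e t - \<mu> * taylor g t"
        using e ge by (simp add: taylor_diff exp_bdd_minus exp_bdd_cmult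
            taylor_bounded_linear[OF bounded_linear_mult_right, symmetric] taylor_bounded_linear[OF bounded_linear_minus[OF bounded_linear_ident], symmetric])
      finally show ?thesis .
    qed
    ultimately have "LI (\<lambda>t. taylor g t * F 1 t) = LI (\<lambda>t. taylor e t * F 0 t + \<mu> * (taylor g t * F 0 t))"
      by (simp add: Bochner_Integration.integral_minus[symmetric] algebra_simps del: Bochner_Integration.integral_minus)
    also have "\<dots> = LI (\<lambda>t. taylor e t * F 0 t) + \<mu> * LI (\<lambda>t. taylor g t * F 0 t)"
      using e ge by (subst LI_add_cont) (auto intro!: continuous_intros taylor_continuous_on cont[OF F])
    finally have "LI (\<lambda>t. taylor g t * F 1 t) - \<mu> * LI (\<lambda>t. taylor g t * F 0 t) = LI (\<lambda>t. taylor e t * F 0 t)"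
      by simp
    moreover have "LI (\<lambda>t. taylor g t * act [:- \<mu>, 1:] (\<lambda>i. F i t) 0) = LI (\<lambda>t. taylor g t * F 1 t + (- \<mu>) * (taylor g t * F 0 t))"
      by (simp add: algebra_simps)
    moreover have "\<dots> = LI (\<lambda>t. taylor g t * F 1 t) + (- \<mu>) * LI (\<lambda>t. taylor g t * F 0 t)"
      using ge by (subst LI_add_cont) (auto intro!: continuous_intros taylor_continuous_on cont[OF F])
    ultimately show ?thesis unfolding T1_def eq[OF F] by simp
  qed
  have T1_add: "T1 (\<lambda>k t. F k t + G k t) = T1 F + T1 G" if "tests F" "tests G" for F G
    using that ge add[OF that]
    by (simp add: T1_def distrib_left LI_add_cont continuous_on_mult contg cont)
  have T1_cmult: "T1 (\<lambda>k t. c * F k t) = c * T1 F" if "tests F" for F c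
    using cmult[OF that] by (simp add: T1_def mult.left_commute algebra_simps)
  \<comment> \<open>A normalizing test function; it exists because the exponential has no zeros, so
    by the fundamental lemma its weighted integrals cannot all vanish.\<close>
  obtain F0 where F0: "tests F0" "?m F0 \<noteq> 0"
  proof (rule ccontr)
    assume "\<not> thesis"
    then have all: "?m F = 0" if "tests F" for F using that \<open>\<And>F0. tests F0 \<Longrightarrow> ?m F0 \<noteq> 0 \<Longrightarrow> thesis\<close> by blast
    have "AE t in mI. exp (- \<mu> * of_real t) = 0"
    proof (rule fundamental_lemma)
      show "integr (\<lambda>t. exp (- \<mu> * of_real t))" by (intro continuous_integr continuous_intros)
      fix F :: "nat \<Rightarrow> real \<Rightarrow> real" assume "tests F"
      then have "tests (\<lambda>k t. complex_of_real (F k t))" by (rule tests_bounded_linear[OF bounded_linear_of_real])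
      from all[OF this] show "LI (\<lambda>t. F 0 t *\<^sub>R exp (- \<mu> * of_real t)) = 0"
        by (simp add: scaleR_conv_of_real mult.commute)
    qed
    then show False using AE_Iv_False by simp
  qed
  define \<kappa> where "\<kappa> = T1 F0 / ?m F0"
  have m_add: "?m (\<lambda>k t. F k t + G k t) = ?m F + ?m G" if "tests F" "tests G" for F G
    using that by (simp add: distrib_left LI_add_cont continuous_intros cont)
  have key: "T1 F = \<kappa> * ?m F" if F: "tests F" for F
  proof -
    \<comment> \<open>Chosen so that \<open>F + d * F0\<close> has vanishing weighted integral and
      therefore lies in the image of d/dt - \<mu>.\<close>
    define d where "d = - (?m F / ?m F0)"
    have d: "d * ?m F0 = - ?m F" using F0(2) by (simp add: d_def)
    have dF0: "tests (\<lambda>k t. d * F0 k t)" by (rule tests_bounded_linear[OF bounded_linear_mult_right F0(1)])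
    define \<Theta> where "\<Theta> = (\<lambda>k t. F k t + d * F0 k t)"
    have \<Theta>: "tests \<Theta>" unfolding \<Theta>_def by (rule tests_add[OF F dF0])
    have "?m \<Theta> = 0"
      unfolding \<Theta>_def using m_add[OF F dF0] d by (simp add: mult.left_commute)
    then obtain \<Psi> where \<Psi>: "tests \<Psi>" "\<And>k t. \<Psi> (Suc k) t = \<mu> * \<Psi> k t + \<Theta> k t"
      using weighted_antiderivative[OF \<Theta>] by blast
    have "(\<lambda>k t. act [:- \<mu>, 1:] (\<lambda>i. \<Psi> i t) k) = \<Theta>" by (simp add: \<Psi>(2))
    then have "T1 \<Theta> = 0" using T1_0[OF \<Psi>(1)] by simp
    then have "T1 F + d * T1 F0 = 0"
      unfolding \<Theta>_def using T1_add[OF F dF0] T1_cmult[OF F0(1), of d] by simp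
    then show ?thesis by (simp add: \<kappa>_def d_def field_simps add_eq_0_iff)
  qed
  let ?h = "\<lambda>k. \<kappa> * (exp \<mu> * (- \<mu>) ^ k)"
  have h: "exp_bdd ?h" "taylor ?h t = \<kappa> * exp (- \<mu> * of_real t)" for t
    using taylor_exp[of \<mu>] by (simp_all add: exp_bdd_cmult taylor_bounded_linear[OF bounded_linear_mult_right, symmetric])
  show ?thesis
  proof
    show "exp_bdd (\<lambda>k. g k + ?h k)" by (intro exp_bdd_add ge h)
    fix F :: "nat \<Rightarrow> real \<Rightarrow> complex" assume F: "tests F"
    have "LI (\<lambda>t. taylor (\<lambda>k. g k + ?h k) t * F 0 t) = LI (\<lambda>t. taylor g t * F 0 t + \<kappa> * (exp (- \<mu> * of_real t) * F 0 t))"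
      by (simp only: taylor_add[OF ge h(1)] h(2) distrib_right mult.assoc)
    also have "\<dots> = LI (\<lambda>t. taylor g t * F 0 t) + \<kappa> * ?m F"
      using ge by (subst LI_add_cont) (auto intro!: continuous_intros taylor_continuous_on cont[OF F])
    also have "\<dots> = T F" using key[OF F] by (simp add: T1_def diff_eq_eq add.commute)
    finally show "T F = LI (\<lambda>t. taylor (\<lambda>k. g k + ?h k) t * F 0 t)" by simp
  qed
qed

text \<open>Induction on the degree: a root splits off a linear factor. \<open>T\<close> composed
  with the cofactor \<open>Q\<close> solves a first-order equation, hence is integration against a
  Taylor function, which becomes the right-hand side for \<open>Q\<close>.\<close>

lemma weak_ode_complex:
  assumes "P \<noteq> 0" "test_functional T" "exp_bdd e"
    and "\<And>F. tests F \<Longrightarrow> T (\<lambda>k t. act P (\<lambda>i. F i t) k) = LI (\<lambda>t. taylor e t * F 0 t)"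
  shows "\<exists>a. exp_bdd a \<and> (\<forall>F. tests F \<longrightarrow> T F = LI (\<lambda>t. taylor a t * F 0 t))"
  using assms
proof (induction "degree P" arbitrary: P T e)
  case 0
  then obtain c where P: "P = [:c:]" "c \<noteq> 0" by (metis degree_0_id of_nat_0 pCons_0_0 degree_eq_zeroE)
  interpret test_functional T by fact
  have "T F = LI (\<lambda>t. taylor (\<lambda>k. inverse c * e k) t * F 0 t)" if F: "tests F" for F
  proof -
    have "c * T F = LI (\<lambda>t. taylor e t * F 0 t)" using 0(5)[OF F] cmult[OF F, of c] by (simp add: P)
    then have "T F = inverse c * LI (\<lambda>t. taylor e t * F 0 t)" using P by (simp add: field_simps)
    also have "\<dots> = LI (\<lambda>t. taylor (\<lambda>k. inverse c * e k) t * F 0 t)"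
      using 0 by (simp add: taylor_bounded_linear[OF bounded_linear_mult_right, symmetric] mult.assoc)
    finally show ?thesis .
  qed
  then show ?case using exp_bdd_cmult[OF 0(4), of "inverse c"] by blast
next
  case (Suc n)
  interpret test_functional T by fact
  obtain \<mu> where "poly P \<mu> = 0"
    using fundamental_theorem_of_algebra_alt[of P] Suc(2) by fastforce
  then obtain Q where Q: "P = [:- \<mu>, 1:] * Q" by (metis dvdE poly_eq_0_iff_dvd)
  have Q0: "Q \<noteq> 0" using Suc(3) Q by auto
  have "degree P = degree [:- \<mu>, 1:] + degree Q"
    unfolding Q using Q0 by (intro degree_mult_eq) auto
  then have deg: "n = degree Q" using Suc(2) by simp
  define T' where "T' = (\<lambda>F. T (\<lambda>k t. act Q (\<lambda>i. F i t) k))"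
  interpret T': test_functional T'
  proof
    fix F G :: "nat \<Rightarrow> real \<Rightarrow> complex" assume "tests F" "tests G"
    then show "T' (\<lambda>k t. F k t + G k t) = T' F + T' G"
      unfolding T'_def act_add_right by (intro add tests_act)
  next
    fix c and F :: "nat \<Rightarrow> real \<Rightarrow> complex" assume "tests F"
    then show "T' (\<lambda>k t. c * F k t) = c * T' F"
      unfolding T'_def act_cmult_right by (intro cmult tests_act)
  qed
  have "T' (\<lambda>k t. act [:- \<mu>, 1:] (\<lambda>i. F i t) k) = LI (\<lambda>t. taylor e t * F 0 t)" if F: "tests F" for F
  proof -
    have "act Q (act [:- \<mu>, 1:] (\<lambda>i. F i t)) k = act P (\<lambda>i. F i t) k" for k t
      unfolding Q by (metis act_mult mult.commute)
    then show ?thesis using Suc(6)[OF F] by (simp add: T'_def del: act_pCons)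
  qed
  then obtain a where "exp_bdd a" "\<And>F. tests F \<Longrightarrow> T' F = LI (\<lambda>t. taylor a t * F 0 t)"
    using T'.first_order[OF Suc(5)] by blast
  then show ?case
    using Suc(1)[OF deg Q0 Suc(4)] unfolding T'_def by blast
qed

lemma LI_Re: "integr f \<Longrightarrow> LI (\<lambda>t. Re (f t)) = Re (LI f)"
  and LI_Im: "integr f \<Longrightarrow> LI (\<lambda>t. Im (f t)) = Im (LI f)"
  by (rule integral_bounded_linear[OF bounded_linear_Re] integral_bounded_linear[OF bounded_linear_Im]; assumption)+

text \<open>Complexified in order to have roots: the equation passes to complex test functions
  through their real and imaginary parts, and the real part of the resulting function represents
  \<open>w\<close>.\<close>

lemma weak_ode_regular:
  fixes w :: "real \<Rightarrow> real"
  assumes P: "P \<noteq> 0" and w: "integr w"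
    and eq: "\<And>F. tests F \<Longrightarrow> LI (\<lambda>t. act P (\<lambda>i. F i t) 0 * w t) = 0"
  obtains a where "exp_bdd a" "AE t in mI. w t = taylor a t"
proof -
  let ?P = "map_poly complex_of_real P"
  define T where "T = (\<lambda>F :: nat \<Rightarrow> real \<Rightarrow> complex. LI (\<lambda>t. F 0 t * of_real (w t)))"
  have wc: "integr (\<lambda>t. complex_of_real (w t))" using w by simp
  have int: "integr (\<lambda>t. F k t * of_real (w t))" if "tests F" for F :: "nat \<Rightarrow> real \<Rightarrow> complex" and k
    using that by (intro integr_mult wc derivs_continuous_on tests_derivs)
  have T: "test_functional T"
    by unfold_locales (simp_all add: T_def distrib_right int mult.assoc)
  have P': "?P \<noteq> 0" using P by (simp add: poly_eq_iff coeff_map_poly)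
  have deg: "degree ?P = degree P" by (rule degree_map_poly) simp
  have eqC: "T (\<lambda>k t. act ?P (\<lambda>i. F i t) k) = LI (\<lambda>t. taylor (\<lambda>_. 0) t * F 0 t)" if F: "tests F" for F
  proof -
    let ?I = "\<lambda>t. act ?P (\<lambda>i. F i t) 0 * of_real (w t)"
    have I: "integr ?I" using int[OF tests_act[OF F], of ?P 0] .
    have "Re (?I t) = act P (\<lambda>i. Re (F i t)) 0 * w t" "Im (?I t) = act P (\<lambda>i. Im (F i t)) 0 * w t" for t
      by (simp_all add: act_def deg coeff_map_poly)
    then have "Re (LI ?I) = 0" "Im (LI ?I) = 0"
      using eq[OF tests_bounded_linear[OF bounded_linear_Re F]] eq[OF tests_bounded_linear[OF bounded_linear_Im F]]
      by (simp_all only: LI_Re[OF I, symmetric] LI_Im[OF I, symmetric])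
    then show ?thesis by (simp add: T_def complex_eq_iff)
  qed
  obtain a where a: "exp_bdd a" "\<And>F. tests F \<Longrightarrow> T F = LI (\<lambda>t. taylor a t * F 0 t)"
    using weak_ode_complex[OF P' T exp_bdd_0 eqC] by blast
  have Re_a: "Re (taylor a t) = taylor (\<lambda>k. Re (a k)) t" for t
    by (rule taylor_bounded_linear[OF bounded_linear_Re a(1)])
  have conta: "continuous_on {-1..1} (\<lambda>t. Re (taylor a t))"
    by (intro continuous_intros taylor_continuous_on a)
  have "AE t in mI. w t - Re (taylor a t) = 0"
  proof (rule fundamental_lemma_real)
    show "integr (\<lambda>t. w t - Re (taylor a t))"
      by (intro Bochner_Integration.integrable_diff w continuous_integr conta)
    fix F :: "nat \<Rightarrow> real \<Rightarrow> real" assume F: "tests F"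
    have cF: "continuous_on {-1..1} (F 0)" using F by (intro derivs_continuous_on tests_derivs)
    have FC: "tests (\<lambda>k t. complex_of_real (F k t))" by (rule tests_bounded_linear[OF bounded_linear_of_real F])
    have "LI (\<lambda>t. complex_of_real (F 0 t) * of_real (w t)) = LI (\<lambda>t. taylor a t * of_real (F 0 t))"
      using a(2)[OF FC] by (simp add: T_def)
    then have "Re (LI (\<lambda>t. complex_of_real (F 0 t) * of_real (w t))) = Re (LI (\<lambda>t. taylor a t * of_real (F 0 t)))"
      by simp
    moreover have "integr (\<lambda>t. taylor a t * complex_of_real (F 0 t))"
      by (intro continuous_integr continuous_intros taylor_continuous_on a cF)
    ultimately have "LI (\<lambda>t. F 0 t * w t) = LI (\<lambda>t. F 0 t * Re (taylor a t))"
      using int[OF FC, of 0] by (simp add: LI_Re[symmetric] mult.commute)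
    moreover have "integr (\<lambda>t. F 0 t * w t)" "integr (\<lambda>t. F 0 t * Re (taylor a t))"
      by (intro integr_mult cF w, intro integr_mult cF continuous_integr conta)
    ultimately show "LI (\<lambda>t. F 0 t * (w t - Re (taylor a t))) = 0"
      by (simp add: right_diff_distrib)
  qed
  then have "AE t in mI. w t = taylor (\<lambda>k. Re (a k)) t"
    by eventually_elim (simp add: Re_a)
  then show ?thesis using that exp_bdd_bounded_linear[OF bounded_linear_Re a(1)] by blast
qed

section \<open>Square-integrable functions and weak derivatives\<close>

declare transpose_matrix_vector [simp del]

lemma L2_integr:
  assumes "f \<in> L2"
  shows "integr f"
proof (rule Bochner_Integration.integrable_bound)
  show "integr (\<lambda>t. 1 + (norm (f t))\<^sup>2)"
    using assms finite_measure.integrable_const[OF finite_measure_Iv]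
    by (intro Bochner_Integration.integrable_add) (auto simp: L2_def)
  show "AE t in mI. norm (f t) \<le> norm (1 + (norm (f t))\<^sup>2)"
  proof (rule AE_I2)
    fix t
    show "norm (f t) \<le> norm (1 + (norm (f t))\<^sup>2)"
      using zero_le_power2[of "norm (f t) - 1"] by (simp add: power2_diff)
         (smt (verit) norm_ge_zero)
  qed
qed (use assms in \<open>simp add: L2_def\<close>)

lemma L2_measurable: "f \<in> L2 \<Longrightarrow> f \<in> borel_measurable mI"
  by (simp add: L2_def)

lemma L2_inner:
  assumes "f \<in> L2" "g \<in> L2"
  shows "integr (\<lambda>t. f t \<bullet> g t)"
proof (rule Bochner_Integration.integrable_bound)
  show "integr (\<lambda>t. (norm (f t))\<^sup>2 + (norm (g t))\<^sup>2)"
    using assms by (auto simp: L2_def)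
  show "(\<lambda>t. f t \<bullet> g t) \<in> borel_measurable mI"
    using assms by (intro borel_measurable_inner) (auto simp: L2_def)
  show "AE t in mI. norm (f t \<bullet> g t) \<le> norm ((norm (f t))\<^sup>2 + (norm (g t))\<^sup>2)"
  proof (rule AE_I2)
    fix t
    have "0 \<le> (norm (f t) - norm (g t))\<^sup>2 + (norm (f t))\<^sup>2 + (norm (g t))\<^sup>2" by simp
    then have "norm (f t) * norm (g t) \<le> (norm (f t))\<^sup>2 + (norm (g t))\<^sup>2" by (simp add: power2_diff)
    then show "norm (f t \<bullet> g t) \<le> norm ((norm (f t))\<^sup>2 + (norm (g t))\<^sup>2)"
      using Cauchy_Schwarz_ineq2[of "f t" "g t"] by simp
  qed
qed

lemma L2_add:
  assumes "f \<in> L2" "g \<in> L2"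
  shows "(\<lambda>t. f t + g t) \<in> L2"
proof -
  have "integr (\<lambda>t. (norm (f t))\<^sup>2 + 2 * (f t \<bullet> g t) + (norm (g t))\<^sup>2)"
    using assms L2_inner[OF assms] by (auto simp: L2_def)
  moreover have "(norm (f t))\<^sup>2 + 2 * (f t \<bullet> g t) + (norm (g t))\<^sup>2 = (norm (f t + g t))\<^sup>2" for t
    by (simp add: power2_norm_eq_inner inner_add inner_commute)
  ultimately show ?thesis using assms by (simp add: L2_def borel_measurable_add)
qed

lemma L2_bounded_linear:
  fixes f :: "'a::euclidean_space \<Rightarrow> 'b::euclidean_space"
  assumes f: "bounded_linear f" and g: "g \<in> L2"
  shows "(\<lambda>t. f (g t)) \<in> L2"
proof -
  obtain K where K: "\<And>x. norm (f x) \<le> norm x * K"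
    using bounded_linear.bounded[OF f] by blast
  have meas: "(\<lambda>t. f (g t)) \<in> borel_measurable mI"
    by (rule measurable_compose[OF L2_measurable[OF g] borel_measurable_continuous_onI[OF linear_continuous_on[OF f]]])
  have "integr (\<lambda>t. (norm (f (g t)))\<^sup>2)"
  proof (rule Bochner_Integration.integrable_bound)
    show "integr (\<lambda>t. (norm (g t))\<^sup>2 * K\<^sup>2)" using g by (simp add: L2_def)
    show "AE t in mI. norm ((norm (f (g t)))\<^sup>2) \<le> norm ((norm (g t))\<^sup>2 * K\<^sup>2)"
      using power_mono[OF K norm_ge_zero, of _ 2] by (intro AE_I2) (simp add: power_mult_distrib)
  qed (use meas in simp)
  then show ?thesis using meas by (simp add: L2_def)
qed

lemma L2_scaleR: "f \<in> L2 \<Longrightarrow> (\<lambda>t. c *\<^sub>R f t) \<in> L2"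
  by (rule L2_bounded_linear[OF bounded_linear_scaleR_right])

lemma L2_diff: "f \<in> L2 \<Longrightarrow> g \<in> L2 \<Longrightarrow> (\<lambda>t. f t - g t) \<in> L2"
  using L2_add[of f "\<lambda>t. (- 1) *\<^sub>R g t"] L2_scaleR[of g "- 1"] by simp

lemma continuous_L2:
  fixes f :: "real \<Rightarrow> 'a::euclidean_space"
  assumes "continuous_on {-1..1} f"
  shows "f \<in> L2"
  unfolding L2_def
  using assms by (auto intro!: continuous_measurable_Iv continuous_integr continuous_intros)

lemma derivs_L2: "derivs F \<Longrightarrow> F k \<in> L2"
  for F :: "nat \<Rightarrow> real \<Rightarrow> 'a::euclidean_space"
  by (intro continuous_L2 derivs_continuous_on)

lemma L2_norm_power2: "(L2_norm f)\<^sup>2 = LI (\<lambda>t. (norm (f t))\<^sup>2)"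
  by (simp add: L2_norm_def)

lemma L2_norm_nonneg [simp]: "0 \<le> L2_norm f"
  by (simp add: L2_norm_def)

lemma L2_norm_cong_AE:
  assumes "f \<in> L2" "g \<in> L2" "AE t in mI. f t = g t"
  shows "L2_norm f = L2_norm g"
proof -
  have "LI (\<lambda>t. (norm (f t))\<^sup>2) = LI (\<lambda>t. (norm (g t))\<^sup>2)"
    using assms by (intro integral_cong_AE) (auto simp: L2_def)
  then show ?thesis by (simp add: L2_norm_def)
qed

text \<open>Exchanges test functions with \<open>nderiv\<close> for families satisfying
  \<open>tests\<close>; the weak identities below are all used in the second form.\<close>

lemma Ball_test_functions_iff:
  "(\<forall>\<phi>\<in>test_functions. Q (\<lambda>i. nderiv UNIV i \<phi>)) \<longleftrightarrow> (\<forall>F. tests F \<longrightarrow> Q F)"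
proof (intro iffI allI impI ballI)
  fix F :: "nat \<Rightarrow> real \<Rightarrow> 'a"
  assume *: "\<forall>\<phi>\<in>test_functions. Q (\<lambda>i. nderiv UNIV i \<phi>)" and F: "tests F"
  then have "F 0 \<in> test_functions" unfolding test_functions_iff by blast
  with * have "Q (\<lambda>i. nderiv UNIV i (F 0))" ..
  then show "Q F" using derivs_nderiv[OF tests_derivs[OF F]] by simp
next
  fix \<phi> :: "real \<Rightarrow> 'a"
  assume *: "\<forall>F. tests F \<longrightarrow> Q F" and "\<phi> \<in> test_functions"
  then obtain F where F: "tests F" "F 0 = \<phi>" unfolding test_functions_iff by blast
  then show "Q (\<lambda>i. nderiv UNIV i \<phi>)" using * derivs_nderiv[OF tests_derivs[OF F(1)]] by simp
qed

section \<open>Weak derivatives and Sobolev functions\<close>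

lemma has_weak_deriv_iff:
  "has_weak_deriv k f g \<longleftrightarrow> (\<forall>F :: nat \<Rightarrow> real \<Rightarrow> real. tests F \<longrightarrow>
     LI (\<lambda>t. F k t *\<^sub>R f t) = (- 1) ^ k *\<^sub>R LI (\<lambda>t. F 0 t *\<^sub>R g t))"
proof -
  have "has_weak_deriv k f g \<longleftrightarrow> (\<forall>\<phi>\<in>test_functions :: (real \<Rightarrow> real) set.
     LI (\<lambda>t. nderiv UNIV k \<phi> t *\<^sub>R f t) = (- 1) ^ k *\<^sub>R LI (\<lambda>t. nderiv UNIV 0 \<phi> t *\<^sub>R g t))"
    by (simp add: has_weak_deriv_def Ball_def)
  also have "\<dots> \<longleftrightarrow> (\<forall>F :: nat \<Rightarrow> real \<Rightarrow> real. tests F \<longrightarrow>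
     LI (\<lambda>t. F k t *\<^sub>R f t) = (- 1) ^ k *\<^sub>R LI (\<lambda>t. F 0 t *\<^sub>R g t))"
    by (rule Ball_test_functions_iff)
  finally show ?thesis .
qed

lemma tests_integr_scaleR:
  fixes F :: "nat \<Rightarrow> real \<Rightarrow> real"
  assumes "tests F" "f \<in> L2"
  shows "integr (\<lambda>t. F k t *\<^sub>R f t)"
  using assms by (intro integr_scaleR derivs_continuous_on tests_derivs L2_integr)

lemma has_weak_deriv_unique:
  assumes "has_weak_deriv k f g" "has_weak_deriv k f g'" "g \<in> L2" "g' \<in> L2"
  shows "AE t in mI. g t = g' t"
proof -
  have "AE t in mI. g t - g' t = 0"
  proof (rule fundamental_lemma)
    show "integr (\<lambda>t. g t - g' t)" using assms by (intro L2_integr L2_diff)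
    fix F :: "nat \<Rightarrow> real \<Rightarrow> real" assume F: "tests F"
    have "(- 1 :: real) ^ k *\<^sub>R LI (\<lambda>t. F 0 t *\<^sub>R g t) = (- 1 :: real) ^ k *\<^sub>R LI (\<lambda>t. F 0 t *\<^sub>R g' t)"
      using assms(1,2) F unfolding has_weak_deriv_iff by metis
    then have "LI (\<lambda>t. F 0 t *\<^sub>R g t) = LI (\<lambda>t. F 0 t *\<^sub>R g' t)" by simp
    then show "LI (\<lambda>t. F 0 t *\<^sub>R (g t - g' t)) = 0"
      using tests_integr_scaleR[OF F assms(3)] tests_integr_scaleR[OF F assms(4)]
      by (simp add: scaleR_diff_right Bochner_Integration.integral_diff)
  qed
  then show ?thesis by eventually_elim simp
qed

lemma weak_deriv:
  assumes "has_weak_deriv k f g" "g \<in> L2"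
  shows "weak_deriv k f \<in> L2" "has_weak_deriv k f (weak_deriv k f)"
    "AE t in mI. weak_deriv k f t = g t"
proof -
  have *: "weak_deriv k f \<in> L2 \<and> has_weak_deriv k f (weak_deriv k f)"
    unfolding weak_deriv_def by (rule someI[of _ g]) (use assms in blast)
  then show "weak_deriv k f \<in> L2" "has_weak_deriv k f (weak_deriv k f)" by auto
  then show "AE t in mI. weak_deriv k f t = g t"
    using has_weak_deriv_unique assms by blast
qed

lemma sobolev_weak_deriv:
  assumes "f \<in> sobolev l" "i \<le> l"
  shows "weak_deriv i f \<in> L2" "has_weak_deriv i f (weak_deriv i f)"
  using assms weak_deriv(1,2) unfolding sobolev_def by blast+

lemma has_weak_deriv_derivs:
  fixes W :: "nat \<Rightarrow> real \<Rightarrow> 'a::euclidean_space"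
  assumes "derivs W"
  shows "has_weak_deriv k (W 0) (W k)"
  unfolding has_weak_deriv_iff
  using LI_by_parts_iter[OF bounded_bilinear_scaleR _ assms, of _ 0 k 0] by simp

lemma has_weak_deriv_add:
  assumes "has_weak_deriv k f g" "has_weak_deriv k f' g'" "f \<in> L2" "f' \<in> L2" "g \<in> L2" "g' \<in> L2"
  shows "has_weak_deriv k (\<lambda>t. f t + f' t) (\<lambda>t. g t + g' t)"
  using assms unfolding has_weak_deriv_iff
  by (simp add: scaleR_add_right tests_integr_scaleR)

lemma has_weak_deriv_bounded_linear:
  fixes h :: "'a::euclidean_space \<Rightarrow> 'b::euclidean_space"
  assumes h: "bounded_linear h" and fg: "has_weak_deriv k f g" "f \<in> L2" "g \<in> L2"
  shows "has_weak_deriv k (\<lambda>t. h (f t)) (\<lambda>t. h (g t))"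
  unfolding has_weak_deriv_iff
proof (intro allI impI)
  fix F :: "nat \<Rightarrow> real \<Rightarrow> real" assume F: "tests F"
  have *: "LI (\<lambda>t. F i t *\<^sub>R h (u t)) = h (LI (\<lambda>t. F i t *\<^sub>R u t))" if "u \<in> L2" for i u
    using integral_bounded_linear[OF h tests_integr_scaleR[OF F that]] by (simp add: linear_simps[OF h])
  show "LI (\<lambda>t. F k t *\<^sub>R h (f t)) = (- 1) ^ k *\<^sub>R LI (\<lambda>t. F 0 t *\<^sub>R h (g t))"
    using fg F unfolding has_weak_deriv_iff by (simp add: * linear_simps[OF h])
qed

lemma has_weak_deriv_scaleR:
  assumes "has_weak_deriv k f g" "f \<in> L2" "g \<in> L2"
  shows "has_weak_deriv k (\<lambda>t. c *\<^sub>R f t) (\<lambda>t. c *\<^sub>R g t)"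
  by (rule has_weak_deriv_bounded_linear[OF bounded_linear_scaleR_right assms])

lemma has_weak_deriv_cong_AE:
  assumes "AE t in mI. f t = f' t" "f \<in> L2" "f' \<in> L2"
  shows "has_weak_deriv k f g \<longleftrightarrow> has_weak_deriv k f' g"
proof -
  have "LI (\<lambda>t. F k t *\<^sub>R f t) = LI (\<lambda>t. F k t *\<^sub>R f' t)" if "tests F" for F :: "nat \<Rightarrow> real \<Rightarrow> real"
    using assms(1)
    by (intro integral_cong_AE borel_measurable_integrable tests_integr_scaleR that assms) (auto elim: AE_mp)
  then show ?thesis unfolding has_weak_deriv_iff by auto
qed

lemma weak_deriv_cong_AE:
  assumes "AE t in mI. f t = f' t" "f \<in> L2" "f' \<in> L2"
  shows "weak_deriv k f = weak_deriv k f'"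
  unfolding weak_deriv_def has_weak_deriv_cong_AE[OF assms] ..

lemma sobolev_cong_AE:
  assumes "AE t in mI. f t = f' t" "f \<in> L2" "f' \<in> L2"
  shows "f \<in> sobolev k \<longleftrightarrow> f' \<in> sobolev k"
  using assms(2,3) by (simp add: sobolev_def has_weak_deriv_cong_AE[OF assms])

lemma Lambda_left_cong_AE:
  assumes "AE t in mI. f t = f' t" "f \<in> L2" "f' \<in> L2"
  shows "Lambda_left k f = Lambda_left k f'"
  unfolding Lambda_left_def weak_deriv_cong_AE[OF assms] ..

lemma derivs_sobolev: "derivs W \<Longrightarrow> W 0 \<in> sobolev l"
  for W :: "nat \<Rightarrow> real \<Rightarrow> 'a::euclidean_space"
  unfolding sobolev_def using has_weak_deriv_derivs derivs_L2 by blast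

lemma sobolev_L2: "f \<in> sobolev l \<Longrightarrow> f \<in> L2"
  by (simp add: sobolev_def)

lemma sobolev_add:
  assumes "f \<in> sobolev l" "g \<in> sobolev l"
  shows "(\<lambda>t. f t + g t) \<in> sobolev l"
  unfolding sobolev_def
proof (intro CollectI conjI allI impI)
  show "(\<lambda>t. f t + g t) \<in> L2" using assms by (intro L2_add sobolev_L2)
  fix i assume "i \<le> l"
  then show "\<exists>h\<in>L2. has_weak_deriv i (\<lambda>t. f t + g t) h"
    using assms by (intro bexI[of _ "\<lambda>t. weak_deriv i f t + weak_deriv i g t"] has_weak_deriv_add L2_add)
      (auto intro: sobolev_L2 sobolev_weak_deriv)
qed

text \<open>Makes the trace well defined: it is applied to the difference of two continuous
  representatives.\<close>

lemma continuous_AE_0_at_left: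
  fixes h :: "real \<Rightarrow> 'a::euclidean_space"
  assumes "continuous_on {-1..1} h" "AE t in mI. h t = 0"
  shows "h (- 1) = 0"
proof -
  have cont: "continuous_on {-1..1} (\<lambda>t. norm (h t))" using assms by (intro continuous_intros)
  have "LI (\<lambda>t. norm (h t)) = 0"
    using assms(2) by (intro integral_eq_zero_AE) (auto elim: AE_mp)
  then have "integral {-1..1} (\<lambda>t. norm (h t)) = 0" using LI_eq_integral[OF cont] by simp
  then have "((\<lambda>t. norm (h t)) has_integral 0) {-1..1}"
    using integrable_continuous_real[OF cont] by (metis integrable_integral)
  then have "norm (h (- 1)) = 0"
    using has_integral_0_cbox_imp_0[of "-1::real" 1 "\<lambda>t. norm (h t)" "-1"] cont by simp
  then show ?thesis by simp
qed

lemma trace_left_continuous: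
  fixes f :: "real \<Rightarrow> 'a::euclidean_space"
  assumes "continuous_on {-1..1} g" "AE t in mI. g t = f t"
  shows "trace_left f = g (- 1)"
  unfolding trace_left_def
proof (rule the_equality)
  fix c assume "\<exists>g. continuous_on {-1..1} g \<and> (AE t in mI. g t = f t) \<and> g (- 1) = c"
  then obtain g' where g': "continuous_on {-1..1} g'" "AE t in mI. g' t = f t" "g' (- 1) = c" by blast
  have "AE t in mI. g' t - g t = 0" using g'(2) assms(2) by eventually_elim simp
  then show "c = g (- 1)"
    using continuous_AE_0_at_left[of "\<lambda>t. g' t - g t"] g' assms(1) by (simp add: continuous_on_diff)
qed (use assms in blast)

text \<open>Existence of a continuous representative of \<open>f\<close> is bypassed: adding and
  subtracting \<open>h\<close> matches the representatives of \<open>f\<close> with those of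
  \<open>f'\<close> without changing the value at -1, so both traces are definite descriptions of
  the same predicate.\<close>

lemma trace_left_add:
  fixes f :: "real \<Rightarrow> 'a::euclidean_space"
  assumes h: "continuous_on {-1..1} h" "h (- 1) = 0" and ae: "AE t in mI. f' t = f t + h t"
  shows "trace_left f' = trace_left f"
proof -
  have "(\<exists>g. continuous_on {-1..1} g \<and> (AE t in mI. g t = f t) \<and> g (- 1) = c) \<longleftrightarrow>
    (\<exists>g. continuous_on {-1..1} g \<and> (AE t in mI. g t = f' t) \<and> g (- 1) = c)" for c
  proof
    assume "\<exists>g. continuous_on {-1..1} g \<and> (AE t in mI. g t = f t) \<and> g (- 1) = c"
    then obtain g where g: "continuous_on {-1..1} g" "AE t in mI. g t = f t" "g (- 1) = c" by blast
    have "AE t in mI. g t + h t = f' t" using g(2) ae by eventually_elim simp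
    then show "\<exists>g. continuous_on {-1..1} g \<and> (AE t in mI. g t = f' t) \<and> g (- 1) = c"
      using g h by (intro exI[of _ "\<lambda>t. g t + h t"]) (simp add: continuous_on_add)
  next
    assume "\<exists>g. continuous_on {-1..1} g \<and> (AE t in mI. g t = f' t) \<and> g (- 1) = c"
    then obtain g where g: "continuous_on {-1..1} g" "AE t in mI. g t = f' t" "g (- 1) = c" by blast
    have "AE t in mI. g t - h t = f t" using g(2) ae by eventually_elim simp
    then show "\<exists>g. continuous_on {-1..1} g \<and> (AE t in mI. g t = f t) \<and> g (- 1) = c"
      using g h by (intro exI[of _ "\<lambda>t. g t - h t"]) (simp add: continuous_on_diff)
  qed
  then show ?thesis by (simp add: trace_left_def)
qed

lemma Lambda_left_derivs:
  fixes W :: "nat \<Rightarrow> real \<Rightarrow> 'a::euclidean_space"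
  assumes "derivs W"
  shows "Lambda_left l (W 0) = map (\<lambda>i. W i (- 1)) [0..<l]"
proof -
  have "trace_left (weak_deriv i (W 0)) = W i (- 1)" for i
  proof (rule trace_left_continuous)
    show "AE t in mI. W i t = weak_deriv i (W 0) t"
      using weak_deriv(3)[OF has_weak_deriv_derivs[OF assms] derivs_L2[OF assms], of i]
      by eventually_elim simp
  qed (rule derivs_continuous_on[OF assms])
  then show ?thesis by (simp add: Lambda_left_def)
qed

lemma Lambda_left_add:
  fixes W :: "nat \<Rightarrow> real \<Rightarrow> 'a::euclidean_space"
  assumes w: "w \<in> sobolev l" and W: "derivs W" and z: "\<And>i. i < l \<Longrightarrow> W i (- 1) = 0"
  shows "Lambda_left l (\<lambda>t. w t + W 0 t) = Lambda_left l w"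
  unfolding Lambda_left_def
proof (rule map_cong[OF refl])
  fix i assume "i \<in> set [0..<l]"
  then have i: "i < l" by simp
  note wd = sobolev_weak_deriv[OF w less_imp_le[OF i]]
  show "trace_left (weak_deriv i (\<lambda>t. w t + W 0 t)) = trace_left (weak_deriv i w)"
  proof (rule trace_left_add)
    show "AE t in mI. weak_deriv i (\<lambda>t. w t + W 0 t) t = weak_deriv i w t + W i t"
      by (intro weak_deriv(3) has_weak_deriv_add wd has_weak_deriv_derivs W derivs_L2 L2_add sobolev_L2[OF w])
  qed (use z i derivs_continuous_on[OF W] in auto)
qed

section \<open>Behaviors\<close>

lemma behavior_iff:
  fixes R :: "(real^'q^'g) poly"
  shows "w \<in> behavior R \<longleftrightarrow> w \<in> L2 \<and> (\<forall>F :: nat \<Rightarrow> real \<Rightarrow> real^'g. tests F \<longrightarrow>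
     (\<Sum>i\<le>degree R. (- 1) ^ i * LI (\<lambda>t. w t \<bullet> (transpose (coeff R i) *v F i t))) = 0)"
proof -
  show ?thesis unfolding behavior_def using Ball_test_functions_iff[of "\<lambda>F. (\<Sum>i\<le>degree R. (- 1) ^ i *
        LI (\<lambda>t. w t \<bullet> (transpose (coeff R i) *v F i t))) = 0"] by simp
qed

lemma integr_inner_tests:
  fixes F :: "nat \<Rightarrow> real \<Rightarrow> real^'g" and w :: "real \<Rightarrow> real^'q"
  assumes "tests F" "w \<in> L2"
  shows "integr (\<lambda>t. w t \<bullet> (M *v F i t))"
proof -
  have "continuous_on {-1..1} (\<lambda>t. M *v F i t)"
    by (intro bounded_linear.continuous_on[OF matrix_vector_mul_bounded_linear] derivs_continuous_on tests_derivs assms)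
  then show ?thesis
    using integr_bilinear[OF bounded_bilinear_inner _ L2_integr[OF assms(2)], of "\<lambda>t. M *v F i t"]
    by (simp add: inner_commute)
qed

lemma behavior_add_scaleR:
  assumes "w \<in> behavior R" "v \<in> behavior R"
  shows "(\<lambda>t. w t + c *\<^sub>R v t) \<in> behavior R"
proof -
  have wL: "w \<in> L2" and vL: "v \<in> L2" using assms by (auto simp: behavior_iff)
  have "(\<Sum>i\<le>degree R. (- 1) ^ i * LI (\<lambda>t. (w t + c *\<^sub>R v t) \<bullet> (transpose (coeff R i) *v F i t))) = 0"
    if F: "tests F" for F
  proof -
    have "(\<Sum>i\<le>degree R. (- 1) ^ i * LI (\<lambda>t. (w t + c *\<^sub>R v t) \<bullet> (transpose (coeff R i) *v F i t))) =
      (\<Sum>i\<le>degree R. (- 1) ^ i * LI (\<lambda>t. w t \<bullet> (transpose (coeff R i) *v F i t))) +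
      c * (\<Sum>i\<le>degree R. (- 1) ^ i * LI (\<lambda>t. v t \<bullet> (transpose (coeff R i) *v F i t)))"
      by (simp add: inner_add_left integr_inner_tests[OF F wL] integr_inner_tests[OF F vL]
          sum.distrib[symmetric] sum_distrib_left algebra_simps)
    also have "\<dots> = 0" using assms F by (simp add: behavior_iff)
    finally show ?thesis .
  qed
  then show ?thesis using assms by (simp add: behavior_iff L2_add L2_scaleR)
qed

lemma behavior_zero: "(\<lambda>t. 0) \<in> behavior R"
  by (simp add: behavior_iff continuous_L2)

lemma behavior_sum:
  assumes "finite J" "\<And>j. j \<in> J \<Longrightarrow> w j \<in> behavior R"
  shows "(\<lambda>t. \<Sum>j\<in>J. w j t) \<in> behavior R"
  using assms
proof (induction J rule: finite_induct)
  case (insert j J)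
  then show ?case
    using behavior_add_scaleR[of "w j" R "\<lambda>t. \<Sum>j\<in>J. w j t" 1] by simp
qed (simp add: behavior_zero)

lemma behavior_cong_AE:
  fixes R :: "(real^'q^'g) poly"
  assumes "AE t in mI. w t = v t" "w \<in> behavior R" "v \<in> L2"
  shows "v \<in> behavior R"
proof -
  have "LI (\<lambda>t. w t \<bullet> (M *v F i t)) = LI (\<lambda>t. v t \<bullet> (M *v F i t))" if "tests F" for F :: "nat \<Rightarrow> real \<Rightarrow> real^'g" and M i
    using assms(1)
    by (intro integral_cong_AE borel_measurable_integrable integr_inner_tests that assms)
       (use assms(2) in \<open>auto simp: behavior_iff elim: AE_mp\<close>)
  then show ?thesis using assms(2,3) by (simp add: behavior_iff)
qed

lemma derivs_behavior:
  fixes R :: "(real^'q^'g) poly"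
  assumes W: "derivs W" and sol: "\<And>t. (\<Sum>i\<le>degree R. coeff R i *v W i t) = 0"
  shows "W 0 \<in> behavior R"
  unfolding behavior_iff
proof (intro conjI allI impI derivs_L2[OF W])
  fix F :: "nat \<Rightarrow> real \<Rightarrow> real^'g" assume F: "tests F"
  have cont: "continuous_on {-1..1} (\<lambda>t. F 0 t \<bullet> (coeff R i *v W i t))" for i
    by (intro continuous_intros bounded_linear.continuous_on[OF matrix_vector_mul_bounded_linear] derivs_continuous_on tests_derivs F W)
  have "LI (\<lambda>t. W 0 t \<bullet> (transpose (coeff R i) *v F i t)) = (- 1) ^ i * LI (\<lambda>t. F 0 t \<bullet> (coeff R i *v W i t))" for i
    using LI_by_parts_iter[OF bounded_bilinear_inner F derivs_bounded_linear[OF matrix_vector_mul_bounded_linear W], of 0 i "coeff R i" 0]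
    by (simp add: dot_lmul_matrix[symmetric] inner_commute)
  then have "(\<Sum>i\<le>degree R. (- 1) ^ i * LI (\<lambda>t. W 0 t \<bullet> (transpose (coeff R i) *v F i t)))
    = (\<Sum>i\<le>degree R. LI (\<lambda>t. F 0 t \<bullet> (coeff R i *v W i t)))"
    by (simp flip: mult.assoc power_mult_distrib)
  also have "\<dots> = LI (\<lambda>t. \<Sum>i\<le>degree R. F 0 t \<bullet> (coeff R i *v W i t))"
    by (subst Bochner_Integration.integral_sum) (auto intro!: continuous_integr cont)
  also have "\<dots> = 0" by (simp add: sol flip: inner_sum_right)
  finally show "(\<Sum>i\<le>degree R. (- 1) ^ i * LI (\<lambda>t. W 0 t \<bullet> (transpose (coeff R i) *v F i t))) = 0" .
qed

text \<open>\<open>R\<close> is a polynomial with matrix coefficients; elimination needs it as a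
  matrix of scalar polynomials, whose entries these are.\<close>

definition row_poly :: "(real^'q^'g) poly \<Rightarrow> 'g \<Rightarrow> 'q \<Rightarrow> real poly" where
  "row_poly R g c = (\<Sum>i\<le>degree R. monom (coeff R i $ g $ c) i)"

lemma coeff_row_poly: "coeff (row_poly R g c) i = coeff R i $ g $ c"
  by (simp add: row_poly_def coeff_sum coeff_monom coeff_eq_0)

lemma degree_row_poly: "degree (row_poly R g c) \<le> degree R"
  by (rule degree_le) (simp add: coeff_row_poly coeff_eq_0)

text \<open>The weak equation tested with a scalar test function in direction \<open>g\<close>;
  since all derivatives fall on the test function, the adjoint entries appear.\<close>

lemma behavior_row:
  fixes R :: "(real^'q^'g) poly" and F :: "nat \<Rightarrow> real \<Rightarrow> real"
  assumes w: "w \<in> behavior R" and F: "tests F"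
  shows "LI (\<lambda>t. \<Sum>c\<in>UNIV. act (adj_poly (row_poly R g c)) (\<lambda>i. F i t) 0 * w t $ c) = 0"
proof -
  have aF: "tests (\<lambda>i t. F i t *\<^sub>R (axis g 1 :: real^'g))"
    by (rule tests_bounded_linear[OF bounded_linear_scaleR_left F])
  have eq: "w t \<bullet> (transpose (coeff R i) *v (F i t *\<^sub>R axis g 1)) = (\<Sum>c\<in>UNIV. F i t * coeff R i $ g $ c * w t $ c)" for i t
    by (simp add: inner_vec_def matrix_vector_mult_def transpose_def axis_def if_distrib mult_ac cong: if_cong)
  have "LI (\<lambda>t. \<Sum>c\<in>UNIV. act (adj_poly (row_poly R g c)) (\<lambda>i. F i t) 0 * w t $ c)
    = LI (\<lambda>t. \<Sum>i\<le>degree R. (- 1) ^ i * (w t \<bullet> (transpose (coeff R i) *v (F i t *\<^sub>R axis g 1))))"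
  proof (rule Bochner_Integration.integral_cong[OF refl])
    fix t
    have "(\<Sum>c\<in>UNIV. act (adj_poly (row_poly R g c)) (\<lambda>i. F i t) 0 * w t $ c)
      = (\<Sum>c\<in>UNIV. \<Sum>i\<le>degree R. (- 1) ^ i * (F i t * coeff R i $ g $ c * w t $ c))"
      by (simp add: act_eq_sum[where n = "degree R"] degree_row_poly coeff_adj_poly coeff_row_poly sum_distrib_left sum_distrib_right mult_ac)
    then show "(\<Sum>c\<in>UNIV. act (adj_poly (row_poly R g c)) (\<lambda>i. F i t) 0 * w t $ c) =
        (\<Sum>i\<le>degree R. (- 1) ^ i * (w t \<bullet> (transpose (coeff R i) *v (F i t *\<^sub>R axis g 1))))"
      unfolding eq sum_distrib_left by (subst sum.swap)
  qed
  also have "\<dots> = (\<Sum>i\<le>degree R. (- 1) ^ i * LI (\<lambda>t. w t \<bullet> (transpose (coeff R i) *v (F i t *\<^sub>R axis g 1))))"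
    using integr_inner_tests[OF aF] w by (subst Bochner_Integration.integral_sum) (auto simp: behavior_iff)
  also have "\<dots> = 0" using w aF unfolding behavior_iff by blast
  finally show ?thesis .
qed

section \<open>Polynomial matrices\<close>

lemma common_denominator:
  fixes f :: "'i \<Rightarrow> 'a::idom fract"
  assumes "finite I"
  shows "\<exists>d n. d \<noteq> 0 \<and> (\<forall>i\<in>I. to_fract d * f i = to_fract (n i))"
  using assms
proof (induction I rule: finite_induct)
  case empty
  show ?case by (intro exI[of _ 1]) simp
next
  case (insert i I)
  then obtain d n where dn: "d \<noteq> 0" "\<And>j. j \<in> I \<Longrightarrow> to_fract d * f j = to_fract (n j)" by blast
  obtain a b where ab: "f i = Fract a b" "b \<noteq> 0" by (cases "f i") auto
  have b: "to_fract b * f i = to_fract a"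
    using ab by (simp add: to_fract_def eq_fract)
  have "to_fract (b * d) * f j = to_fract ((n(i := a)) j * (if j = i then d else b))" if "j \<in> insert i I" for j
  proof (cases "j = i")
    case True
    then show ?thesis using b by (simp add: mult_ac)
  next
    case False
    then show ?thesis using dn(2)[of j] that by (simp add: mult_ac)
  qed
  then show ?case using ab dn(1)
    by (intro exI[of _ "b * d"] exI[of _ "\<lambda>j. (n(i := a)) j * (if j = i then d else b)"]) auto
qed

text \<open>Over the fraction field a kernel vector can be cleared of denominators, so the kernel
  stays trivial there and a left inverse exists. \<Delta> is a common denominator of its
  entries.\<close>

lemma poly_matrix_left_inverse:
  fixes K :: "'r::finite \<Rightarrow> 'c::finite \<Rightarrow> 'a::idom"
  assumes ker: "\<And>\<eta>. (\<And>r. (\<Sum>c\<in>UNIV. K r c * \<eta> c) = 0) \<Longrightarrow> (\<And>c. \<eta> c = 0)"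
  obtains \<Delta> S where "\<Delta> \<noteq> 0" "\<And>c c'. (\<Sum>r\<in>UNIV. S c r * K r c') = (if c = c' then \<Delta> else 0)"
proof -
  define M :: "'a fract^'c^'r" where "M = (\<chi> r c. to_fract (K r c))"
  have "x = 0" if x: "M *v x = 0" for x
  proof -
    obtain d n where dn: "d \<noteq> 0" "\<And>c. to_fract d * x $ c = to_fract (n c)"
      using common_denominator[of "UNIV :: 'c set" "\<lambda>c. x $ c"] by auto
    have "to_fract (\<Sum>c\<in>UNIV. K r c * n c) = to_fract d * (M *v x) $ r" for r
    proof -
      have "to_fract (\<Sum>c\<in>UNIV. K r c * n c) = (\<Sum>c\<in>UNIV. to_fract (K r c) * to_fract (n c))"
        by simp
      also have "\<dots> = (\<Sum>c\<in>UNIV. to_fract d * (to_fract (K r c) * x $ c))"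
        by (intro sum.cong) (simp_all only: dn(2)[symmetric] mult.left_commute)
      finally show ?thesis
        by (simp add: M_def matrix_vector_mult_def sum_distrib_left)
    qed
    then have "to_fract (\<Sum>c\<in>UNIV. K r c * n c) = 0" for r
      unfolding x by simp
    then have "(\<Sum>c\<in>UNIV. K r c * n c) = 0" for r
      by (simp only: to_fract_eq_0_iff)
    then have "n c = 0" for c
      by (rule ker)
    then have "to_fract d * x $ c = 0" for c using dn(2) by simp
    then show "x = 0" using dn(1) by (simp add: vec_eq_iff)
  qed
  then have "\<forall>x. M *v x = 0 \<longrightarrow> x = 0" by blast
  then obtain N :: "'a fract^'r^'c" where N: "N ** M = mat 1"
    using iffD2[OF matrix_left_invertible_ker[of M]] by auto
  obtain d n where dn: "d \<noteq> 0" "\<And>c r. to_fract d * N $ c $ r = to_fract (n (c, r))"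
    using common_denominator[of "UNIV :: ('c \<times> 'r) set" "\<lambda>(c, r). N $ c $ r"] by auto
  have "(\<Sum>r\<in>UNIV. n (c, r) * K r c') = (if c = c' then d else 0)" for c c'
  proof -
    have "to_fract (\<Sum>r\<in>UNIV. n (c, r) * K r c') = (\<Sum>r\<in>UNIV. to_fract (n (c, r)) * to_fract (K r c'))"
      by simp
    also have "\<dots> = (\<Sum>r\<in>UNIV. to_fract d * (N $ c $ r * to_fract (K r c')))"
      by (intro sum.cong) (simp_all only: dn(2)[symmetric] mult.assoc)
    also have "\<dots> = to_fract d * (N ** M) $ c $ c'"
      by (simp add: M_def matrix_matrix_mult_def sum_distrib_left)
    also have "\<dots> = to_fract (if c = c' then d else 0)"
      by (simp add: N mat_def)
    finally show ?thesis by (simp only: to_fract_eq_iff)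
  qed
  then show ?thesis using dn(1) that[of d "\<lambda>c r. n (c, r)"] by blast
qed

lemma poly_matrix_right_inverse:
  fixes K S :: "'c::finite \<Rightarrow> 'c \<Rightarrow> 'a::idom"
  assumes "\<Delta> \<noteq> 0" "\<And>c c'. (\<Sum>r\<in>UNIV. S c r * K r c') = (if c = c' then \<Delta> else 0)"
  shows "(\<Sum>r\<in>UNIV. K c r * S r c') = (if c = c' then \<Delta> else 0)"
proof -
  define M N :: "'a fract^'c^'c" where "M = (\<chi> r c. to_fract (K r c))" and "N = (\<chi> c r. to_fract (S c r) / to_fract \<Delta>)"
  have \<Delta>: "to_fract \<Delta> \<noteq> 0" using assms(1) by simp
  have "N ** M = mat 1"
  proof -
    have "to_fract \<Delta> * (N ** M) $ c $ c' = to_fract \<Delta> * (mat 1 :: 'a fract^'c^'c) $ c $ c'" for c c'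
      using \<Delta> assms(2)[of c c', THEN arg_cong, of to_fract]
      by (auto simp: to_fract_sum to_fract_mult M_def N_def matrix_matrix_mult_def sum_distrib_left mat_def split: if_splits)
    then show ?thesis using \<Delta> by (simp add: vec_eq_iff)
  qed
  then have "M ** N = mat 1" by (rule matrix_left_right_inverse1)
  have "to_fract (\<Sum>r\<in>UNIV. K c r * S r c') = to_fract \<Delta> * (M ** N) $ c $ c'"
    using \<Delta> by (simp add: to_fract_sum to_fract_mult M_def N_def matrix_matrix_mult_def sum_distrib_left)
  also have "\<dots> = to_fract (if c = c' then \<Delta> else 0)"
    by (simp add: \<open>M ** N = mat 1\<close> mat_def)
  finally show ?thesis by (simp only: to_fract_eq_iff)
qed

lemma ex_max_degree:
  fixes \<eta> :: "'c::finite \<Rightarrow> 'a::zero poly"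
  assumes "\<eta> i \<noteq> 0"
  obtains m where "\<eta> m \<noteq> 0" "\<And>j. degree (\<eta> j) \<le> degree (\<eta> m)"
proof -
  let ?D = "(\<lambda>j. degree (\<eta> j)) ` {j. \<eta> j \<noteq> 0}"
  have "Max ?D \<in> ?D" using assms by (intro Max_in) auto
  then obtain m where m: "\<eta> m \<noteq> 0" "Max ?D = degree (\<eta> m)" by blast
  have "degree (\<eta> j) \<le> degree (\<eta> m)" for j
    using Max_ge[of ?D "degree (\<eta> j)"] m(2) by (cases "\<eta> j = 0") auto
  with m(1) show ?thesis by (rule that)
qed

text \<open>At a component of maximal degree the left-hand side has larger degree than every summand
  on the right. Applies both to s I - A and to the Euler-Lagrange equations after elimination of the
  outputs.\<close>

lemma degree_dominant_kernel:
  fixes P :: "'a::idom poly" and \<eta> :: "'c::finite \<Rightarrow> 'a poly"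
  assumes eq: "\<And>i. P * \<eta> i = (\<Sum>j\<in>UNIV. Q i j * \<eta> j)" and deg: "\<And>i j. degree (Q i j) < degree P"
  shows "\<eta> i = 0"
proof (rule ccontr)
  assume "\<eta> i \<noteq> 0"
  then obtain m where m: "\<eta> m \<noteq> 0" "\<And>j. degree (\<eta> j) \<le> degree (\<eta> m)"
    by (rule ex_max_degree) blast
  have P: "P \<noteq> 0" using deg[of i i] by auto
  have "degree (\<Sum>j\<in>UNIV. Q m j * \<eta> j) \<le> degree P + degree (\<eta> m) - 1"
  proof (rule degree_sum_le)
    fix j :: 'c
    show "degree (Q m j * \<eta> j) \<le> degree P + degree (\<eta> m) - 1"
      using degree_mult_le[of "Q m j" "\<eta> j"] deg[of m j] m(2)[of j] by linarith
  qed simp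
  then have "degree (P * \<eta> m) \<le> degree P + degree (\<eta> m) - 1" by (simp add: eq)
  moreover have "degree (P * \<eta> m) = degree P + degree (\<eta> m)"
    using P m(1) by (intro degree_mult_eq) auto
  ultimately show False using deg[of i i] by linarith
qed

section \<open>The transfer polynomials of a state space system\<close>

definition char_matrix :: "real^'n^'n \<Rightarrow> 'n \<Rightarrow> 'n \<Rightarrow> real poly" where
  "char_matrix A i j = (if i = j then [:0, 1:] else 0) - [:A $ i $ j:]"

lemma char_matrix_sum:
  "(\<Sum>j\<in>UNIV. char_matrix A i j * \<eta> j) = [:0, 1:] * \<eta> i - (\<Sum>j\<in>UNIV. [:A $ i $ j:] * \<eta> j)"
proof -
  have "(\<Sum>j\<in>UNIV. char_matrix A i j * \<eta> j) = (\<Sum>j\<in>UNIV. (if i = j then [:0, 1:] * \<eta> j else 0) - [:A $ i $ j:] * \<eta> j)"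
    by (intro sum.cong) (auto simp: char_matrix_def algebra_simps)
  then show ?thesis by (simp add: sum_subtractf)
qed

text \<open>\<theta> and \<open>S\<close> act as characteristic polynomial and adjugate of s I - A.
  They are obtained by clearing denominators in the inverse, so the degree bounds below are derived
  from the matrix identity instead of from determinants.\<close>

locale iso_system =
  fixes A :: "real^'n::finite^'n" and B :: "real^'m::finite^'n"
    and C :: "real^'n^'p::finite" and D :: "real^'m^'p"
    and \<theta> :: "real poly" and S :: "'n \<Rightarrow> 'n \<Rightarrow> real poly"
  assumes \<theta>: "\<theta> \<noteq> 0"
    and S_left: "\<And>i j. (\<Sum>r\<in>UNIV. S i r * char_matrix A r j) = (if i = j then \<theta> else 0)"
begin

definition state_p :: "'n \<Rightarrow> 'm \<Rightarrow> real poly" where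
  "state_p i j = (\<Sum>r\<in>UNIV. S i r * [:B $ r $ j:])"

text \<open>Numerator of the transfer function: dividing by \<theta> gives C (s I - A)^(-1) B +
  D.\<close>

definition transfer_p :: "'p \<Rightarrow> 'm \<Rightarrow> real poly" where
  "transfer_p p j = (\<Sum>i\<in>UNIV. [:C $ p $ i:] * state_p i j) + [:D $ p $ j:] * \<theta>"

lemma S_right: "(\<Sum>r\<in>UNIV. char_matrix A i r * S r j) = (if i = j then \<theta> else 0)"
  by (rule poly_matrix_right_inverse[OF \<theta> S_left])

lemma state_p_eq: "[:0, 1:] * state_p i j = (\<Sum>r\<in>UNIV. [:A $ i $ r:] * state_p r j) + [:B $ i $ j:] * \<theta>"
proof -
  have "[:0, 1:] * state_p i j - (\<Sum>r\<in>UNIV. [:A $ i $ r:] * state_p r j) = (\<Sum>r\<in>UNIV. char_matrix A i r * state_p r j)"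
    by (rule char_matrix_sum[symmetric])
  also have "\<dots> = (\<Sum>r\<in>UNIV. \<Sum>s\<in>UNIV. char_matrix A i r * S r s * [:B $ s $ j:])"
    by (simp add: state_p_def sum_distrib_left mult.assoc)
  also have "\<dots> = (\<Sum>s\<in>UNIV. (\<Sum>r\<in>UNIV. char_matrix A i r * S r s) * [:B $ s $ j:])"
    by (subst sum.swap) (simp only: sum_distrib_right)
  also have "\<dots> = \<theta> * [:B $ i $ j:]"
    by (simp add: S_right if_distrib if_distribR cong: if_cong)
  finally show ?thesis by (simp add: algebra_simps)
qed

text \<open>Strict properness. At an entry of maximal degree in column \<open>j\<close>,
  multiplication by the indeterminate raises the degree by one; in \<open>state_p_eq\<close> the
  term with \<open>A\<close> cannot match this, so the term with \<theta> must.\<close>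

lemma degree_state_p:
  assumes "state_p i j \<noteq> 0"
  shows "degree (state_p i j) < degree \<theta>"
proof -
  obtain m where m: "state_p m j \<noteq> 0" "\<And>i. degree (state_p i j) \<le> degree (state_p m j)"
    using assms by (rule ex_max_degree[of "\<lambda>i. state_p i j"]) blast
  have "degree (\<Sum>r\<in>UNIV. [:A $ m $ r:] * state_p r j) \<le> degree (state_p m j)"
  proof (rule degree_sum_le)
    fix r
    show "degree ([:A $ m $ r:] * state_p r j) \<le> degree (state_p m j)"
      using m(2)[of r] degree_smult_le[of "A $ m $ r" "state_p r j"] by (cases "state_p r j = 0") auto
  qed simp
  moreover have "degree ([:B $ m $ j:] * \<theta>) \<le> degree \<theta>" by simp
  ultimately have "degree ([:0, 1:] * state_p m j) \<le> max (degree (state_p m j)) (degree \<theta>)"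
    unfolding state_p_eq by (intro degree_add_le) auto
  moreover have "degree ([:0, 1:] * state_p m j) = Suc (degree (state_p m j))"
    using m(1) by (subst degree_mult_eq) auto
  ultimately have "degree (state_p m j) < degree \<theta>" by simp
  then show ?thesis using m(2)[of i] by simp
qed

lemma degree_transfer_p: "degree (transfer_p p j) \<le> degree \<theta>"
  unfolding transfer_p_def
proof (intro degree_add_le degree_sum_le)
  fix i
  show "degree ([:C $ p $ i:] * state_p i j) \<le> degree \<theta>"
    using degree_state_p[of i j] degree_smult_le[of "C $ p $ i" "state_p i j"] by (cases "state_p i j = 0") auto
qed auto

text \<open>\<open>S\<close> applied to the equations (d/dt - A) X = B U, read on derivative
  sequences.\<close>

lemma act_state:
  assumes X: "\<And>i k. X i (Suc k) = (\<Sum>j\<in>UNIV. A $ i $ j * X j k) + (\<Sum>j\<in>UNIV. B $ i $ j * U j k)"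
  shows "act \<theta> (X i) k = (\<Sum>j\<in>UNIV. act (state_p i j) (U j) k)"
proof -
  have 1: "(\<Sum>j\<in>UNIV. act (char_matrix A r j) (X j) k) = (\<Sum>j\<in>UNIV. B $ r $ j * U j k)" for r k
  proof -
    have "(\<Sum>j\<in>UNIV. act (char_matrix A r j) (X j) k) = (\<Sum>j\<in>UNIV. (if r = j then X j (Suc k) else 0) - A $ r $ j * X j k)"
      by (intro sum.cong) (auto simp: char_matrix_def act_diff_left)
    then show ?thesis by (simp add: sum_subtractf X)
  qed
  have "act \<theta> (X i) k = (\<Sum>j\<in>UNIV. act (if i = j then \<theta> else 0) (X j) k)"
    by (simp add: if_distrib if_distribR cong: if_cong)
  also have "\<dots> = (\<Sum>j\<in>UNIV. \<Sum>r\<in>UNIV. act (S i r) (act (char_matrix A r j) (X j)) k)"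
    by (simp add: S_left[symmetric] act_sum_left act_mult)
  also have "\<dots> = (\<Sum>r\<in>UNIV. act (S i r) (\<lambda>k. \<Sum>j\<in>UNIV. B $ r $ j * U j k) k)"
    by (subst sum.swap) (simp add: act_sum_right[symmetric] 1)
  also have "\<dots> = (\<Sum>j\<in>UNIV. act (state_p i j) (U j) k)"
    by (simp add: act_sum_right act_cmult_right state_p_def act_sum_left act_mult)
       (subst sum.swap, simp add: act_smult)
  finally show ?thesis .
qed

lemma act_output:
  assumes X: "\<And>i k. X i (Suc k) = (\<Sum>j\<in>UNIV. A $ i $ j * X j k) + (\<Sum>j\<in>UNIV. B $ i $ j * U j k)"
    and Y: "\<And>k. Y k = (\<Sum>i\<in>UNIV. C $ p $ i * X i k) + (\<Sum>j\<in>UNIV. D $ p $ j * U j k)"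
  shows "act \<theta> Y k = (\<Sum>j\<in>UNIV. act (transfer_p p j) (U j) k)"
proof -
  have "Y = (\<lambda>k. (\<Sum>i\<in>UNIV. C $ p $ i * X i k) + (\<Sum>j\<in>UNIV. D $ p $ j * U j k))" using Y by blast
  then have "act \<theta> Y k = (\<Sum>i\<in>UNIV. C $ p $ i * act \<theta> (X i) k) + (\<Sum>j\<in>UNIV. D $ p $ j * act \<theta> (U j) k)"
    by (simp add: act_add_right act_sum_right act_cmult_right)
  also have "\<dots> = (\<Sum>i\<in>UNIV. \<Sum>j\<in>UNIV. C $ p $ i * act (state_p i j) (U j) k) + (\<Sum>j\<in>UNIV. D $ p $ j * act \<theta> (U j) k)"
    by (simp add: act_state[of X U, OF X] sum_distrib_left)
  also have "\<dots> = (\<Sum>j\<in>UNIV. act (transfer_p p j) (U j) k)"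
    by (subst sum.swap) (simp add: transfer_p_def act_add_left act_sum_left act_smult sum.distrib)
  finally show ?thesis .
qed

lemma act_state_p_step:
  "act (state_p i j) F (Suc k) = (\<Sum>r\<in>UNIV. A $ i $ r * act (state_p r j) F k) + B $ i $ j * act \<theta> F k"
proof -
  have "act ([:0, 1:] * state_p i j) F k = act (state_p i j) F (Suc k)" by (subst act_mult) simp
  then show ?thesis unfolding state_p_eq by (simp add: act_add_left act_sum_left act_smult)
qed

lemma act_transfer_p: "act (transfer_p p j) F k = (\<Sum>i\<in>UNIV. C $ p $ i * act (state_p i j) F k) + D $ p $ j * act \<theta> F k"
  by (simp add: transfer_p_def act_add_left act_sum_left act_smult)

text \<open>Column \<open>j\<close> of the image representation: the latent variable enters input
  channel \<open>j\<close> through \<theta>, leaves the other inputs zero, and produces the outputs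
  \<open>transfer_p\<close>.\<close>

definition traj_p :: "'m \<Rightarrow> 'm + 'p \<Rightarrow> real poly" where
  "traj_p j c = (case c of Inl i \<Rightarrow> if i = j then \<theta> else 0 | Inr p \<Rightarrow> transfer_p p j)"

lemma degree_traj_p: "degree (traj_p j c) \<le> degree \<theta>"
  by (auto simp: traj_p_def degree_transfer_p split: sum.split)

end

lemma iso_system_exists:
  fixes A :: "real^'n::finite^'n"
  obtains \<theta> S where "iso_system A \<theta> S"
proof (rule poly_matrix_left_inverse[of "char_matrix A"])
  fix \<eta> c assume *: "\<And>r. (\<Sum>c\<in>UNIV. char_matrix A r c * \<eta> c) = 0"
  show "\<eta> c = 0"
  proof (rule degree_dominant_kernel[of "[:0, 1:]" \<eta> "\<lambda>i j. [:A $ i $ j:]"])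
    fix i
    show "[:0, 1:] * \<eta> i = (\<Sum>j\<in>UNIV. [:A $ i $ j:] * \<eta> j)"
      using *[of i] by (simp only: char_matrix_sum right_minus_eq)
  qed simp
next
  fix \<Delta> S
  assume "\<Delta> \<noteq> 0" "\<And>c c'. (\<Sum>r\<in>UNIV. S c r * char_matrix A r c') = (if c = c' then \<Delta> else 0)"
  then have "iso_system A \<Delta> S" by unfold_locales auto
  then show thesis by (rule that)
qed

section \<open>The lag and unobservable states\<close>

lemma obs_matrix_step:
  assumes "\<And>k. z (Suc k) = A *v z k"
  shows "((\<lambda>M. M ** A) ^^ i) C *v z k = C *v z (i + k)"
proof (induction i arbitrary: k)
  case (Suc i)
  have "((\<lambda>M. M ** A) ^^ Suc i) C *v z k = ((\<lambda>M. M ** A) ^^ i) C *v (A *v z k)"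
    by (simp add: matrix_vector_mul_assoc)
  also have "\<dots> = C *v z (i + Suc k)" using Suc[of "Suc k"] assms by simp
  finally show ?case by simp
qed simp

text \<open>The minimum defining the lag is attained: otherwise the rank would grow at every step,
  although it is bounded by the state dimension.\<close>

lemma obs_rank_lag: "obs_rank A C (Suc (lag A C)) = obs_rank A C (lag A C)"
proof -
  have mono: "obs_rank A C k \<le> obs_rank A C (Suc k)" for k
    unfolding obs_rank_def by (intro dim_subset UN_mono) auto
  have "\<exists>k. obs_rank A C (Suc k) = obs_rank A C k"
  proof (rule ccontr)
    assume "\<not> ?thesis"
    then have "obs_rank A C k < obs_rank A C (Suc k)" for k using mono[of k] by (metis le_neq_implies_less)
    then have "k \<le> obs_rank A C k" for k by (induction k) (auto simp: Suc_leI le_less_trans)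
    moreover have "obs_rank A C k \<le> DIM(real^'a)" for k unfolding obs_rank_def by (rule dim_subset_UNIV)
    ultimately show False by (metis not_less_eq_eq order_trans)
  qed
  then show ?thesis unfolding lag_def by (rule LeastI_ex)
qed

text \<open>At the lag, the rows of the next observability block lie in the span of the earlier
  ones. So \<open>lag A C\<close> consecutive zero outputs of the free motion force the next one to
  vanish, and the window of zeros slides on forever.\<close>

lemma unobservable_of_lag:
  fixes A :: "real^'n::finite^'n" and C :: "real^'n^'p::finite"
  assumes z: "\<And>k. z (Suc k) = A *v z k" and low: "\<And>k. k < lag A C \<Longrightarrow> C *v z k = 0"
  shows "C *v z k = 0"
proof -
  let ?l = "lag A C" let ?O = "\<lambda>i. ((\<lambda>M. M ** A) ^^ i) C"
  let ?V = "\<lambda>k. \<Union>i<k. rows (?O i)"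
  have span: "span (?V (Suc ?l)) = span (?V ?l)"
  proof (rule sym, rule dim_eq_span)
    show "?V ?l \<subseteq> ?V (Suc ?l)" by (intro UN_mono) auto
  qed (use obs_rank_lag[of A C] in \<open>simp add: obs_rank_def\<close>)
  have orth: "?O i *v v = 0 \<longleftrightarrow> (\<forall>r\<in>rows (?O i). v \<bullet> r = 0)" for i v
    by (auto simp: rows_def row_def vec_eq_iff matrix_vector_mult_def inner_vec_def mult.commute)
  have step: "C *v z (?l + k) = 0" if van: "\<And>i. i < ?l \<Longrightarrow> C *v z (i + k) = 0" for k
  proof -
    have "z k \<bullet> r = 0" if r: "r \<in> span (?V ?l)" for r
      using r
    proof (induction rule: span_induct)
      case base
      show ?case by (simp add: subspace_def inner_add_right)
    next
      case (step r)
      then obtain i where i: "i < ?l" "r \<in> rows (?O i)" by auto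
      have "?O i *v z k = 0" using i(1) van by (simp add: obs_matrix_step[of z A, OF z])
      then show ?case using i(2) orth by blast
    qed
    moreover have "r \<in> span (?V ?l)" if "r \<in> rows (?O ?l)" for r
      using that span by (metis (no_types, lifting) UN_I lessThan_iff lessI span_base)
    ultimately have "?O ?l *v z k = 0" using orth by blast
    then show ?thesis by (simp add: obs_matrix_step[of z A, OF z])
  qed
  have "\<forall>i<?l. C *v z (i + k) = 0" for k
  proof (induction k)
    case (Suc k)
    show ?case
    proof (intro allI impI)
      fix i assume "i < ?l"
      then consider "Suc i < ?l" | "Suc i = ?l" by linarith
      then show "C *v z (i + Suc k) = 0"
      proof cases
        case 1
        then show ?thesis using Suc by (metis add_Suc_right add_Suc)
      next
        case 2
        then show ?thesis using step[of k] Suc by (metis add_Suc_right add_Suc)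
      qed
    qed
  qed (use low in simp)
  then have all: "C *v z (?l + k) = 0" for k using step by blast
  show ?thesis
  proof (cases "k < ?l")
    case False
    then show ?thesis using all[of "k - ?l"] by simp
  qed (rule low)
qed

section \<open>Regularity of solutions of weak systems\<close>

text \<open>Multiplying the test functions by \<open>S\<close> decouples the system: as
  \<open>S\<close> times \<open>K\<close> is \<Delta> times the identity, every component of
  \<open>w\<close> satisfies one and the same scalar equation.\<close>

lemma weak_system_regular:
  fixes w :: "real \<Rightarrow> real^'c::finite" and K :: "'r::finite \<Rightarrow> 'c \<Rightarrow> real poly"
  assumes w: "w \<in> L2"
    and ker: "\<And>\<eta> c. (\<And>r. (\<Sum>c\<in>UNIV. K r c * \<eta> c) = 0) \<Longrightarrow> \<eta> c = 0"
    and eq: "\<And>r F. tests F \<Longrightarrow> LI (\<lambda>t. \<Sum>c\<in>UNIV. act (K r c) (\<lambda>i. F i t) 0 * w t $ c) = 0"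
  obtains a where "exp_bdd a" "AE t in mI. w t = taylor a t"
proof (rule poly_matrix_left_inverse[of K])
  fix \<eta> c assume "\<And>r. (\<Sum>c\<in>UNIV. K r c * \<eta> c) = 0"
  then show "\<eta> c = 0" by (rule ker)
next
  fix \<Delta> S
  assume \<Delta>: "\<Delta> \<noteq> 0" and S: "\<And>c c'. (\<Sum>r\<in>UNIV. S c r * K r c') = (if c = c' then \<Delta> else 0)"
  have wc: "integr (\<lambda>t. w t $ c)" for c
    by (intro L2_integr L2_bounded_linear[OF bounded_linear_vec_nth] w)
  have int: "integr (\<lambda>t. act P (\<lambda>i. F i t) 0 * w t $ c)" if "tests F" for P F c
    using tests_act[OF that] by (intro integr_mult wc derivs_continuous_on[of "\<lambda>k t. act P (\<lambda>i. F i t) k"] tests_derivs)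
  have scalar: "LI (\<lambda>t. act \<Delta> (\<lambda>i. F i t) 0 * w t $ c) = 0" if F: "tests F" for F c
  proof -
    have "act \<Delta> (\<lambda>i. F i t) 0 * w t $ c =
      (\<Sum>r\<in>UNIV. \<Sum>c'\<in>UNIV. act (K r c') (\<lambda>k. act (S c r) (\<lambda>i. F i t) k) 0 * w t $ c')" for t
    proof -
      have "(\<Sum>r\<in>UNIV. \<Sum>c'\<in>UNIV. act (K r c') (\<lambda>k. act (S c r) (\<lambda>i. F i t) k) 0 * w t $ c')
        = (\<Sum>c'\<in>UNIV. (\<Sum>r\<in>UNIV. act (S c r * K r c') (\<lambda>i. F i t) 0) * w t $ c')"
        by (subst sum.swap) (simp add: sum_distrib_right act_mult mult.commute[of "S _ _"])
      also have "\<dots> = (\<Sum>c'\<in>UNIV. act (if c = c' then \<Delta> else 0) (\<lambda>i. F i t) 0 * w t $ c')"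
        by (simp only: act_sum_left[symmetric] S)
      also have "\<dots> = act \<Delta> (\<lambda>i. F i t) 0 * w t $ c"
        by (simp add: if_distrib if_distribR cong: if_cong)
      finally show ?thesis by simp
    qed
    then have "LI (\<lambda>t. act \<Delta> (\<lambda>i. F i t) 0 * w t $ c) =
      (\<Sum>r\<in>UNIV. LI (\<lambda>t. \<Sum>c'\<in>UNIV. act (K r c') (\<lambda>k. act (S c r) (\<lambda>i. F i t) k) 0 * w t $ c'))"
      using int[OF tests_act[OF F]] by (simp only:) (subst Bochner_Integration.integral_sum; simp)
    also have "\<dots> = 0"
      using eq[OF tests_act[OF F]] by simp
    finally show ?thesis .
  qed
  have "\<exists>b. exp_bdd b \<and> (AE t in mI. w t $ c = taylor b t)" for c
  proof -
    have "integr (\<lambda>t. w t $ c)" by (rule wc)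
    moreover have "\<And>F. tests F \<Longrightarrow> LI (\<lambda>t. act \<Delta> (\<lambda>i. F i t) 0 * w t $ c) = 0" by (rule scalar)
    ultimately show ?thesis using weak_ode_regular[of \<Delta> "\<lambda>t. w t $ c"] \<Delta> by blast
  qed
  then obtain b where b: "\<And>c. exp_bdd (b c)" "\<And>c. AE t in mI. w t $ c = taylor (b c) t"
    by metis
  define a where "a = (\<lambda>k. \<chi> c. b c k)"
  have a: "exp_bdd a" by (rule exp_bdd_vec) (simp add: a_def b)
  have comp: "taylor a t $ c = taylor (b c) t" for t c
    using taylor_bounded_linear[OF bounded_linear_vec_nth[of c] a, of t] by (simp add: a_def)
  have "AE t in mI. \<forall>c\<in>UNIV. w t $ c = taylor (b c) t"
    using b(2) by (intro AE_finite_allI) auto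
  then have "AE t in mI. w t = taylor a t"
    by eventually_elim (simp add: vec_eq_iff comp)
  with a show thesis by (rule that)
qed

section \<open>Inputs and outputs\<close>

lemma bounded_linear_Inl: "bounded_linear (\<lambda>v :: real^('m::finite + 'p::finite). (\<chi> i. v $ Inl i) :: real^'m)"
  by (rule linear_conv_bounded_linear[THEN iffD1], rule linearI) (simp_all add: vec_eq_iff)

lemma bounded_linear_Inr: "bounded_linear (\<lambda>v :: real^('m::finite + 'p::finite). (\<chi> i. v $ Inr i) :: real^'p)"
  by (rule linear_conv_bounded_linear[THEN iffD1], rule linearI) (simp_all add: vec_eq_iff)

lemma inp_eq: "inp w = (\<lambda>t. \<chi> i. w t $ Inl i)"
  by (simp add: inp_def fun_eq_iff)

lemma outp_eq: "outp w = (\<lambda>t. \<chi> i. w t $ Inr i)"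
  by (simp add: outp_def fun_eq_iff)

lemma inp_L2: "w \<in> L2 \<Longrightarrow> inp w \<in> L2"
  unfolding inp_eq by (rule L2_bounded_linear[OF bounded_linear_Inl])

lemma outp_L2: "w \<in> L2 \<Longrightarrow> outp w \<in> L2"
  unfolding outp_eq by (rule L2_bounded_linear[OF bounded_linear_Inr])

lemma derivs_inp: "derivs W \<Longrightarrow> derivs (\<lambda>k. inp (W k))"
  unfolding inp_eq by (rule derivs_bounded_linear[OF bounded_linear_Inl])

lemma derivs_outp: "derivs W \<Longrightarrow> derivs (\<lambda>k. outp (W k))"
  unfolding outp_eq by (rule derivs_bounded_linear[OF bounded_linear_Inr])

lemma inp_add: "inp (\<lambda>t. w t + c *\<^sub>R v t) = (\<lambda>t. inp w t + c *\<^sub>R inp v t)"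
  and outp_add: "outp (\<lambda>t. w t + c *\<^sub>R v t) = (\<lambda>t. outp w t + c *\<^sub>R outp v t)"
  by (simp_all add: inp_def outp_def fun_eq_iff vec_eq_iff)

lemma sobolev_inp_weak_deriv:
  assumes "w \<in> sobolev l"
  shows "weak_deriv l (inp w) \<in> L2" "has_weak_deriv l (inp w) (weak_deriv l (inp w))"
proof -
  note wd = sobolev_weak_deriv[OF assms order_refl]
  have "has_weak_deriv l (inp w) (inp (weak_deriv l w))"
    unfolding inp_eq by (rule has_weak_deriv_bounded_linear[OF bounded_linear_Inl wd(2) sobolev_L2[OF assms] wd(1)])
  from weak_deriv[OF this inp_L2[OF wd(1)]]
  show "weak_deriv l (inp w) \<in> L2" "has_weak_deriv l (inp w) (weak_deriv l (inp w))" by auto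
qed

lemma act_if: "act (if b then P else Q) a k = (if b then act P a k else act Q a k)"
  by simp

lemma sum_UNIV_Plus:
  fixes f :: "'m::finite + 'p::finite \<Rightarrow> 'a::comm_monoid_add"
  shows "(\<Sum>c\<in>UNIV. f c) = (\<Sum>i\<in>UNIV. f (Inl i)) + (\<Sum>p\<in>UNIV. f (Inr p))"
  by (subst UNIV_Plus_UNIV[symmetric], subst sum.Plus) auto

section \<open>The cost functional\<close>

lemma LI_norm_add:
  assumes "f \<in> L2" "g \<in> L2"
  shows "LI (\<lambda>t. (norm (f t + s *\<^sub>R g t))\<^sup>2) = LI (\<lambda>t. (norm (f t))\<^sup>2) + 2 * s * LI (\<lambda>t. f t \<bullet> g t) + s\<^sup>2 * LI (\<lambda>t. (norm (g t))\<^sup>2)"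
proof -
  have "(norm (f t + s *\<^sub>R g t))\<^sup>2 = (norm (f t))\<^sup>2 + 2 * s * (f t \<bullet> g t) + s\<^sup>2 * (norm (g t))\<^sup>2" for t
    unfolding power2_norm_eq_inner by (simp add: inner_add inner_commute algebra_simps power2_eq_square)
  then show ?thesis
    using assms L2_inner[OF assms] by (simp add: L2_def)
qed

lemma cost_eq:
  assumes "has_weak_deriv l (inp w) g" "g \<in> L2"
  shows "cost l w = LI (\<lambda>t. (norm (outp w t))\<^sup>2) + LI (\<lambda>t. (norm (g t))\<^sup>2)"
  unfolding cost_def L2_norm_power2[symmetric]
  using L2_norm_cong_AE[OF weak_deriv(1)[OF assms] assms(2) weak_deriv(3)[OF assms]] by simp

lemma cost_cong_AE:
  assumes "AE t in mI. w t = v t" "w \<in> L2" "v \<in> L2"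
  shows "cost l w = cost l v"
proof -
  have "AE t in mI. inp w t = inp v t" "AE t in mI. outp w t = outp v t"
    using assms(1) by (eventually_elim, simp add: inp_def outp_def)+
  then show ?thesis
    unfolding cost_def
    using weak_deriv_cong_AE[of "inp w" "inp v"] L2_norm_cong_AE[of "outp w" "outp v"] assms inp_L2 outp_L2 by metis
qed

lemma cost_derivs:
  assumes "derivs W"
  shows "cost l (W 0) = LI (\<lambda>t. (norm (outp (W 0) t))\<^sup>2) + LI (\<lambda>t. (norm (inp (W l) t))\<^sup>2)"
  by (rule cost_eq[OF has_weak_deriv_derivs[OF derivs_inp[OF assms]] derivs_L2[OF derivs_inp[OF assms]]])

lemma cost_nonneg: "0 \<le> cost l w"
  by (simp add: cost_def)

text \<open>The bilinear form of the quadratic cost, half its derivative in direction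
  \<open>W 0\<close>. The variation supplies its classical derivative \<open>W l\<close>, while
  \<open>w\<close> has only a weak one.\<close>

definition cost_deriv :: "nat \<Rightarrow> (real \<Rightarrow> real^('m::finite + 'p::finite)) \<Rightarrow> (nat \<Rightarrow> real \<Rightarrow> real^('m + 'p)) \<Rightarrow> real" where
  "cost_deriv l w W = LI (\<lambda>t. outp w t \<bullet> outp (W 0) t) + LI (\<lambda>t. weak_deriv l (inp w) t \<bullet> inp (W l) t)"

lemma cost_add:
  assumes w: "w \<in> sobolev l" and W: "derivs W"
  shows "cost l (\<lambda>t. w t + s *\<^sub>R W 0 t) = cost l w + 2 * s * cost_deriv l w W + s\<^sup>2 * cost l (W 0)"
proof -
  note V = sobolev_inp_weak_deriv[OF w]
  have wL: "w \<in> L2" using w by (rule sobolev_L2)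
  note WL = derivs_L2[OF derivs_inp[OF W]]
  have hd: "has_weak_deriv l (inp (\<lambda>t. w t + s *\<^sub>R W 0 t)) (\<lambda>t. weak_deriv l (inp w) t + s *\<^sub>R inp (W l) t)"
    unfolding inp_add
    by (intro has_weak_deriv_add has_weak_deriv_scaleR V has_weak_deriv_derivs[OF derivs_inp[OF W]] inp_L2[OF wL] L2_scaleR WL)
  have "cost l (\<lambda>t. w t + s *\<^sub>R W 0 t) = LI (\<lambda>t. (norm (outp w t + s *\<^sub>R outp (W 0) t))\<^sup>2)
    + LI (\<lambda>t. (norm (weak_deriv l (inp w) t + s *\<^sub>R inp (W l) t))\<^sup>2)"
    by (subst cost_eq[OF hd]) (auto intro!: L2_add L2_scaleR V WL simp: outp_add)
  also have "\<dots> = cost l w + 2 * s * cost_deriv l w W + s\<^sup>2 * cost l (W 0)"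
    by (simp add: LI_norm_add V(1) WL outp_L2[OF wL] derivs_L2[OF derivs_outp[OF W]]
        cost_eq[OF V(2) V(1)] cost_derivs[OF W] cost_deriv_def algebra_simps)
  finally show ?thesis .
qed

lemma quadratic_nonneg_imp_linear_0:
  fixes b c :: real
  assumes "\<And>s. 2 * s * b + s\<^sup>2 * c \<ge> 0" "c \<ge> 0"
  shows "b = 0"
proof (rule ccontr)
  assume b: "b \<noteq> 0"
  \<comment> \<open>Nearly the minimizer \<open>- b / c\<close> of the quadratic; adding 1 covers
    \<open>c = 0\<close>.\<close>
  let ?s = "- b / (c + 1)"
  have "?s * (c + 1) = - b" using assms(2) by simp
  moreover have "(2 * ?s * b + ?s\<^sup>2 * c) * (c + 1)\<^sup>2 = 2 * b * (?s * (c + 1)) * (c + 1) + (?s * (c + 1))\<^sup>2 * c"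
    unfolding power2_eq_square by (simp only: algebra_simps)
  ultimately have "(2 * ?s * b + ?s\<^sup>2 * c) * (c + 1)\<^sup>2 = - (b\<^sup>2 * (c + 2))"
    by (simp add: algebra_simps power2_eq_square)
  moreover have "0 \<le> (2 * ?s * b + ?s\<^sup>2 * c) * (c + 1)\<^sup>2"
    using assms(1)[of ?s] by (intro mult_nonneg_nonneg) auto
  moreover have "b\<^sup>2 * (c + 2) > 0" using b assms(2) by (intro mult_pos_pos) auto
  ultimately show False by linarith
qed

lemma solves_P_variation:
  assumes w: "solves_P (behavior R) l \<xi> w" and W: "derivs W" "W 0 \<in> behavior R"
    and init: "\<And>i. i < l \<Longrightarrow> W i (- 1) = 0"
  shows "cost_deriv l w W = 0" "cost l (\<lambda>t. w t + W 0 t) = cost l w + cost l (W 0)"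
proof -
  have feas: "w \<in> behavior R" "w \<in> sobolev l" "Lambda_left l w = \<xi>"
    and min: "\<And>v. v \<in> behavior R \<Longrightarrow> v \<in> sobolev l \<Longrightarrow> Lambda_left l v = \<xi> \<Longrightarrow> cost l w \<le> cost l v"
    using w unfolding solves_P_def is_arg_min_linorder by auto
  have "2 * s * cost_deriv l w W + s\<^sup>2 * cost l (W 0) \<ge> 0" for s
  proof -
    have sW: "derivs (\<lambda>k t. s *\<^sub>R W k t)" by (rule derivs_bounded_linear[OF bounded_linear_scaleR_right W(1)])
    have "cost l w \<le> cost l (\<lambda>t. w t + s *\<^sub>R W 0 t)"
    proof (rule min)
      show "(\<lambda>t. w t + s *\<^sub>R W 0 t) \<in> behavior R" by (rule behavior_add_scaleR[OF feas(1) W(2)])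
      show "(\<lambda>t. w t + s *\<^sub>R W 0 t) \<in> sobolev l" by (rule sobolev_add[OF feas(2) derivs_sobolev[OF sW]])
      show "Lambda_left l (\<lambda>t. w t + s *\<^sub>R W 0 t) = \<xi>"
        using Lambda_left_add[OF feas(2) sW] init feas(3) by simp
    qed
    then show ?thesis by (simp add: cost_add[OF feas(2) W(1)])
  qed
  then show *: "cost_deriv l w W = 0" by (rule quadratic_nonneg_imp_linear_0) (rule cost_nonneg)
  show "cost l (\<lambda>t. w t + W 0 t) = cost l w + cost l (W 0)"
    using cost_add[OF feas(2) W(1), of 1] * by simp
qed

section \<open>State space representations\<close>

locale iso_behavior = iso_system A B C D \<theta> S
  for A :: "real^'n::finite^'n" and B :: "real^'m::finite^'n"
    and C :: "real^'n^'p::finite" and D :: "real^'m^'p"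
    and \<theta> :: "real poly" and S :: "'n \<Rightarrow> 'n \<Rightarrow> real poly" +
  fixes R :: "(real^('m + 'p)^'g::finite) poly"
  assumes iso: "iso_representation A B C D (behavior R)"
begin

text \<open>Passes from a smooth trajectory to recurrences for its derivatives at -1, where the lag
  and the image representation become linear algebra. The sequence \<open>x\<close> consists of the
  derivatives of the state there.\<close>

lemma iso_jets:
  assumes W: "derivs W" "W 0 \<in> behavior R"
  obtains x where "\<And>k. x (Suc k) = A *v x k + B *v inp (W k) (- 1)"
    "\<And>k. outp (W k) (- 1) = C *v x k + D *v inp (W k) (- 1)"
proof -
  obtain \<xi> where \<xi>: "\<And>t. t \<in> {-1..1} \<Longrightarrow> (\<xi> has_vector_derivative (A *v \<xi> t + B *v inp (W 0) t)) (at t within {-1..1})"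
    "\<And>t. t \<in> {-1..1} \<Longrightarrow> outp (W 0) t = C *v \<xi> t + D *v inp (W 0) t"
    using iso derivs_smooth_on_Icc[OF W(1)] W(2) unfolding iso_representation_def by blast
  define x where "x k = nderiv {-1..1} k \<xi>" for k
  have unique: "a = b" if "(f has_vector_derivative a) (at t within {-1..1})" "(f has_vector_derivative b) (at t within {-1..1})" "t \<in> {-1..1}"
    for f :: "real \<Rightarrow> real^'z" and a b and t :: real
    using vector_derivative_unique_within_closed_interval[of "-1" 1 t f a b] that by simp
  have dinp: "((\<lambda>t. M *v inp (W k) t) has_vector_derivative M *v inp (W (Suc k)) t) (at t within {-1..1})" for k t and M :: "real^'m^'z::finite"
    using derivs_bounded_linear[OF matrix_vector_mul_bounded_linear derivs_inp[OF W(1)], of M]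
    by (auto simp: derivs_def intro: has_vector_derivative_at_within)
  have dmul: "((\<lambda>t. M *v f t) has_vector_derivative M *v f') (at t within {-1..1})"
    if "(f has_vector_derivative f') (at t within {-1..1})" for f f' t and M :: "real^'n^'z::finite"
    by (rule bounded_linear.has_vector_derivative[OF matrix_vector_mul_bounded_linear that])
  have main: "\<forall>t\<in>{-1..1}. (x k has_vector_derivative (A *v x k t + B *v inp (W k) t)) (at t within {-1..1})
      \<and> outp (W k) t = C *v x k t + D *v inp (W k) t" for k
  proof (induction k)
    case 0
    then show ?case using \<xi> by (simp add: x_def)
  next
    case (Suc k)
    have xS: "x (Suc k) t = A *v x k t + B *v inp (W k) t" if "t \<in> {-1..1}" for t
      unfolding x_def nderiv_Suc using Suc that
      by (intro vector_derivative_within_closed_interval) (auto simp: x_def)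
    show ?case
    proof (intro ballI conjI)
      fix t :: real assume t: "t \<in> {-1..1}"
      have dk: "(x k has_vector_derivative x (Suc k) t) (at t within {-1..1})"
        using Suc t xS[OF t] by simp
      have "((\<lambda>t. A *v x k t + B *v inp (W k) t) has_vector_derivative (A *v x (Suc k) t + B *v inp (W (Suc k)) t)) (at t within {-1..1})"
        by (intro has_vector_derivative_add dmul dk dinp)
      then show "(x (Suc k) has_vector_derivative (A *v x (Suc k) t + B *v inp (W (Suc k)) t)) (at t within {-1..1})"
        by (rule has_vector_derivative_transform[OF t, rotated]) (rule xS)
      \<comment> \<open>Both sides of the next output equation are derivatives of the same function
        on the interval, and one-sided derivatives are unique.\<close>
      have "((\<lambda>t. C *v x k t + D *v inp (W k) t) has_vector_derivative (C *v x (Suc k) t + D *v inp (W (Suc k)) t)) (at t within {-1..1})"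
        by (intro has_vector_derivative_add dmul dk dinp)
      then have "(outp (W k) has_vector_derivative (C *v x (Suc k) t + D *v inp (W (Suc k)) t)) (at t within {-1..1})"
        by (rule has_vector_derivative_transform[OF t, rotated]) (use Suc in auto)
      moreover have "(outp (W k) has_vector_derivative outp (W (Suc k)) t) (at t within {-1..1})"
        using derivs_outp[OF W(1)] by (auto simp: derivs_def intro: has_vector_derivative_at_within)
      ultimately show "outp (W (Suc k)) t = C *v x (Suc k) t + D *v inp (W (Suc k)) t"
        using unique t by blast
    qed
  qed
  have "x (Suc k) (- 1) = A *v x k (- 1) + B *v inp (W k) (- 1)" for k
    unfolding x_def nderiv_Suc using main[of k]
    by (intro vector_derivative_within_closed_interval) (auto simp: x_def)
  then show ?thesis using that[of "\<lambda>k. x k (- 1)"] main by auto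
qed

lemma traj_p_derivs: "derivs F \<Longrightarrow> derivs (\<lambda>k t. \<chi> c. act (traj_p j c) (\<lambda>i. F i t) k)"
  by (intro derivs_vec derivs_act)

lemma traj_p_behavior:
  assumes F: "derivs F"
  shows "(\<lambda>t. \<chi> c. act (traj_p j c) (\<lambda>i. F i t) 0) \<in> behavior R"
proof -
  let ?w = "\<lambda>t. \<chi> c. act (traj_p j c) (\<lambda>i. F i t) 0"
  define X where "X = (\<lambda>k t. \<chi> i. act (state_p i j) (\<lambda>i. F i t) k)"
  have X: "derivs X" unfolding X_def by (intro derivs_vec derivs_act F)
  have inp: "(M *v inp ?w t) $ i = M $ i $ j * act \<theta> (\<lambda>i. F i t) 0" for t i and M :: "real^'m^'z::finite"
  proof -
    have "(M *v inp ?w t) $ i = (\<Sum>j'\<in>UNIV. M $ i $ j' * act (if j' = j then \<theta> else 0) (\<lambda>i. F i t) 0)"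
      by (simp add: matrix_vector_mult_def inp_def traj_p_def)
    also have "\<dots> = M $ i $ j * act \<theta> (\<lambda>i. F i t) 0" unfolding act_if by (simp add: if_distrib[of "(*) _"] cong: if_cong)
    finally show ?thesis .
  qed
  have "(X 0 has_vector_derivative (A *v X 0 t + B *v inp ?w t)) (at t within {-1..1})" for t
  proof -
    have "A *v X 0 t + B *v inp ?w t = X (Suc 0) t"
      by (simp add: vec_eq_iff inp X_def act_state_p_step) (simp add: matrix_vector_mult_def)
    then show ?thesis using X by (auto simp: derivs_def intro: has_vector_derivative_at_within)
  qed
  moreover have "outp ?w t = C *v X 0 t + D *v inp ?w t" for t
    by (simp only: vec_eq_iff vector_add_component inp)
       (simp add: outp_def traj_p_def act_transfer_p matrix_vector_mult_def X_def)
  ultimately show ?thesis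
    using iso derivs_smooth_on_Icc[OF traj_p_derivs[OF F]] derivs_smooth_on_Icc[OF X]
    unfolding iso_representation_def by blast
qed

text \<open>If \<eta> is annihilated by \<open>R\<close>, then \<eta>(d/dt) f is a trajectory for
  every smooth \<open>f\<close>, and its derivatives at -1 obey the input-output relation of the
  state space. Letting \<open>f\<close> run through monomials in \<open>t + 1\<close> recovers the
  relation between the polynomials.\<close>

lemma row_kernel:
  assumes \<eta>: "\<And>g. (\<Sum>c\<in>UNIV. row_poly R g c * \<eta> c) = 0"
  shows "\<theta> * \<eta> (Inr p) = (\<Sum>j\<in>UNIV. transfer_p p j * \<eta> (Inl j))"
proof (rule act_faithful)
  fix m :: nat
  \<comment> \<open>The derivative sequence at -1 of \<open>(t + 1) ^ m / fact m\<close>.\<close>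
  define \<delta> :: "nat \<Rightarrow> real" where "\<delta> = (\<lambda>i. if i = m then 1 else 0)"
  have \<delta>: "exp_bdd \<delta>" by (rule exp_bdd_finite_support[of "Suc m"]) (simp add: \<delta>_def)
  define F where "F = (\<lambda>k. taylor (\<lambda>i. \<delta> (i + k)))"
  have F: "derivs F" unfolding F_def by (rule derivs_taylor[OF \<delta>])
  have F1: "F i (- 1) = \<delta> i" for i by (simp add: F_def taylor_at_left)
  define W :: "nat \<Rightarrow> real \<Rightarrow> real^('m + 'p)" where "W = (\<lambda>k t. \<chi> c. act (\<eta> c) (\<lambda>i. F i t) k)"
  have W: "derivs W" unfolding W_def by (intro derivs_vec derivs_act F)
  have "W 0 \<in> behavior R"
  proof (rule derivs_behavior[OF W])
    fix t
    have "(\<Sum>i\<le>degree R. coeff R i *v W i t) $ g = 0" for g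
    proof -
      have "(\<Sum>i\<le>degree R. coeff R i *v W i t) $ g = (\<Sum>c\<in>UNIV. \<Sum>i\<le>degree R. coeff R i $ g $ c * act (\<eta> c) (\<lambda>i. F i t) i)"
        by (subst sum.swap) (simp add: sum_component matrix_vector_mult_def W_def)
      also have "\<dots> = (\<Sum>c\<in>UNIV. act (row_poly R g c) (act (\<eta> c) (\<lambda>i. F i t)) 0)"
        by (simp add: act_eq_sum[OF degree_row_poly] coeff_row_poly)
      also have "\<dots> = act (\<Sum>c\<in>UNIV. row_poly R g c * \<eta> c) (\<lambda>i. F i t) 0"
        by (simp only: act_sum_left act_mult)
      finally show ?thesis by (simp add: \<eta>)
    qed
    then show "(\<Sum>i\<le>degree R. coeff R i *v W i t) = 0" by (simp add: vec_eq_iff)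
  qed
  then obtain x where x: "\<And>k. x (Suc k) = A *v x k + B *v inp (W k) (- 1)"
    "\<And>k. outp (W k) (- 1) = C *v x k + D *v inp (W k) (- 1)"
    using iso_jets[OF W] by blast
  have U: "inp (W k) (- 1) $ j = act (\<eta> (Inl j)) \<delta> k" and Y: "outp (W k) (- 1) $ p = act (\<eta> (Inr p)) \<delta> k" for k j p
    by (simp_all add: inp_def outp_def W_def F1)
  have "act \<theta> (act (\<eta> (Inr p)) \<delta>) 0 = (\<Sum>j\<in>UNIV. act (transfer_p p j) (act (\<eta> (Inl j)) \<delta>) 0)"
  proof (rule act_output[of "\<lambda>i k. x k $ i"])
    show "x (Suc k) $ i = (\<Sum>j\<in>UNIV. A $ i $ j * x k $ j) + (\<Sum>j\<in>UNIV. B $ i $ j * act (\<eta> (Inl j)) \<delta> k)" for i k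
      by (simp add: x(1) matrix_vector_mult_def U)
    show "act (\<eta> (Inr p)) \<delta> k = (\<Sum>i\<in>UNIV. C $ p $ i * x k $ i) + (\<Sum>j\<in>UNIV. D $ p $ j * act (\<eta> (Inl j)) \<delta> k)" for k
      by (simp add: Y[symmetric] x(2) matrix_vector_mult_def U)
  qed
  then show "act (\<theta> * \<eta> (Inr p)) (\<lambda>i. if i = m then 1 else 0) 0 =
      act (\<Sum>j\<in>UNIV. transfer_p p j * \<eta> (Inl j)) (\<lambda>i. if i = m then 1 else 0) 0"
    by (simp add: \<delta>_def act_mult act_sum_left)
qed

section \<open>The Euler-Lagrange system\<close>

text \<open>
  The weak equations satisfied by a minimizer: rows \<open>Inl g\<close> are the equations of the behavior, row
  \<open>Inr j\<close> is stationarity under the variations \<open>traj_p j\<close> applied to test functions. All entries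
  act on the test function, hence the adjoints.
\<close>

definition el_matrix :: "nat \<Rightarrow> 'g + 'm \<Rightarrow> 'm + 'p \<Rightarrow> real poly" where
  "el_matrix l r c = (case r of
     Inl g \<Rightarrow> adj_poly (row_poly R g c)
   | Inr j \<Rightarrow> (case c of
       Inl i \<Rightarrow> if i = j then smult ((- 1) ^ l) (\<theta> * monom 1 (2 * l)) else 0
     | Inr p \<Rightarrow> transfer_p p j))"

text \<open>
  Eliminating the outputs leaves a system for the inputs in which the term from the penalty on
  \<open>u\<^sup>(\<^sup>l\<^sup>)\<close> has the largest degree; this is where \<open>l > 0\<close> is needed.
\<close>

lemma el_matrix_kernel:
  assumes l: "l > 0" and \<eta>: "\<And>r. (\<Sum>c\<in>UNIV. el_matrix l r c * \<eta> c) = 0"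
  shows "\<eta> c = 0"
proof -
  \<comment> \<open>The rows \<open>Inl g\<close> carry adjoints, so it is the adjoint of \<eta>
    that \<open>R\<close> annihilates and \<open>row_kernel\<close> applies to.\<close>
  have "(\<Sum>c\<in>UNIV. row_poly R g c * adj_poly (\<eta> c)) = 0" for g
  proof -
    have "adj_poly (\<Sum>c\<in>UNIV. row_poly R g c * adj_poly (\<eta> c)) = 0"
      using \<eta>[of "Inl g"] by (simp add: el_matrix_def adj_poly_sum adj_poly_mult)
    then show ?thesis by simp
  qed
  then have "\<theta> * adj_poly (\<eta> (Inr p)) = (\<Sum>j\<in>UNIV. transfer_p p j * adj_poly (\<eta> (Inl j)))" for p by (rule row_kernel)
  from arg_cong[OF this, of adj_poly]
  have Y: "adj_poly \<theta> * \<eta> (Inr p) = (\<Sum>j\<in>UNIV. adj_poly (transfer_p p j) * \<eta> (Inl j))" for p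
    by (simp add: adj_poly_mult adj_poly_sum)
  have E: "smult ((- 1) ^ l) (\<theta> * monom 1 (2 * l)) * \<eta> (Inl j) = - (\<Sum>p\<in>UNIV. transfer_p p j * \<eta> (Inr p))" for j
  proof -
    have "(\<Sum>i\<in>UNIV. (if i = j then smult ((- 1) ^ l) (\<theta> * monom 1 (2 * l)) else 0) * \<eta> (Inl i)) + (\<Sum>p\<in>UNIV. transfer_p p j * \<eta> (Inr p)) = 0"
      using \<eta>[of "Inr j"] by (simp add: sum_UNIV_Plus el_matrix_def)
    then show ?thesis by (simp add: if_distrib if_distribR add_eq_0_iff2 cong: if_cong)
  qed
  let ?P = "adj_poly \<theta> * (smult ((- 1) ^ l) (\<theta> * monom 1 (2 * l)))"
  have "?P * \<eta> (Inl j) = (\<Sum>i\<in>UNIV. (- (\<Sum>p\<in>UNIV. transfer_p p j * adj_poly (transfer_p p i))) * \<eta> (Inl i))" for j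
  proof -
    have "?P * \<eta> (Inl j) = - (\<Sum>p\<in>UNIV. transfer_p p j * (adj_poly \<theta> * \<eta> (Inr p)))"
      unfolding mult.assoc E by (simp add: sum_distrib_left mult.left_commute)
    also have "\<dots> = - (\<Sum>i\<in>UNIV. \<Sum>p\<in>UNIV. transfer_p p j * adj_poly (transfer_p p i) * \<eta> (Inl i))"
      unfolding Y by (subst sum.swap) (simp add: sum_distrib_left mult.assoc)
    finally show ?thesis by (simp add: sum_distrib_right sum_negf)
  qed
  moreover have "degree (- (\<Sum>p\<in>UNIV. transfer_p p j * adj_poly (transfer_p p i))) < degree ?P" for i j
  proof -
    have "degree ?P = degree \<theta> + (degree \<theta> + 2 * l)"
      using \<theta> by (subst degree_mult_eq) (auto simp: degree_mult_eq degree_monom_eq monom_eq_0_iff)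
    moreover have "degree (\<Sum>p\<in>UNIV. transfer_p p j * adj_poly (transfer_p p i)) \<le> degree \<theta> + degree \<theta>"
    proof (rule degree_sum_le)
      fix p
      show "degree (transfer_p p j * adj_poly (transfer_p p i)) \<le> degree \<theta> + degree \<theta>"
        using degree_mult_le[of "transfer_p p j" "adj_poly (transfer_p p i)"] degree_transfer_p[of p j] degree_transfer_p[of p i] by simp
    qed simp
    ultimately show ?thesis using l by simp
  qed
  ultimately have u: "\<eta> (Inl j) = 0" for j by (rule degree_dominant_kernel[of ?P])
  have "adj_poly \<theta> * \<eta> (Inr p) = 0" for p using Y[of p] u by simp
  then have "\<eta> (Inr p) = 0" for p using \<theta> by simp
  with u show ?thesis by (cases c) auto
qed

text \<open>The penalty pairs the weak derivative of order \<open>l\<close> with \<open>l\<close>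
  derivatives of \<theta>(d/dt) F. Weak differentiation moves the other \<open>l\<close> derivatives
  onto the test function, whence the power \<open>2 * l\<close> and the sign.\<close>

lemma euler_lagrange:
  assumes w: "solves_P (behavior R) l \<xi> w" and F: "tests F"
  shows "LI (\<lambda>t. \<Sum>c\<in>UNIV. act (el_matrix l (Inr j) c) (\<lambda>i. F i t) 0 * w t $ c) = 0"
proof -
  have ws: "w \<in> sobolev l" and wL: "w \<in> L2"
    using w sobolev_L2 unfolding solves_P_def is_arg_min_linorder by auto
  let ?V = "weak_deriv l (inp w)"
  note V = sobolev_inp_weak_deriv[OF ws]
  define W :: "nat \<Rightarrow> real \<Rightarrow> real^('m + 'p)" where "W = (\<lambda>k t. \<chi> c. act (traj_p j c) (\<lambda>i. F i t) k)"
  have W: "derivs W" "W 0 \<in> behavior R"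
    unfolding W_def using F by (auto intro: traj_p_derivs traj_p_behavior tests_derivs)
  have "W i (- 1) = 0" for i
    using F by (auto simp: W_def vec_eq_iff tests_def intro!: act_eq_0)
  then have "cost_deriv l w W = 0" by (intro solves_P_variation(1)[OF w W])
  moreover have "outp w t \<bullet> outp (W 0) t = (\<Sum>p\<in>UNIV. act (transfer_p p j) (\<lambda>i. F i t) 0 * w t $ Inr p)" for t
    by (simp add: inner_vec_def outp_def W_def traj_p_def mult.commute)
  moreover have "?V t \<bullet> inp (W l) t = act \<theta> (\<lambda>i. F i t) l * ?V t $ j" for t
  proof -
    have "?V t \<bullet> inp (W l) t = (\<Sum>i\<in>UNIV. ?V t $ i * act (if i = j then \<theta> else 0) (\<lambda>i. F i t) l)"
      by (simp add: inner_vec_def inp_def W_def traj_p_def)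
    also have "\<dots> = act \<theta> (\<lambda>i. F i t) l * ?V t $ j" unfolding act_if by (simp add: if_distrib[of "(*) _"] cong: if_cong)
    finally show ?thesis .
  qed
  ultimately have *: "LI (\<lambda>t. \<Sum>p\<in>UNIV. act (transfer_p p j) (\<lambda>i. F i t) 0 * w t $ Inr p) + LI (\<lambda>t. act \<theta> (\<lambda>i. F i t) l * ?V t $ j) = 0"
    by (simp add: cost_deriv_def)
  define G where "G = (\<lambda>k t. act \<theta> (\<lambda>i. F i t) (k + l))"
  have G: "tests G" unfolding G_def by (rule tests_shift[OF tests_act[OF F]])
  have comp: "LI (\<lambda>t. G k t * f t $ j) = LI (\<lambda>t. G k t *\<^sub>R f t) $ j" if "f \<in> L2" for k and f :: "real \<Rightarrow> real^'m"
    using integral_bounded_linear[OF bounded_linear_vec_nth[of j] tests_integr_scaleR[OF G that]] by simp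
  have "LI (\<lambda>t. G l t *\<^sub>R inp w t) = (- 1) ^ l *\<^sub>R LI (\<lambda>t. G 0 t *\<^sub>R ?V t)"
    using V(2) G unfolding has_weak_deriv_iff by blast
  then have "LI (\<lambda>t. G l t * inp w t $ j) = (- 1) ^ l * LI (\<lambda>t. G 0 t * ?V t $ j)"
    by (simp add: comp inp_L2 wL V(1))
  then have "LI (\<lambda>t. G 0 t * ?V t $ j) = (- 1) ^ l * LI (\<lambda>t. G l t * inp w t $ j)"
    by simp
  also have "\<dots> = LI (\<lambda>t. act (smult ((- 1) ^ l) (\<theta> * monom 1 (2 * l))) (\<lambda>i. F i t) 0 * w t $ Inl j)"
  proof -
    have "act (\<theta> * monom 1 (2 * l)) (\<lambda>i. F i t) 0 = G l t" for t
      by (subst mult.commute, subst act_mult, subst act_monom) (simp add: G_def mult_2)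
    then show ?thesis by (simp add: act_smult inp_def mult.assoc)
  qed
  finally have V_eq: "LI (\<lambda>t. act \<theta> (\<lambda>i. F i t) l * ?V t $ j) = LI (\<lambda>t. act (smult ((- 1) ^ l) (\<theta> * monom 1 (2 * l))) (\<lambda>i. F i t) 0 * w t $ Inl j)"
    by (simp add: G_def)
  have int: "integr (\<lambda>t. act P (\<lambda>i. F i t) 0 * w t $ c)" for P c
    using tests_act[OF F]
    by (intro integr_mult L2_integr L2_bounded_linear[OF bounded_linear_vec_nth] wL derivs_continuous_on[of "\<lambda>k t. act P (\<lambda>i. F i t) k"] tests_derivs)
  have "(\<Sum>c\<in>UNIV. act (el_matrix l (Inr j) c) (\<lambda>i. F i t) 0 * w t $ c)
    = act (smult ((- 1) ^ l) (\<theta> * monom 1 (2 * l))) (\<lambda>i. F i t) 0 * w t $ Inl j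
      + (\<Sum>p\<in>UNIV. act (transfer_p p j) (\<lambda>i. F i t) 0 * w t $ Inr p)" for t
    by (simp add: sum_UNIV_Plus el_matrix_def if_distrib[of "\<lambda>P. act P _ _"] if_distrib if_distribR cong: if_cong)
  then show ?thesis
    using * V_eq int by (simp add: Bochner_Integration.integral_add Bochner_Integration.integrable_sum)
qed

lemma minimizer_regular:
  assumes w: "solves_P (behavior R) l \<xi> w" and l: "l > 0"
  obtains a where "exp_bdd a" "AE t in mI. w t = taylor a t"
proof (rule weak_system_regular[of w "el_matrix l"])
  have wB: "w \<in> behavior R" using w unfolding solves_P_def is_arg_min_linorder by auto
  then show "w \<in> L2" by (simp add: behavior_iff)
  show "\<eta> c = 0" if "\<And>r. (\<Sum>c\<in>UNIV. el_matrix l r c * \<eta> c) = 0" for \<eta> c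
    using el_matrix_kernel[OF l that] .
  show "LI (\<lambda>t. \<Sum>c\<in>UNIV. act (el_matrix l r c) (\<lambda>i. F i t) 0 * w t $ c) = 0" if F: "tests F" for r F
  proof (cases r)
    case (Inl g)
    then show ?thesis using behavior_row[OF wB F] by (simp add: el_matrix_def)
  next
    case (Inr j)
    then show ?thesis using euler_lagrange[OF w F] by simp
  qed
qed (rule that)

end

section \<open>Polynomials as terminating Taylor series\<close>

text \<open>Needed because \<open>im_P\<close> uses powers of \<open>t\<close> while
  \<open>taylor\<close> is centred at -1.\<close>

lemma polynomial_recenter:
  fixes c :: "nat \<Rightarrow> 'a::real_vector" and r :: real
  shows "\<exists>a. \<forall>t. (\<Sum>j<N. (t + r) ^ j *\<^sub>R c j) = (\<Sum>j<N. t ^ j *\<^sub>R a j)"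
proof (induction N)
  case (Suc N)
  then obtain a where a: "\<And>t. (\<Sum>j<N. (t + r) ^ j *\<^sub>R c j) = (\<Sum>j<N. t ^ j *\<^sub>R a j)" by blast
  let ?b = "\<lambda>j. (if j < N then a j else 0) + (real (N choose j) * r ^ (N - j)) *\<^sub>R c N"
  have "(\<Sum>j<Suc N. (t + r) ^ j *\<^sub>R c j) = (\<Sum>j<Suc N. t ^ j *\<^sub>R ?b j)" for t
  proof -
    have "(t + r) ^ N *\<^sub>R c N = (\<Sum>j<Suc N. t ^ j *\<^sub>R ((real (N choose j) * r ^ (N - j)) *\<^sub>R c N))"
      unfolding binomial_ring lessThan_Suc_atMost by (simp add: scaleR_sum_left mult_ac)
    moreover have "(\<Sum>j<N. t ^ j *\<^sub>R a j) = (\<Sum>j<Suc N. t ^ j *\<^sub>R (if j < N then a j else 0))"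
      by (simp add: sum.lessThan_Suc)
    ultimately have "(\<Sum>j<Suc N. (t + r) ^ j *\<^sub>R c j) =
        (\<Sum>j<Suc N. t ^ j *\<^sub>R (if j < N then a j else 0)) + (\<Sum>j<Suc N. t ^ j *\<^sub>R ((real (N choose j) * r ^ (N - j)) *\<^sub>R c N))"
      unfolding sum.lessThan_Suc[of "\<lambda>j. (t + r) ^ j *\<^sub>R c j"] a by simp
    then show ?thesis by (simp only: scaleR_add_right sum.distrib)
  qed
  then show ?case by (intro exI[of _ ?b]) blast
qed simp

lemma taylor_im_P:
  fixes a :: "nat \<Rightarrow> 'a::euclidean_space"
  assumes "\<And>k. k \<ge> N \<Longrightarrow> a k = 0"
  shows "taylor a \<in> im_P N"
proof -
  obtain c where c: "\<And>t. (\<Sum>j<N. (t + 1) ^ j *\<^sub>R ((1 / fact j) *\<^sub>R a j)) = (\<Sum>j<N. t ^ j *\<^sub>R c j)"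
    using polynomial_recenter[where N = N and r = 1 and c = "\<lambda>j. (1 / fact j) *\<^sub>R a j"] by blast
  have "taylor a t = (\<Sum>j<N. t ^ j *\<^sub>R c j)" for t
    unfolding c[symmetric] by (subst taylor_finite[OF assms]) auto
  then show ?thesis unfolding im_P_def by blast
qed

lemma im_P_taylor:
  fixes w :: "real \<Rightarrow> 'a::euclidean_space"
  assumes "w \<in> im_P N"
  obtains a where "\<And>k. k \<ge> N \<Longrightarrow> a k = 0" "AE t in mI. w t = taylor a t"
proof -
  obtain c where c: "AE t in mI. w t = (\<Sum>j<N. t ^ j *\<^sub>R c j)"
    using assms unfolding im_P_def by blast
  obtain b where b: "\<And>t. (\<Sum>j<N. (t + (- 1)) ^ j *\<^sub>R c j) = (\<Sum>j<N. t ^ j *\<^sub>R b j)"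
    using polynomial_recenter[where N = N and r = "- 1" and c = c] by blast
  define a where "a k = (if k < N then fact k *\<^sub>R b k else 0)" for k
  have "taylor a t = (\<Sum>j<N. t ^ j *\<^sub>R c j)" for t
  proof -
    have "taylor a t = (\<Sum>k<N. ((t + 1) ^ k / fact k) *\<^sub>R a k)"
      by (rule taylor_finite) (simp add: a_def)
    also have "\<dots> = (\<Sum>k<N. (t + 1) ^ k *\<^sub>R b k)" by (intro sum.cong) (auto simp: a_def)
    also have "\<dots> = (\<Sum>j<N. t ^ j *\<^sub>R c j)" using b[of "t + 1"] by simp
    finally show ?thesis .
  qed
  with c have "AE t in mI. w t = taylor a t" by simp
  then show ?thesis using that[of a] by (simp add: a_def)
qed

lemma taylor_act:
  fixes a :: "nat \<Rightarrow> real"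
  assumes "exp_bdd a"
  shows "taylor (act P a) t = act P (\<lambda>i. taylor (\<lambda>k. a (k + i)) t) 0"
proof -
  have "act P a = (\<lambda>k. \<Sum>i\<le>degree P. coeff P i * a (k + i))"
    by (simp add: act_def fun_eq_iff add.commute)
  then have "taylor (act P a) t = (\<Sum>i\<le>degree P. taylor (\<lambda>k. coeff P i * a (k + i)) t)"
    by (simp add: taylor_sum exp_bdd_cmult exp_bdd_shift[OF assms])
  also have "\<dots> = act P (\<lambda>i. taylor (\<lambda>k. a (k + i)) t) 0"
    by (simp add: act_def taylor_bounded_linear[OF bounded_linear_mult_right exp_bdd_shift[OF assms], symmetric])
  finally show ?thesis .
qed

section \<open>Poincare's inequality\<close>

text \<open>Cauchy-Schwarz against the constant 1, as nonnegativity of a variance: \<open>m\<close>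
  is the mean of \<open>f\<close>, and 2 is the length of the interval.\<close>

lemma LI_square_le:
  fixes f :: "real \<Rightarrow> real"
  assumes "continuous_on {-1..1} f"
  shows "(LI f)\<^sup>2 \<le> 2 * LI (\<lambda>t. (f t)\<^sup>2)"
proof -
  define m where "m = LI f / 2"
  have LIf: "LI f = 2 * m" by (simp add: m_def)
  have "LI (\<lambda>t. m\<^sup>2) = 2 * m\<^sup>2" by (subst LI_eq_integral) auto
  then have c: "LI (\<lambda>t. m\<^sup>2 + - 2 * m * f t) = - 2 * m\<^sup>2"
    using assms by (subst LI_add_cont) (auto intro!: continuous_intros simp: LIf power2_eq_square)
  have "0 \<le> LI (\<lambda>t. (f t - m)\<^sup>2)" by (rule Bochner_Integration.integral_nonneg) simp
  also have "\<dots> = LI (\<lambda>t. (f t)\<^sup>2 + (m\<^sup>2 + - 2 * m * f t))"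
    by (simp add: power2_diff algebra_simps)
  also have "\<dots> = LI (\<lambda>t. (f t)\<^sup>2) - 2 * m\<^sup>2"
    using assms by (subst LI_add_cont) (auto intro!: continuous_intros simp only: c)
  finally show ?thesis by (simp add: LIf power2_eq_square)
qed

text \<open>The value at \<open>t\<close> is at most the integral of the norm of the derivative.
  Integrating the square of this bound over the interval costs a factor 2, Cauchy-Schwarz
  another.\<close>

lemma poincare_step:
  fixes U :: "nat \<Rightarrow> real \<Rightarrow> 'a::euclidean_space"
  assumes U: "derivs U" and init: "U k (- 1) = 0"
  shows "LI (\<lambda>t. (norm (U k t))\<^sup>2) \<le> 4 * LI (\<lambda>t. (norm (U (Suc k) t))\<^sup>2)"
proof -
  let ?f = "\<lambda>t. norm (U (Suc k) t)"
  have cont: "continuous_on S ?f" for S by (intro continuous_intros derivs_continuous_on U)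
  have le: "norm (U k t) \<le> LI ?f" if t: "t \<in> {-1..1}" for t
  proof -
    have "(U (Suc k) has_integral U k t - U k (- 1)) {-1..t}"
      using U t by (intro fundamental_theorem_of_calculus) (auto simp: derivs_def intro: has_vector_derivative_at_within)
    then have "norm (U k t) = norm (integral {-1..t} (U (Suc k)))" by (simp add: init integral_unique)
    also have "\<dots> \<le> integral {-1..t} ?f"
      by (intro integral_norm_bound_integral integrable_continuous_real derivs_continuous_on U cont) auto
    also have "\<dots> \<le> integral {-1..1} ?f"
      using t by (intro integral_subset_le integrable_continuous_real cont) auto
    finally show ?thesis by (simp add: LI_eq_integral[OF cont])
  qed
  have "LI (\<lambda>t. (norm (U k t))\<^sup>2) \<le> LI (\<lambda>t. (LI ?f)\<^sup>2)"
  proof (rule integral_mono_AE)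
    show "integr (\<lambda>t. (norm (U k t))\<^sup>2)" by (intro continuous_integr continuous_intros derivs_continuous_on U)
    show "AE t in mI. (norm (U k t))\<^sup>2 \<le> (LI ?f)\<^sup>2"
      using le by (intro AE_I2 power_mono) (auto simp: space_restrict_space)
  qed (simp add: continuous_integr)
  also have "\<dots> = 2 * (LI ?f)\<^sup>2" by (subst LI_eq_integral) auto
  also have "\<dots> \<le> 4 * LI (\<lambda>t. (?f t)\<^sup>2)" using LI_square_le[OF cont] by simp
  finally show ?thesis .
qed

lemma poincare:
  fixes U :: "nat \<Rightarrow> real \<Rightarrow> 'a::euclidean_space"
  assumes U: "derivs U" and init: "\<And>i. i < l \<Longrightarrow> U i (- 1) = 0"
  shows "LI (\<lambda>t. (norm (U 0 t))\<^sup>2) \<le> 4 ^ l * LI (\<lambda>t. (norm (U l t))\<^sup>2)"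
  using init
proof (induction l)
  case (Suc l)
  then have "LI (\<lambda>t. (norm (U 0 t))\<^sup>2) \<le> 4 ^ l * LI (\<lambda>t. (norm (U l t))\<^sup>2)" by simp
  also have "\<dots> \<le> 4 ^ l * (4 * LI (\<lambda>t. (norm (U (Suc l) t))\<^sup>2))"
    using Suc(2)[of l] by (intro mult_left_mono poincare_step U) auto
  finally show ?case by simp
qed simp

section \<open>Cost and norm of smooth trajectories\<close>

lemma norm_inp_outp: "(norm (w t))\<^sup>2 = (norm (outp w t))\<^sup>2 + (norm (inp w t))\<^sup>2"
  unfolding power2_norm_eq_inner
  by (simp add: inner_vec_def sum_UNIV_Plus inp_def outp_def)

lemma norm_outp_le: "norm (outp w t) \<le> norm (w t)" and norm_inp_le: "norm (inp w t) \<le> norm (w t)"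
  using norm_inp_outp[of w t] zero_le_power2[of "norm (inp w t)"] zero_le_power2[of "norm (outp w t)"]
  by (auto intro: power2_le_imp_le)

text \<open>Coercivity on variations: the output enters the cost directly, the input only through
  its derivative of order \<open>l\<close>, which controls it by Poincare's inequality since the
  initial values vanish.\<close>

lemma L2_norm_le_cost:
  assumes W: "derivs W" and init: "\<And>i. i < l \<Longrightarrow> W i (- 1) = 0"
  shows "(L2_norm (W 0))\<^sup>2 \<le> 4 ^ l * cost l (W 0)"
proof -
  have init': "inp (W i) (- 1) = 0" if "i < l" for i
    using init[OF that] by (simp add: inp_def vec_eq_iff)
  have "(L2_norm (W 0))\<^sup>2 = LI (\<lambda>t. (norm (outp (W 0) t))\<^sup>2) + LI (\<lambda>t. (norm (inp (W 0) t))\<^sup>2)"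
    unfolding L2_norm_power2 norm_inp_outp[of "W 0"]
    using derivs_L2[OF derivs_outp[OF W], of 0] derivs_L2[OF derivs_inp[OF W], of 0] by (simp add: L2_def)
  moreover have "LI (\<lambda>t. (norm (outp (W 0) t))\<^sup>2) \<le> 4 ^ l * LI (\<lambda>t. (norm (outp (W 0) t))\<^sup>2)"
    using mult_right_mono[of 1 "4 ^ l" "LI (\<lambda>t. (norm (outp (W 0) t))\<^sup>2)"] by simp
  moreover have "LI (\<lambda>t. (norm (inp (W 0) t))\<^sup>2) \<le> 4 ^ l * LI (\<lambda>t. (norm (inp (W l) t))\<^sup>2)"
    by (rule poincare[OF derivs_inp[OF W] init'])
  ultimately show ?thesis unfolding cost_derivs[OF W] by (simp add: distrib_left)
qed

lemma cost_le_of_bound: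
  assumes W: "derivs W" and b: "\<And>t i. t \<in> {-1..1} \<Longrightarrow> i \<in> {0, l} \<Longrightarrow> norm (W i t) \<le> H"
  shows "cost l (W 0) \<le> 4 * H\<^sup>2"
proof -
  have c: "LI (\<lambda>t. (norm (f t))\<^sup>2) \<le> 2 * H\<^sup>2"
    if "f \<in> L2" "\<And>t. t \<in> {-1..1} \<Longrightarrow> norm (f t) \<le> H" for f :: "real \<Rightarrow> 'z::euclidean_space"
  proof -
    have "LI (\<lambda>t. (norm (f t))\<^sup>2) \<le> LI (\<lambda>t. H\<^sup>2)"
    proof (rule integral_mono_AE)
      show "integr (\<lambda>t. (norm (f t))\<^sup>2)" using that(1) by (simp add: L2_def)
      show "AE t in mI. (norm (f t))\<^sup>2 \<le> H\<^sup>2"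
        using that(2) by (intro AE_I2 power_mono) (auto simp: space_restrict_space)
    qed (simp add: continuous_integr)
    also have "\<dots> = 2 * H\<^sup>2" by (subst LI_eq_integral) auto
    finally show ?thesis .
  qed
  have "norm (outp (W 0) t) \<le> H" "norm (inp (W l) t) \<le> H" if "t \<in> {-1..1}" for t
    using norm_outp_le[of "W 0" t] norm_inp_le[of "W l" t] b[OF that, of 0] b[OF that, of l] by auto
  then have "LI (\<lambda>t. (norm (outp (W 0) t))\<^sup>2) \<le> 2 * H\<^sup>2" "LI (\<lambda>t. (norm (inp (W l) t))\<^sup>2) \<le> 2 * H\<^sup>2"
    by (auto intro!: c derivs_L2[OF derivs_outp[OF W]] derivs_L2[OF derivs_inp[OF W]])
  then show ?thesis unfolding cost_derivs[OF W] by simp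
qed

section \<open>Polynomial approximation of trajectories\<close>

context iso_behavior
begin

text \<open>The state is the free motion from \<open>x 0\<close> plus the response from rest.
  Vanishing derivatives up to the lag make the free motion unobservable, so inputs and outputs are
  those of the response, whose latent variable solves \<theta>(d/dt) f = u from rest.\<close>

lemma image_representation:
  fixes a :: "nat \<Rightarrow> real^('m + 'p)"
  assumes a: "exp_bdd a" "taylor a \<in> behavior R" and init: "\<And>k. k < lag A C \<Longrightarrow> a k = 0"
  obtains f where "\<And>j. exp_bdd (f j)" "\<And>j i. i < degree \<theta> + lag A C \<Longrightarrow> f j i = 0"
    "\<And>k c. a k $ c = (\<Sum>j\<in>UNIV. act (traj_p j c) (f j) k)"
proof -
  define W where "W = (\<lambda>k. taylor (\<lambda>i. a (i + k)))"
  have W: "derivs W" "W 0 \<in> behavior R" unfolding W_def using a by (auto intro: derivs_taylor)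
  have W1: "W k (- 1) = a k" for k by (simp add: W_def taylor_at_left)
  obtain x where x: "\<And>k. x (Suc k) = A *v x k + B *v inp (W k) (- 1)"
    "\<And>k. outp (W k) (- 1) = C *v x k + D *v inp (W k) (- 1)"
    using iso_jets[OF W] by blast
  define u where "u = (\<lambda>k. inp (W k) (- 1))"
  have u: "u k $ j = a k $ Inl j" for k j by (simp add: u_def inp_def W1)
  have u0: "u k = 0" if "k < lag A C" for k using init[OF that] by (simp add: vec_eq_iff u)
  define z where "z = rec_nat (x 0) (\<lambda>k v. A *v v)"
  have z: "z 0 = x 0" "\<And>k. z (Suc k) = A *v z k" by (simp_all add: z_def)
  have xz: "x k = z k" if "k \<le> lag A C" for k
    using that by (induction k) (simp_all add: z x(1) u0[unfolded u_def])
  have Cz: "C *v z k = 0" for k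
  proof (rule unobservable_of_lag[of z A])
    fix k assume k: "k < lag A C"
    then have "outp (W k) (- 1) = 0" using init by (simp add: outp_def W1 vec_eq_iff)
    moreover have "inp (W k) (- 1) = 0" using u0[OF k] unfolding u_def .
    ultimately show "C *v z k = 0" using x(2)[of k] xz[of k] k by simp
  qed (rule z(2))
  define f where "f j = (SOME f. (\<forall>i<degree \<theta>. f i = 0) \<and> (\<forall>k. act \<theta> f k = a k $ Inl j))" for j
  have "(\<forall>i<degree \<theta>. f j i = 0) \<and> (\<forall>k. act \<theta> (f j) k = a k $ Inl j)" for j
  proof -
    have "\<exists>f. (\<forall>i<degree \<theta>. f i = 0) \<and> (\<forall>k. act \<theta> f k = a k $ Inl j)"
      by (rule act_solve[OF \<theta>, of "\<lambda>k. a k $ Inl j"]) blast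
    from someI_ex[OF this] show ?thesis unfolding f_def .
  qed
  then have f0: "\<And>i. i < degree \<theta> \<Longrightarrow> f j i = 0" and f: "\<And>k. act \<theta> (f j) k = a k $ Inl j" for j
    by auto
  have fe: "exp_bdd (f j)" for j
    by (rule exp_bdd_solve[OF \<theta> exp_bdd_bounded_linear[OF bounded_linear_vec_nth a(1)] f0 f])
  \<comment> \<open>The input has \<open>lag A C\<close> vanishing derivatives, so the recurrence
    prolongs the \<open>degree \<theta>\<close> initial zeros of \<open>f j\<close> by that
    many.\<close>
  have f00: "f j i = 0" if "i < degree \<theta> + lag A C" for j i
    using that
  proof (induction i rule: less_induct)
    case (less i)
    show ?case
    proof (cases "i < degree \<theta>")
      case False
      define k where "k = i - degree \<theta>"
      have k: "i = degree \<theta> + k" "k < lag A C" using False less(2) by (auto simp: k_def)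
      have "act \<theta> (f j) k = 0" using f init[OF k(2)] by simp
      moreover have "act \<theta> (f j) k = (\<Sum>i<degree \<theta>. coeff \<theta> i * f j (i + k)) + lead_coeff \<theta> * f j i"
        unfolding act_def k(1) by (simp flip: lessThan_Suc_atMost)
      moreover have "(\<Sum>i<degree \<theta>. coeff \<theta> i * f j (i + k)) = 0"
        using k by (intro sum.neutral) (auto intro!: less(1))
      ultimately show ?thesis using \<theta> by simp
    qed (rule f0)
  qed
  \<comment> \<open>Both sides satisfy the same recurrence; both start at 0, the right one because
    \<open>state_p\<close> has smaller degree than \<theta>.\<close>
  have xh: "(x k - z k) $ i = (\<Sum>j\<in>UNIV. act (state_p i j) (f j) k)" for k i
  proof (induction k arbitrary: i)
    case 0
    have "act (state_p i j) (f j) 0 = 0" for j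
    proof (cases "state_p i j = 0")
      case False
      then show ?thesis using degree_state_p[OF False] by (intro act_eq_0) (auto intro!: f0)
    qed simp
    then show ?case by (simp add: z)
  next
    case (Suc k)
    have "x (Suc k) - z (Suc k) = A *v (x k - z k) + B *v u k"
      by (simp add: x(1) z(2) u_def matrix_vector_mult_diff_distrib)
    then have "(x (Suc k) - z (Suc k)) $ i = (\<Sum>r\<in>UNIV. A $ i $ r * (x k - z k) $ r) + (\<Sum>j\<in>UNIV. B $ i $ j * u k $ j)"
      by (simp add: matrix_vector_mult_def)
    also have "\<dots> = (\<Sum>r\<in>UNIV. \<Sum>j\<in>UNIV. A $ i $ r * act (state_p r j) (f j) k) + (\<Sum>j\<in>UNIV. B $ i $ j * act \<theta> (f j) k)"
      unfolding Suc by (simp add: sum_distrib_left f u)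
    also have "\<dots> = (\<Sum>j\<in>UNIV. act (state_p i j) (f j) (Suc k))"
      by (subst sum.swap) (simp add: act_state_p_step sum.distrib)
    finally show ?case .
  qed
  have "a k $ c = (\<Sum>j\<in>UNIV. act (traj_p j c) (f j) k)" for k c
  proof (cases c)
    case (Inl i)
    then have "(\<Sum>j\<in>UNIV. act (traj_p j c) (f j) k) = (\<Sum>j\<in>UNIV. if i = j then act \<theta> (f j) k else 0)"
      by (intro sum.cong) (auto simp: traj_p_def)
    then show ?thesis using Inl by (simp add: f)
  next
    case (Inr p)
    have "outp (W k) (- 1) = C *v (x k - z k) + D *v u k"
      using x(2)[of k] Cz[of k] by (simp add: u_def matrix_vector_mult_diff_distrib)
    moreover have "a k $ c = outp (W k) (- 1) $ p" using Inr by (simp add: outp_def W1)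
    ultimately have "a k $ c = (\<Sum>i\<in>UNIV. C $ p $ i * (x k - z k) $ i) + (\<Sum>j\<in>UNIV. D $ p $ j * u k $ j)"
      by (simp add: matrix_vector_mult_def)
    also have "\<dots> = (\<Sum>i\<in>UNIV. \<Sum>j\<in>UNIV. C $ p $ i * act (state_p i j) (f j) k) + (\<Sum>j\<in>UNIV. D $ p $ j * act \<theta> (f j) k)"
      unfolding xh by (simp add: sum_distrib_left f u)
    also have "\<dots> = (\<Sum>j\<in>UNIV. act (traj_p j c) (f j) k)"
      by (subst sum.swap) (simp add: Inr traj_p_def act_transfer_p sum.distrib)
    finally show ?thesis .
  qed
  with fe f00 show ?thesis by (rule that)
qed

lemma taylor_image_behavior:
  assumes f: "\<And>j. exp_bdd (f j)" and a: "\<And>k. a k = (\<chi> c. \<Sum>j\<in>UNIV. act (traj_p j c) (f j) k)"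
  shows "taylor a \<in> behavior R"
proof -
  have ae: "exp_bdd a" by (rule exp_bdd_vec) (simp add: a exp_bdd_sum exp_bdd_act f)
  define F where "F j = (\<lambda>k. taylor (\<lambda>i. f j (i + k)))" for j
  have F: "derivs (F j)" for j unfolding F_def by (rule derivs_taylor[OF f])
  have "taylor a t = (\<Sum>j\<in>UNIV. \<chi> c. act (traj_p j c) (\<lambda>i. F j i t) 0)" for t
  proof (rule vec_eq_iff[THEN iffD2, rule_format])
    fix c
    have "taylor a t $ c = taylor (\<lambda>k. a k $ c) t"
      by (rule taylor_bounded_linear[OF bounded_linear_vec_nth ae])
    also have "\<dots> = (\<Sum>j\<in>UNIV. taylor (act (traj_p j c) (f j)) t)"
      by (simp add: a taylor_sum exp_bdd_act f)
    also have "\<dots> = (\<Sum>j\<in>UNIV. \<chi> c. act (traj_p j c) (\<lambda>i. F j i t) 0) $ c"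
      by (simp add: taylor_act[OF f] F_def sum_component)
    finally show "taylor a t $ c = (\<Sum>j\<in>UNIV. \<chi> c. act (traj_p j c) (\<lambda>i. F j i t) 0) $ c" .
  qed
  then have "taylor a = (\<lambda>t. \<Sum>j\<in>UNIV. \<chi> c. act (traj_p j c) (\<lambda>i. F j i t) 0)" by blast
  then show ?thesis
    using behavior_sum[of UNIV "\<lambda>j t. \<chi> c. act (traj_p j c) (\<lambda>i. F j i t) 0" R] traj_p_behavior[OF F] by simp
qed

text \<open>
  Truncating the Taylor series of the latent variable \<open>f\<close>, and not that of the trajectory itself,
  keeps the approximants inside the behavior.
\<close>

lemma polynomial_approximation:
  fixes a :: "nat \<Rightarrow> real^('m + 'p)"
  assumes a: "exp_bdd a" "taylor a \<in> behavior R" and init: "\<And>k. k < lag A C \<Longrightarrow> a k = 0"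
  obtains H b where "H \<ge> 0" "\<And>N k. k \<ge> N \<Longrightarrow> b N k = 0" "\<And>N. taylor (b N) \<in> behavior R"
    "\<And>N k. k < lag A C \<Longrightarrow> b N k = 0"
    "\<And>N t i. t \<in> {-1..1} \<Longrightarrow> i \<in> {0, lag A C} \<Longrightarrow> norm (taylor (\<lambda>k. b N (k + i) - a (k + i)) t) \<le> H / 2 ^ N"
proof -
  let ?l = "lag A C" let ?n = "degree \<theta>"
  obtain f where fe: "\<And>j. exp_bdd (f j)" and f0: "\<And>j i. i < ?n + ?l \<Longrightarrow> f j i = 0"
    and af: "\<And>k c. a k $ c = (\<Sum>j\<in>UNIV. act (traj_p j c) (f j) k)"
    using image_representation[OF a init] by blast
  define g where "g N j k = (if k < N then f j k else 0)" for N j k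
  have ge: "exp_bdd (g N j)" for N j
    unfolding g_def using exp_bdd_truncate[OF fe, of "\<lambda>k. k < N" j] by simp
  define b :: "nat \<Rightarrow> nat \<Rightarrow> real^('m + 'p)" where "b N k = (\<chi> c. \<Sum>j\<in>UNIV. act (traj_p j c) (g N j) k)" for N k
  have b_high: "b N k = 0" if "k \<ge> N" for N k
    using that by (auto simp: b_def vec_eq_iff g_def intro!: sum.neutral act_eq_0)
  have b_low: "b N k = 0" if "k < ?l" for N k
  proof -
    \<comment> \<open>Derivatives of order below the lag involve only entries of \<open>f\<close>
      below \<open>degree \<theta> + lag A C\<close>, all zero. Hence truncation keeps the initial
      values exact for every \<open>N\<close>.\<close>
    have "act (traj_p j c) (g N j) k = 0" for j c
    proof (rule act_eq_0)
      fix i assume "i \<le> degree (traj_p j c)"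
      then have "i + k < ?n + ?l" using degree_traj_p[of j c] that by linarith
      then show "g N j (i + k) = 0" by (simp add: g_def f0)
    qed
    then show ?thesis by (simp add: b_def vec_eq_iff)
  qed
  have bB: "taylor (b N) \<in> behavior R" for N
    by (rule taylor_image_behavior[OF ge]) (simp add: b_def)
  \<comment> \<open>A majorant independent of \<open>N\<close>: each entry of the truncation error
    of \<open>f\<close> is either 0 or minus the entry itself.\<close>
  define G where "G k = (\<Sum>c\<in>UNIV. \<Sum>j\<in>UNIV. \<Sum>i\<le>degree (traj_p j c). \<bar>coeff (traj_p j c) i\<bar> * \<bar>f j (k + i)\<bar>)" for k
  have "exp_bdd (\<lambda>k. \<bar>f j k\<bar>)" for j using fe[of j] unfolding exp_bdd_def by simp
  then have "exp_bdd G" unfolding G_def[abs_def]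
    by (intro exp_bdd_sum exp_bdd_cmult exp_bdd_shift)
  then obtain K M where KM: "K > 0" "M \<ge> 1" "\<And>k. norm (G k) \<le> K * M ^ k" by (rule exp_bddE) blast
  have G: "norm (b N k - a k) \<le> G k" for N k
  proof -
    have "norm (b N k - a k) \<le> (\<Sum>c\<in>UNIV. \<bar>(b N k - a k) $ c\<bar>)" by (rule norm_le_l1_cart)
    also have "\<dots> \<le> G k" unfolding G_def
    proof (rule sum_mono)
      fix c
      have "(b N k - a k) $ c = (\<Sum>j\<in>UNIV. \<Sum>i\<le>degree (traj_p j c). coeff (traj_p j c) i * (g N j (i + k) - f j (i + k)))"
        by (simp add: b_def af act_def sum_subtractf right_diff_distrib)
      also have "\<bar>\<dots>\<bar> \<le> (\<Sum>j\<in>UNIV. \<Sum>i\<le>degree (traj_p j c). \<bar>coeff (traj_p j c) i * (g N j (i + k) - f j (i + k))\<bar>)"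
        by (intro order_trans[OF sum_abs] sum_mono sum_abs)
      also have "\<dots> \<le> (\<Sum>j\<in>UNIV. \<Sum>i\<le>degree (traj_p j c). \<bar>coeff (traj_p j c) i\<bar> * \<bar>f j (k + i)\<bar>)"
        by (intro sum_mono) (auto simp: abs_mult g_def add.commute intro!: mult_left_mono)
      finally show "\<bar>(b N k - a k) $ c\<bar> \<le> (\<Sum>j\<in>UNIV. \<Sum>i\<le>degree (traj_p j c). \<bar>coeff (traj_p j c) i\<bar> * \<bar>f j (k + i)\<bar>)" .
    qed
    finally show ?thesis .
  qed
  have diff0: "b N k = a k" if "k + ?n < N" for N k
  proof -
    have "act (traj_p j c) (g N j) k = act (traj_p j c) (f j) k" for j c
      unfolding act_def using that degree_traj_p[of j c] by (intro sum.cong) (auto simp: g_def)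
    then show ?thesis by (simp add: b_def vec_eq_iff af)
  qed
  \<comment> \<open>Truncating at \<open>N\<close> leaves derivatives of order below
    \<open>N - degree \<theta>\<close> unchanged, and shifting by \<open>i\<close> loses up to
    \<open>lag A C\<close> more. The power of 2 compensates for both losses, the power of
    \<open>M\<close> for the growth under the shift.\<close>
  let ?H = "K * M ^ ?l * exp (4 * M) * 2 ^ (?n + ?l)"
  have err: "norm (taylor (\<lambda>k. b N (k + i) - a (k + i)) t) \<le> ?H / 2 ^ N"
    if t: "t \<in> {-1..1}" and i: "i \<in> {0, ?l}" for N t i
  proof -
    have "norm (taylor (\<lambda>k. b N (k + i) - a (k + i)) t) \<le> K * M ^ ?l * exp (4 * M) / 2 ^ (N - (?n + ?l))"
    proof (rule norm_taylor_le[OF _ KM(2) _ _ t])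
      fix k
      have "norm (b N (k + i) - a (k + i)) \<le> K * M ^ (k + i)"
        using G[of N "k + i"] KM(3)[of "k + i"] by simp
      also have "\<dots> \<le> K * M ^ (k + ?l)"
        using KM i by (intro mult_left_mono power_increasing) auto
      finally show "norm (b N (k + i) - a (k + i)) \<le> K * M ^ ?l * M ^ k" by (simp add: power_add mult_ac)
    next
      show "0 < K * M ^ ?l" using KM by simp
    next
      fix k assume "k < N - (?n + ?l)"
      then show "b N (k + i) - a (k + i) = 0" using i diff0[of "k + i" N] by auto
    qed
    also have "\<dots> \<le> ?H / 2 ^ N"
    proof -
      have "(2::real) ^ N \<le> 2 ^ (?n + ?l) * 2 ^ (N - (?n + ?l))"
        unfolding power_add[symmetric] by (intro power_increasing) auto
      then have "(K * M ^ ?l * exp (4 * M)) * 2 ^ N \<le> (K * M ^ ?l * exp (4 * M)) * (2 ^ (?n + ?l) * 2 ^ (N - (?n + ?l)))"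
        using KM by (intro mult_left_mono) auto
      then show ?thesis by (simp add: field_simps)
    qed
    finally show ?thesis .
  qed
  show ?thesis
    by (rule that[of ?H b]) (use b_high bB b_low err KM in auto)
qed

end

section \<open>Conclusion\<close>

text \<open>A single term of the exponential series bounds \<open>(ln 2 * N) ^ k / fact k\<close> by
  \<open>2 ^ N\<close>, which gives the constant \<open>fact k / ln 2 ^ k\<close>.\<close>

lemma bigo_of_geometric:
  fixes f :: "nat \<Rightarrow> real"
  assumes "\<And>N. N \<ge> N0 \<Longrightarrow> \<bar>f N\<bar> \<le> H / 2 ^ N"
  shows "f \<in> O(\<lambda>N. 1 / real N ^ k)"
proof (rule bigoI)
  let ?c = "\<bar>H\<bar> * (fact k / ln 2 ^ k)"
  show "\<forall>\<^sub>F N in sequentially. norm (f N) \<le> ?c * norm (1 / real N ^ k)"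
    using eventually_ge_at_top[of "max N0 1"]
  proof eventually_elim
    case (elim N)
    have "(ln 2 * real N) ^ k / fact k \<le> exp (ln 2 * real N)"
      by (rule power_div_fact_le_exp) simp
    then have "(ln 2 * real N) ^ k \<le> fact k * 2 ^ N"
      by (simp add: exp_of_nat_mult field_simps)
    then have "real N ^ k / 2 ^ N \<le> fact k / ln 2 ^ k"
      by (simp add: power_mult_distrib field_simps)
    then have "1 / 2 ^ N \<le> (fact k / ln 2 ^ k) * (1 / real N ^ k)"
      using elim by (simp add: field_simps)
    then have "\<bar>H\<bar> * (1 / 2 ^ N) \<le> \<bar>H\<bar> * ((fact k / ln 2 ^ k) * (1 / real N ^ k))"
      by (rule mult_left_mono) simp
    moreover have "\<bar>f N\<bar> \<le> \<bar>H\<bar> * (1 / 2 ^ N)"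
      using assms[of N] elim abs_ge_self[of H] divide_right_mono[of H "\<bar>H\<bar>" "2 ^ N"] by simp
    ultimately show ?case by simp
  qed
qed

lemma cost_0_eq_0:
  assumes w: "w \<in> L2" and c: "cost 0 w = 0"
  shows "AE t in mI. w t = 0"
proof -
  have "has_weak_deriv 0 (inp w) (inp w)" by (simp add: has_weak_deriv_iff)
  then have "LI (\<lambda>t. (norm (outp w t))\<^sup>2) + LI (\<lambda>t. (norm (inp w t))\<^sup>2) = 0"
    using cost_eq[OF _ inp_L2[OF w], of 0 w] c by simp
  moreover have "integr (\<lambda>t. (norm (outp w t))\<^sup>2)" "integr (\<lambda>t. (norm (inp w t))\<^sup>2)"
    using inp_L2[OF w] outp_L2[OF w] by (auto simp: L2_def)
  ultimately have "LI (\<lambda>t. (norm (w t))\<^sup>2) = 0"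
    unfolding norm_inp_outp[of w] by simp
  then have "AE t in mI. (norm (w t))\<^sup>2 = 0"
    using w by (subst (asm) integral_nonneg_eq_0_iff_AE) (auto simp: L2_def)
  then show ?thesis by eventually_elim simp
qed

lemma solves_P_cong_AE:
  assumes w: "solves_P (behavior R) l \<xi> w" and ae: "AE t in mI. w t = v t" and v: "v \<in> L2"
  shows "solves_P (behavior R) l \<xi> v"
proof -
  have feas: "w \<in> behavior R" "w \<in> sobolev l" "Lambda_left l w = \<xi>"
    using w unfolding solves_P_def is_arg_min_linorder by auto
  note wL = sobolev_L2[OF feas(2)]
  show ?thesis
    using w behavior_cong_AE[OF ae feas(1) v] sobolev_cong_AE[OF ae wL v] Lambda_left_cong_AE[OF ae wL v] cost_cong_AE[OF ae wL v]
    unfolding solves_P_def is_arg_min_linorder by auto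
qed

text \<open>All functions are replaced by Taylor representatives, \<open>a\<close> for the minimizer
  and \<open>b N\<close> for the discrete solutions. The gap in cost then equals the cost of the
  difference, which also controls the distance; a competitor of order \<open>N\<close> bounds it
  from above.\<close>

lemma (in iso_behavior) geometric_convergence:
  assumes l: "l = lag A C" "l > 0" and ws: "solves_P (behavior R) l \<xi> ws"
    and wN: "\<And>N. N \<ge> N0 \<Longrightarrow> solves_PN (behavior R) l \<xi> N (wN N)"
  obtains H where "\<And>N. N \<ge> N0 \<Longrightarrow> 0 \<le> cost l (wN N) - cost l ws"
    "\<And>N. N \<ge> N0 \<Longrightarrow> cost l (wN N) - cost l ws \<le> H / 2 ^ N"
    "\<And>N. N \<ge> N0 \<Longrightarrow> L2_norm (\<lambda>t. ws t - wN N t) \<le> H / 2 ^ N"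
proof -
  obtain a where a: "exp_bdd a" "AE t in mI. ws t = taylor a t"
    using minimizer_regular[OF ws l(2)] by blast
  have dse: "derivs (\<lambda>k. taylor (\<lambda>i. c (i + k)))" if "exp_bdd c" for c :: "nat \<Rightarrow> real^('m + 'p)"
    by (rule derivs_taylor[OF that])
  have eL2: "taylor c \<in> L2" if "exp_bdd c" for c :: "nat \<Rightarrow> real^('m + 'p)"
    using derivs_L2[OF dse[OF that], of 0] by simp
  have wsL: "ws \<in> L2" using ws unfolding solves_P_def is_arg_min_linorder by (auto intro: sobolev_L2)
  have P: "solves_P (behavior R) l \<xi> (taylor a)" by (rule solves_P_cong_AE[OF ws a(2) eL2[OF a(1)]])
  have cost_ws: "cost l ws = cost l (taylor a)" by (rule cost_cong_AE[OF a(2) wsL eL2[OF a(1)]])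
  have eL: "Lambda_left l (taylor c) = map c [0..<l]" if "exp_bdd c" for c :: "nat \<Rightarrow> real^('m + 'p)"
    using Lambda_left_derivs[OF dse[OF that], of l] by (simp add: taylor_at_left)
  have aB: "taylor a \<in> behavior R" and a\<xi>: "map a [0..<l] = \<xi>"
    using P eL[OF a(1)] unfolding solves_P_def is_arg_min_linorder by auto
  define b where "b N = (SOME b. (\<forall>k\<ge>N. b k = 0) \<and> (AE t in mI. wN N t = taylor b t))" for N
  have "(\<forall>k\<ge>N. b N k = 0) \<and> (AE t in mI. wN N t = taylor (b N) t)" if N: "N \<ge> N0" for N
  proof -
    have "wN N \<in> im_P N" using wN[OF N] unfolding solves_PN_def is_arg_min_linorder by auto
    then have "\<exists>b. (\<forall>k\<ge>N. b k = 0) \<and> (AE t in mI. wN N t = taylor b t)"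
      by (rule im_P_taylor) blast
    from someI_ex[OF this] show ?thesis unfolding b_def .
  qed
  then have b: "b N k = 0" "AE t in mI. wN N t = taylor (b N) t" if "N \<ge> N0" "k \<ge> N" for N k
    using that by auto
  have b2: "AE t in mI. wN N t = taylor (b N) t" if "N \<ge> N0" for N
    using b(2)[OF that order_refl] .
  have be: "exp_bdd (b N)" if "N \<ge> N0" for N by (rule exp_bdd_finite_support[of N]) (use b(1)[OF that] in auto)
  have wNL: "wN N \<in> L2" and wNB: "wN N \<in> behavior R" and wN\<xi>: "Lambda_left l (wN N) = \<xi>"
    and wN_min: "\<And>v. v \<in> behavior R \<Longrightarrow> v \<in> im_P N \<Longrightarrow> Lambda_left l v = \<xi> \<Longrightarrow> cost l (wN N) \<le> cost l v" if "N \<ge> N0" for N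
    using wN[OF that] unfolding solves_PN_def is_arg_min_linorder by (auto simp: behavior_iff)
  have bB: "taylor (b N) \<in> behavior R" if "N \<ge> N0" for N
    by (rule behavior_cong_AE[OF b2 wNB eL2[OF be]]) (use that in auto)
  have b\<xi>: "map (b N) [0..<l] = \<xi>" if "N \<ge> N0" for N
    using Lambda_left_cong_AE[OF b2[OF that] wNL[OF that] eL2[OF be[OF that]], of l] wN\<xi>[OF that] eL[OF be[OF that]] by simp
  have cost_wN: "cost l (wN N) = cost l (taylor (b N))" if "N \<ge> N0" for N
    by (rule cost_cong_AE[OF b2[OF that] wNL[OF that] eL2[OF be[OF that]]])
  have init: "a k = b N k" if "N \<ge> N0" "k < l" for N k
  proof -
    have "map a [0..<l] = map (b N) [0..<l]" using a\<xi> b\<xi>[OF that(1)] by simp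
    then show ?thesis using that(2) unfolding map_eq_conv by auto
  qed
  have diffB: "taylor (\<lambda>k. c k - c' k) \<in> behavior R" if "exp_bdd c" "exp_bdd c'" "taylor c \<in> behavior R" "taylor c' \<in> behavior R" for c c' :: "nat \<Rightarrow> real^('m + 'p)"
  proof -
    have "taylor (\<lambda>k. c k - c' k) = (\<lambda>t. taylor c t + (- 1) *\<^sub>R taylor c' t)"
      using that by (auto simp: taylor_diff)
    then show ?thesis using behavior_add_scaleR[OF that(3,4), of "- 1"] by simp
  qed
  have variation: "cost l (taylor c) = cost l (taylor a) + cost l (taylor (\<lambda>k. c k - a k))"
    if c: "exp_bdd c" "taylor c \<in> behavior R" "\<And>k. k < l \<Longrightarrow> c k = a k" for c
  proof -
    have e: "exp_bdd (\<lambda>k. c k - a k)" by (intro exp_bdd_diff c a)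
    have "cost l (\<lambda>t. taylor a t + taylor (\<lambda>k. c k - a k) t) = cost l (taylor a) + cost l (taylor (\<lambda>k. c k - a k))"
      using solves_P_variation(2)[OF P dse[OF e]] diffB[OF c(1) a(1) c(2) aB] c(3) by (simp add: taylor_at_left)
    moreover have "(\<lambda>t. taylor a t + taylor (\<lambda>k. c k - a k) t) = taylor c"
      using c(1) a(1) by (auto simp: taylor_diff)
    ultimately show ?thesis by simp
  qed
  \<comment> \<open>Difference to the discrete solution of order \<open>N0\<close>, with vanishing
    initial values. One decomposition serves all \<open>N\<close>, so the constant \<open>H\<close>
    does not depend on \<open>N\<close>.\<close>
  define d where "d = (\<lambda>k. a k - b N0 k)"
  have d: "exp_bdd d" "taylor d \<in> behavior R" "\<And>k. k < lag A C \<Longrightarrow> d k = 0"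
    unfolding d_def using a(1) aB be bB diffB init l(1) by (auto intro: exp_bdd_diff)
  obtain H q where q: "H \<ge> 0" "\<And>N k. k \<ge> N \<Longrightarrow> q N k = 0" "\<And>N. taylor (q N) \<in> behavior R"
    "\<And>N k. k < l \<Longrightarrow> q N k = 0"
    "\<And>N t i. t \<in> {-1..1} \<Longrightarrow> i \<in> {0, l} \<Longrightarrow> norm (taylor (\<lambda>k. q N (k + i) - d (k + i)) t) \<le> H / 2 ^ N"
    using polynomial_approximation[OF d] unfolding l(1) by blast
  have qe: "exp_bdd (q N)" for N by (rule exp_bdd_finite_support[of N]) (rule q(2))
  have upper: "cost l (wN N) - cost l ws \<le> 4 * (H / 2 ^ N)\<^sup>2" if N: "N \<ge> N0" for N
  proof -
    \<comment> \<open>The competitor of order \<open>N\<close>: since \<open>N \<ge> N0\<close>,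
      adding the fixed polynomial does not leave \<open>im_P N\<close>.\<close>
    define c where "c = (\<lambda>k. b N0 k + q N k)"
    have ce: "exp_bdd c" unfolding c_def using be qe by (intro exp_bdd_add) auto
    have cB: "taylor c \<in> behavior R"
    proof -
      have "taylor c = (\<lambda>t. taylor (b N0) t + 1 *\<^sub>R taylor (q N) t)" by (auto simp: c_def taylor_add be qe)
      then show ?thesis using behavior_add_scaleR[OF bB q(3), of N0 1 N] by simp
    qed
    have ca: "c k = a k" if "k < l" for k using init[of N0 k] that q(4) by (simp add: c_def)
    have "Lambda_left l (taylor c) = \<xi>"
      unfolding eL[OF ce] a\<xi>[symmetric] using ca by simp
    moreover have "taylor c \<in> im_P N"
      by (rule taylor_im_P) (use N b(1)[of N0] q(2) in \<open>auto simp: c_def\<close>)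
    ultimately have "cost l (wN N) \<le> cost l (taylor c)" by (intro wN_min[OF N] cB)
    also have "\<dots> = cost l ws + cost l (taylor (\<lambda>k. c k - a k))"
      using variation[OF ce cB ca] cost_ws by simp
    also have "(\<lambda>k. c k - a k) = (\<lambda>k. q N k - d k)" by (auto simp: c_def d_def)
    also have "cost l (taylor (\<lambda>k. q N k - d k)) \<le> 4 * (H / 2 ^ N)\<^sup>2"
      using cost_le_of_bound[OF dse[OF exp_bdd_diff[OF qe[of N] d(1)]], where l = l and H = "H / 2 ^ N"] q(5)[where N = N] by simp
    finally show ?thesis by simp
  qed
  have gap: "cost l (wN N) - cost l ws = cost l (taylor (\<lambda>k. b N k - a k))" if N: "N \<ge> N0" for N
    using variation[OF be[OF N] bB[OF N]] init[OF N] by (simp add: cost_wN[OF N] cost_ws)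
  have dist: "L2_norm (\<lambda>t. ws t - wN N t) \<le> 2 ^ l * (2 * H) / 2 ^ N" if N: "N \<ge> N0" for N
  proof -
    have e: "exp_bdd (\<lambda>k. b N k - a k)" by (intro exp_bdd_diff be[OF N] a(1))
    have "L2_norm (\<lambda>t. ws t - wN N t) = L2_norm (\<lambda>t. (- 1) *\<^sub>R taylor (\<lambda>k. b N k - a k) t)"
    proof (rule L2_norm_cong_AE)
      show "AE t in mI. ws t - wN N t = (- 1) *\<^sub>R taylor (\<lambda>k. b N k - a k) t"
        using a(2) b2[OF N] by eventually_elim (simp add: taylor_diff be[OF N] a(1))
    qed (intro L2_diff wsL wNL[OF N] L2_scaleR eL2[OF e])+
    also have "\<dots> = L2_norm (taylor (\<lambda>k. b N k - a k))" by (simp add: L2_norm_def)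
    finally have eq: "L2_norm (\<lambda>t. ws t - wN N t) = L2_norm (taylor (\<lambda>k. b N k - a k))" .
    have "(L2_norm (taylor (\<lambda>k. b N k - a k)))\<^sup>2 \<le> 4 ^ l * cost l (taylor (\<lambda>k. b N k - a k))"
      using L2_norm_le_cost[OF dse[OF e], of l] init[OF N] by (simp add: taylor_at_left)
    also have "\<dots> \<le> 4 ^ l * (4 * (H / 2 ^ N)\<^sup>2)"
      using upper[OF N] gap[OF N] by (intro mult_left_mono) auto
    also have "\<dots> = (2 ^ l * (2 * H) / 2 ^ N)\<^sup>2"
      by (simp add: power_mult_distrib power_divide power_even_eq[symmetric] power_mult[symmetric] mult.commute[of l])
        (simp add: power_mult)
    finally show ?thesis unfolding eq by (rule power2_le_imp_le) (use q(1) in simp)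
  qed
  have sq: "4 * (H / 2 ^ N)\<^sup>2 \<le> 4 * H\<^sup>2 / 2 ^ N" for N
  proof -
    have "H\<^sup>2 / (2 ^ N)\<^sup>2 \<le> H\<^sup>2 / 2 ^ N"
      by (intro divide_left_mono) (auto simp: power2_eq_square)
    then show ?thesis by (simp add: power_divide)
  qed
  show ?thesis
  proof (rule that[of "max (4 * H\<^sup>2) (2 ^ l * (2 * H))"])
    fix N assume N: "N \<ge> N0"
    show "0 \<le> cost l (wN N) - cost l ws" unfolding gap[OF N] by (rule cost_nonneg)
    show "cost l (wN N) - cost l ws \<le> max (4 * H\<^sup>2) (2 ^ l * (2 * H)) / 2 ^ N"
      using upper[OF N] sq[of N] divide_right_mono[of "4 * H\<^sup>2" "max (4 * H\<^sup>2) (2 ^ l * (2 * H))" "2 ^ N"] by simp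
    show "L2_norm (\<lambda>t. ws t - wN N t) \<le> max (4 * H\<^sup>2) (2 ^ l * (2 * H)) / 2 ^ N"
      using dist[OF N] divide_right_mono[of "2 ^ l * (2 * H)" "max (4 * H\<^sup>2) (2 ^ l * (2 * H))" "2 ^ N"] by simp
  qed
qed

text \<open>The zero trajectory is feasible in both problems, and the cost without differentiation
  is the full squared norm; so both solutions vanish almost everywhere.\<close>

lemma lag_0_convergence:
  fixes ws wN :: "real \<Rightarrow> real^('m::finite + 'p::finite)"
  assumes ws: "solves_P (behavior R) 0 [] ws" and wN: "solves_PN (behavior R) 0 [] N wN"
  shows "cost 0 ws = 0" "cost 0 wN = 0" "L2_norm (\<lambda>t. ws t - wN t) = 0"
proof -
  have c0: "cost 0 (\<lambda>t. 0 :: real^('m + 'p)) = 0"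
    using cost_derivs[OF derivs_0, of 0] by (simp add: inp_def outp_def zero_vec_def[symmetric])
  have z: "(\<lambda>t. 0) \<in> behavior R" "(\<lambda>t. 0) \<in> sobolev 0" "(\<lambda>t. 0 :: real^('m + 'p)) \<in> im_P N" "Lambda_left 0 w = []" for w :: "real \<Rightarrow> real^('m + 'p)"
    using behavior_zero derivs_sobolev[OF derivs_0] taylor_im_P[of N "\<lambda>_. 0"] by (auto simp: Lambda_left_def taylor_zero[abs_def])
  have L: "ws \<in> L2" "wN \<in> L2"
    using ws wN unfolding solves_P_def solves_PN_def is_arg_min_linorder by (auto simp: behavior_iff)
  have "cost 0 ws \<le> 0" "cost 0 wN \<le> 0"
    using ws wN z c0 unfolding solves_P_def solves_PN_def is_arg_min_linorder by fastforce+
  then show c: "cost 0 ws = 0" "cost 0 wN = 0" using cost_nonneg by (auto intro: antisym)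
  have "L2_norm (\<lambda>t. ws t - wN t) = L2_norm (\<lambda>t. 0 :: real^('m + 'p))"
  proof (rule L2_norm_cong_AE)
    show "AE t in mI. ws t - wN t = 0"
      using cost_0_eq_0[OF L(1) c(1)] cost_0_eq_0[OF L(2) c(2)] by eventually_elim simp
  qed (auto intro: L2_diff L continuous_L2)
  then show "L2_norm (\<lambda>t. ws t - wN t) = 0" by (simp add: L2_norm_def)
qed

text \<open>The discrete problem may be infeasible for small \<open>N\<close>, so solutions are
  assumed from some \<open>N0\<close> on; the values of \<open>wN\<close> below \<open>N0\<close>
  are arbitrary and do not affect the asymptotics.\<close>

theorem theorem12:
  fixes R :: "(real^('m::finite + 'p::finite)^'g::finite) poly"
    and A :: "real^'n::finite^'n" and B :: "real^'m^'n"
    and C :: "real^'n^'p" and D :: "real^'m^'p"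
    and \<BB> :: "(real \<Rightarrow> real^('m + 'p)) set"
    and \<xi> :: "(real^('m + 'p)) list"
    and l N0 :: nat
    and wstar :: "real \<Rightarrow> real^('m + 'p)"
    and wN :: "nat \<Rightarrow> real \<Rightarrow> real^('m + 'p)"
  assumes "\<BB> = behavior R"
    and "iso_representation A B C D \<BB>"
    and "l = lag A C"
    and "length \<xi> = l"
    and "solves_P \<BB> l \<xi> wstar"
    and "\<And>N. N \<ge> N0 \<Longrightarrow> solves_PN \<BB> l \<xi> N (wN N)"
  shows "(\<forall>N\<ge>N0. 0 \<le> cost l (wN N) - cost l wstar) \<and>
    (\<forall>k::nat. (\<lambda>N. cost l (wN N) - cost l wstar) \<in> O(\<lambda>N. 1 / real N ^ k) \<and>
              (\<lambda>N. L2_norm (\<lambda>t. wstar t - wN N t)) \<in> O(\<lambda>N. 1 / real N ^ k))"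
proof -
  have ws: "solves_P (behavior R) l \<xi> wstar" and wN: "\<And>N. N \<ge> N0 \<Longrightarrow> solves_PN (behavior R) l \<xi> N (wN N)"
    using assms by auto
  have "\<exists>H. \<forall>N\<ge>N0. 0 \<le> cost l (wN N) - cost l wstar \<and> cost l (wN N) - cost l wstar \<le> H / 2 ^ N \<and>
      L2_norm (\<lambda>t. wstar t - wN N t) \<le> H / 2 ^ N"
  proof (cases "l = 0")
    case True
    then have "\<xi> = []" using assms(4) by simp
    then have "cost l wstar = 0 \<and> cost l (wN N) = 0 \<and> L2_norm (\<lambda>t. wstar t - wN N t) = 0" if "N \<ge> N0" for N
      using lag_0_convergence[of R wstar N "wN N"] ws wN[OF that] True by simp
    then show ?thesis by (intro exI[of _ 0]) simp
  next
    case False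
    obtain \<theta> S where "iso_system A \<theta> S" by (rule iso_system_exists)
    then interpret iso_behavior A B C D \<theta> S R
      using assms(1,2) by (simp add: iso_behavior_def iso_behavior_axioms_def)
    show ?thesis
      by (rule geometric_convergence[OF assms(3) _ ws wN]) (use False in blast)+
  qed
  then obtain H where H: "\<And>N. N \<ge> N0 \<Longrightarrow> 0 \<le> cost l (wN N) - cost l wstar"
    "\<And>N. N \<ge> N0 \<Longrightarrow> cost l (wN N) - cost l wstar \<le> H / 2 ^ N"
    "\<And>N. N \<ge> N0 \<Longrightarrow> L2_norm (\<lambda>t. wstar t - wN N t) \<le> H / 2 ^ N"
    by blast
  show ?thesis
  proof (intro conjI allI impI)
    fix k
    show "(\<lambda>N. cost l (wN N) - cost l wstar) \<in> O(\<lambda>N. 1 / real N ^ k)"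
      by (rule bigo_of_geometric[of N0 _ H]) (use H(1,2) in simp)
    show "(\<lambda>N. L2_norm (\<lambda>t. wstar t - wN N t)) \<in> O(\<lambda>N. 1 / real N ^ k)"
      by (rule bigo_of_geometric[of N0 _ H]) (use H(3) in simp)
  qed (rule H(1))
qed

end
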